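(* For every $n\ge1$, the action of $\mathfrak{S}_{n+1}$ on $\operatorname{Zinb}(n)$ given by the anticyclic structure of $\operatorname{Zinb}$ is isomorphic to the Lie module $\operatorname{Lie}(n+1)$.
   Context: All vector spaces are over $\mathbb{Q}$. The symmetric group $\mathfrak{S}_n$ acts on $\mathcal{P}(n)$ by $(\sigma\cdot E)(x_1,\dots,x_n)=E(x_{\sigma(1)},\dots,x_{\sigma(n)})$. An anticyclic operad is a symmetric operad $\mathcal{P}$ (unit $1\in\mathcal{P}(1)$, partial compositions $\circ_i$) together with an action of $\mathfrak{S}_{n+1}$ on each $\mathcal{P}(n)$ extending the action of $\mathfrak{S}_n$ (the stabilizer of $n+1$), such that, writing $\tau_n$ for the action of the long cycle $(n+1,n,\dots,2,1)$ ($1\mapsto n+1$, $i\mapsto i-1$ for $i\ge 2$): $\tau_1(1)=-1$ and, for $f\in\mathcal{P}(m)$, $g\in\mathcal{P}(n)$, $\tau(f\circ_i g)=\tau_m(f)\circ_{i-1}g$ for $2\le i\le m$ and $\tau(f\circ_1 g)=-\tau_n(g)\circ_n\tau_m(f)$. A morphism of anticyclic operads is a morphism of operads commuting with the actions of $\mathfrak{S}_{n+1}$. A non-symmetric anticyclic operad is a non-symmetric operad with endomorphisms $\tau_n$ of $\mathcal{P}(n)$ satisfying $\tau_n^{n+1}=\mathrm{Id}$ and these same identities. If $\mathcal{P}$ is a non-symmetric anticyclic operad, the symmetric operad with components $\mathcal{P}(n)\otimes\mathbb{Q}\mathfrak{S}_n\cong\operatorname{Ind}_{\mathbb{Z}/(n+1)\mathbb{Z}}^{\mathfrak{S}_{n+1}}\mathcal{P}(n)$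 is naturally an anticyclic operad, with $\tau_n(E\otimes 1)=\tau_n(E)\otimes 1$. The non-symmetric operad $\operatorname{Dend}$ is generated by binary operations $x\prec y$, $x\succ y$ with relations $(x\prec y)\prec z=x\prec(y\prec z)+x\prec(y\succ z)$, $x\succ(y\prec z)=(x\succ y)\prec z$, $x\succ(y\succ z)=(x\succ y)\succ z+(x\prec y)\succ z$. It is a non-symmetric anticyclic operad with the unique structure such that $\tau_1=-\mathrm{Id}$, $\tau_2(x_1\succ x_2)=x_1\prec x_2$, $\tau_2(x_1\prec x_2)=-x_1\prec x_2-x_1\succ x_2$. We also write $\operatorname{Dend}$ for the associated (symmetric) anticyclic operad. $\operatorname{Zinb}$ is the quotient of the symmetric operad $\operatorname{Dend}$ by the ideal generated by $x_1\prec x_2-x_2\succ x_1$; denoting by $x_1x_2$ the image of $x_1\prec x_2$, it is generated by the binary product $xy$ (no symmetry) with relation $(xy)z=x(yz)+x(zy)$. It carries the unique anticyclic operad structure for which the quotient map from $\operatorname{Dend}$ is a morphism of anticyclic operads. $\operatorname{Lie}(n+1)$ is the arity $n+1$ component of the Lie operad, i.e. the multilinear part of the free Lie algebra on $x_1,\dots,x_{n+1}$, with $\mathfrak{S}_{n+1}$ permuting the variables. *)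

theory Defs
  imports Complex_Main "HOL-Library.Poly_Mapping" "HOL-Combinatorics.Permutations"
begin

section \<open>Rational vector spaces\<close>

class rat_vector = ab_group_add +
  fixes scaleQ :: "rat \<Rightarrow> 'a \<Rightarrow> 'a"  (infixr \<open>*\<^sub>Q\<close> 75)
  assumes scaleQ_add_right: "a *\<^sub>Q (x + y) = a *\<^sub>Q x + a *\<^sub>Q y"
    and scaleQ_add_left: "(a + b) *\<^sub>Q x = a *\<^sub>Q x + b *\<^sub>Q x"
    and scaleQ_scaleQ: "a *\<^sub>Q b *\<^sub>Q x = (a * b) *\<^sub>Q x"
    and scaleQ_one: "1 *\<^sub>Q x = x"

global_interpretation rat_vector: vector_space "scaleQ :: rat \<Rightarrow> 'a \<Rightarrow> 'a::rat_vector"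
  by unfold_locales (simp_all add: scaleQ_add_right scaleQ_add_left scaleQ_scaleQ scaleQ_one)

instantiation rat :: rat_vector
begin
definition scaleQ_rat :: "rat \<Rightarrow> rat \<Rightarrow> rat" where "scaleQ_rat a x = a * x"
instance by standard (simp_all add: scaleQ_rat_def algebra_simps)
end

instantiation poly_mapping :: (type, rat_vector) rat_vector
begin
lift_definition scaleQ_poly_mapping :: "rat \<Rightarrow> ('a \<Rightarrow>\<^sub>0 'b) \<Rightarrow> ('a \<Rightarrow>\<^sub>0 'b)"
  is "\<lambda>c f x. c *\<^sub>Q f x"
  by (erule finite_subset[rotated]) auto
instance
  by standard
    (transfer; simp add: fun_eq_iff scaleQ_add_right scaleQ_add_left scaleQ_scaleQ scaleQ_one)+
end

definition linear_between :: "'a::rat_vector set \<Rightarrow> 'b::rat_vector set \<Rightarrow> ('a \<Rightarrow> 'b) \<Rightarrow> bool" where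
  "linear_between A B h \<longleftrightarrow> h ` A \<subseteq> B \<and> (\<forall>x\<in>A. \<forall>y\<in>A. h (x + y) = h x + h y)
     \<and> (\<forall>c. \<forall>x\<in>A. h (c *\<^sub>Q x) = c *\<^sub>Q h x)"

text \<open>\<open>'a \<Rightarrow>\<^sub>0 rat\<close> is the vector space with basis \<open>'a\<close>; \<open>basis_vec t\<close> is the basis
  element \<open>t\<close> and \<open>bilin_ext f\<close> the bilinear extension of \<open>f\<close>.\<close>

definition basis_vec :: "'a \<Rightarrow> ('a \<Rightarrow>\<^sub>0 rat)" where
  "basis_vec t = Poly_Mapping.single t 1"

definition bilin_ext :: "('a \<Rightarrow> 'b \<Rightarrow> 'c) \<Rightarrow> ('a \<Rightarrow>\<^sub>0 rat) \<Rightarrow> ('b \<Rightarrow>\<^sub>0 rat) \<Rightarrow> ('c \<Rightarrow>\<^sub>0 rat)" where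
  "bilin_ext f x y = (\<Sum>a\<in>Poly_Mapping.keys x. \<Sum>b\<in>Poly_Mapping.keys y.
     Poly_Mapping.single (f a b) (Poly_Mapping.lookup x a * Poly_Mapping.lookup y b))"


section \<open>Representations of symmetric groups\<close>

text \<open>The symmetric group on \<open>N\<close> letters is \<open>{\<sigma>. \<sigma> permutes {1..N}}\<close>; \<open>\<rho>\<close> is a linear left
  action of it on the subspace \<open>A\<close>.\<close>

definition sym_rep :: "nat \<Rightarrow> 'a::rat_vector set \<Rightarrow> ((nat \<Rightarrow> nat) \<Rightarrow> 'a \<Rightarrow> 'a) \<Rightarrow> bool" where
  "sym_rep N A \<rho> \<longleftrightarrow> rat_vector.subspace A
     \<and> (\<forall>\<sigma>. \<sigma> permutes {1..N} \<longrightarrow> linear_between A A (\<rho> \<sigma>))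
     \<and> (\<forall>x\<in>A. \<rho> id x = x)
     \<and> (\<forall>\<sigma> \<pi>. \<sigma> permutes {1..N} \<longrightarrow> \<pi> permutes {1..N} \<longrightarrow>
          (\<forall>x\<in>A. \<rho> (\<sigma> \<circ> \<pi>) x = \<rho> \<sigma> (\<rho> \<pi> x)))"

definition sym_rep_iso :: "nat \<Rightarrow> 'a::rat_vector set \<Rightarrow> ((nat \<Rightarrow> nat) \<Rightarrow> 'a \<Rightarrow> 'a)
    \<Rightarrow> 'b::rat_vector set \<Rightarrow> ((nat \<Rightarrow> nat) \<Rightarrow> 'b \<Rightarrow> 'b) \<Rightarrow> bool" where
  "sym_rep_iso N A \<rho> B \<rho>' \<longleftrightarrow> sym_rep N A \<rho> \<and> sym_rep N B \<rho>' \<and>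
     (\<exists>\<phi>. linear_between A B \<phi> \<and> bij_betw \<phi> A B
        \<and> (\<forall>\<sigma>. \<sigma> permutes {1..N} \<longrightarrow> (\<forall>x\<in>A. \<phi> (\<rho> \<sigma> x) = \<rho>' \<sigma> (\<phi> x))))"


section \<open>Operads\<close>

text \<open>The components \<open>arity_space P n\<close>, \<open>n \<ge> 1\<close>, are subspaces of one ambient space; the arity 0
  component is never used. \<open>pcomp P m n i f g\<close> is \<open>f \<circ>\<^sub>i g\<close> for \<open>f\<close> of arity \<open>m\<close>
  and \<open>g\<close> of arity \<open>n\<close>. All the functions below are meaningful only for arguments in the
  indicated components and for \<open>1 \<le> i \<le> m\<close>.\<close>

record 'a ns_operad =
  arity_space :: "nat \<Rightarrow> 'a set"
  op_unit :: 'a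
  pcomp :: "nat \<Rightarrow> nat \<Rightarrow> nat \<Rightarrow> 'a \<Rightarrow> 'a \<Rightarrow> 'a"

record 'a operad = "'a ns_operad" +
  op_act :: "nat \<Rightarrow> (nat \<Rightarrow> nat) \<Rightarrow> 'a \<Rightarrow> 'a"

locale ns_operad =
  fixes P :: "('a::rat_vector, 'm) ns_operad_scheme"
  assumes subspace: "n \<ge> 1 \<Longrightarrow> rat_vector.subspace (arity_space P n)"
    and unit_mem: "op_unit P \<in> arity_space P 1"
    and pcomp_linear_left: "\<lbrakk>m \<ge> 1; n \<ge> 1; 1 \<le> i; i \<le> m; g \<in> arity_space P n\<rbrakk>
      \<Longrightarrow> linear_between (arity_space P m) (arity_space P (m + n - 1)) (\<lambda>f. pcomp P m n i f g)"
    and pcomp_linear_right: "\<lbrakk>m \<ge> 1; n \<ge> 1; 1 \<le> i; i \<le> m; f \<in> arity_space P m\<rbrakk>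
      \<Longrightarrow> linear_between (arity_space P n) (arity_space P (m + n - 1)) (\<lambda>g. pcomp P m n i f g)"
    and unit_left: "\<lbrakk>n \<ge> 1; g \<in> arity_space P n\<rbrakk> \<Longrightarrow> pcomp P 1 n 1 (op_unit P) g = g"
    and unit_right: "\<lbrakk>m \<ge> 1; 1 \<le> i; i \<le> m; f \<in> arity_space P m\<rbrakk>
      \<Longrightarrow> pcomp P m 1 i f (op_unit P) = f"
    and assoc_nested: "\<lbrakk>l \<ge> 1; m \<ge> 1; n \<ge> 1; 1 \<le> i; i \<le> l; 1 \<le> j; j \<le> m;
        f \<in> arity_space P l; g \<in> arity_space P m; h \<in> arity_space P n\<rbrakk>
      \<Longrightarrow> pcomp P (l + m - 1) n (i + j - 1) (pcomp P l m i f g) h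
          = pcomp P l (m + n - 1) i f (pcomp P m n j g h)"
    and assoc_parallel: "\<lbrakk>l \<ge> 1; m \<ge> 1; n \<ge> 1; 1 \<le> i; i < k; k \<le> l;
        f \<in> arity_space P l; g \<in> arity_space P m; h \<in> arity_space P n\<rbrakk>
      \<Longrightarrow> pcomp P (l + m - 1) n (k + m - 1) (pcomp P l m i f g) h
          = pcomp P (l + n - 1) m i (pcomp P l n k f h) g"

text \<open>With \<open>(\<sigma> \<cdot> E)(x\<^sub>1, \<dots>, x\<^sub>n) = E(x\<^bsub>\<sigma>(1)\<^esub>, \<dots>, x\<^bsub>\<sigma>(n)\<^esub>)\<close>, one has
  \<open>(\<sigma> \<cdot> f) \<circ>\<^bsub>\<sigma>(j)\<^esub> (\<rho> \<cdot> g) = \<theta> \<cdot> (f \<circ>\<^sub>j g)\<close>, where \<open>\<theta> = block_perm n j \<sigma> \<rho>\<close>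
  and \<open>n\<close> is the arity of \<open>g\<close>: the positions \<open>j, \<dots>, j + n - 1\<close> of \<open>f \<circ>\<^sub>j g\<close> receive the
  variables \<open>\<sigma> j + \<rho> q - 1\<close>, and the variables of \<open>f\<close> beyond \<open>\<sigma> j\<close> are shifted by \<open>n - 1\<close>.\<close>

definition block_perm :: "nat \<Rightarrow> nat \<Rightarrow> (nat \<Rightarrow> nat) \<Rightarrow> (nat \<Rightarrow> nat) \<Rightarrow> nat \<Rightarrow> nat" where
  "block_perm n j \<sigma> \<rho> p =
     (let shift = (\<lambda>q. if q < \<sigma> j then q else q + n - 1)
      in if p < j then shift (\<sigma> p)
         else if p < j + n then \<sigma> j + \<rho> (p + 1 - j) - 1
         else shift (\<sigma> (p + 1 - n)))"

locale operad = ns_operad P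
  for P :: "('a::rat_vector, 'm) operad_scheme" +
  assumes act_rep: "n \<ge> 1 \<Longrightarrow> sym_rep n (arity_space P n) (op_act P n)"
    and equivariant: "\<lbrakk>m \<ge> 1; n \<ge> 1; 1 \<le> j; j \<le> m; \<sigma> permutes {1..m}; \<rho> permutes {1..n};
        f \<in> arity_space P m; g \<in> arity_space P n\<rbrakk>
      \<Longrightarrow> pcomp P m n (\<sigma> j) (op_act P m \<sigma> f) (op_act P n \<rho> g)
          = op_act P (m + n - 1) (block_perm n j \<sigma> \<rho>) (pcomp P m n j f g)"


section \<open>Anticyclic operads\<close>

definition long_cycle :: "nat \<Rightarrow> nat \<Rightarrow> nat" where
  "long_cycle n i = (if i = 1 then n + 1 else if 2 \<le> i \<and> i \<le> n + 1 then i - 1 else i)"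

definition anticyclic_identities ::
  "('a::rat_vector, 'm) ns_operad_scheme \<Rightarrow> (nat \<Rightarrow> 'a \<Rightarrow> 'a) \<Rightarrow> bool" where
  "anticyclic_identities P \<tau> \<longleftrightarrow>
     \<tau> 1 (op_unit P) = - op_unit P \<and>
     (\<forall>m n f g. m \<ge> 1 \<longrightarrow> n \<ge> 1 \<longrightarrow> f \<in> arity_space P m \<longrightarrow> g \<in> arity_space P n \<longrightarrow>
        (\<forall>i. 2 \<le> i \<and> i \<le> m \<longrightarrow>
           \<tau> (m + n - 1) (pcomp P m n i f g) = pcomp P m n (i - 1) (\<tau> m f) g) \<and>
        \<tau> (m + n - 1) (pcomp P m n 1 f g) = - pcomp P n m n (\<tau> n g) (\<tau> m f))"

locale ns_anticyclic_operad = ns_operad P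
  for P :: "('a::rat_vector, 'm) ns_operad_scheme" +
  fixes \<tau> :: "nat \<Rightarrow> 'a \<Rightarrow> 'a"
  assumes tau_linear: "n \<ge> 1 \<Longrightarrow> linear_between (arity_space P n) (arity_space P n) (\<tau> n)"
    and tau_order: "\<lbrakk>n \<ge> 1; f \<in> arity_space P n\<rbrakk> \<Longrightarrow> (\<tau> n ^^ (n + 1)) f = f"
    and tau_identities: "anticyclic_identities P \<tau>"

locale anticyclic_operad = operad P
  for P :: "('a::rat_vector, 'm) operad_scheme" +
  fixes cyc :: "nat \<Rightarrow> (nat \<Rightarrow> nat) \<Rightarrow> 'a \<Rightarrow> 'a"
  assumes cyc_rep: "n \<ge> 1 \<Longrightarrow> sym_rep (n + 1) (arity_space P n) (cyc n)"
    and cyc_extends: "\<lbrakk>n \<ge> 1; \<sigma> permutes {1..n}; f \<in> arity_space P n\<rbrakk>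
      \<Longrightarrow> cyc n \<sigma> f = op_act P n \<sigma> f"
    and cyc_identities: "anticyclic_identities P (\<lambda>n. cyc n (long_cycle n))"

text \<open>Commutation with the symmetric group actions of the operads is a special case of
  commutation with the extended actions.\<close>

definition anticyclic_morphism ::
  "('a::rat_vector, 'm) operad_scheme \<Rightarrow> (nat \<Rightarrow> (nat \<Rightarrow> nat) \<Rightarrow> 'a \<Rightarrow> 'a) \<Rightarrow>
   ('b::rat_vector, 'k) operad_scheme \<Rightarrow> (nat \<Rightarrow> (nat \<Rightarrow> nat) \<Rightarrow> 'b \<Rightarrow> 'b) \<Rightarrow> ('a \<Rightarrow> 'b) \<Rightarrow> bool" where
  "anticyclic_morphism P cycP Q cycQ h \<longleftrightarrow>
     (\<forall>n\<ge>1. linear_between (arity_space P n) (arity_space Q n) h) \<and>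
     h (op_unit P) = op_unit Q \<and>
     (\<forall>m n i f g. m \<ge> 1 \<longrightarrow> n \<ge> 1 \<longrightarrow> 1 \<le> i \<longrightarrow> i \<le> m \<longrightarrow>
        f \<in> arity_space P m \<longrightarrow> g \<in> arity_space P n \<longrightarrow>
        h (pcomp P m n i f g) = pcomp Q m n i (h f) (h g)) \<and>
     (\<forall>n \<sigma> f. n \<ge> 1 \<longrightarrow> \<sigma> permutes {1..n + 1} \<longrightarrow> f \<in> arity_space P n \<longrightarrow>
        h (cycP n \<sigma> f) = cycQ n \<sigma> (h f))"


section \<open>Ideals, quotients and symmetrization\<close>

text \<open>\<open>ns_ideal P G n\<close> and \<open>operad_ideal P G n\<close> are the arity \<open>n\<close> components of the ideal
  generated by the subsets \<open>G n\<close> of \<open>arity_space P n\<close>.\<close>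

inductive ns_ideal ::
  "('a::rat_vector, 'm) ns_operad_scheme \<Rightarrow> (nat \<Rightarrow> 'a set) \<Rightarrow> nat \<Rightarrow> 'a \<Rightarrow> bool"
  for P G where
  generator: "x \<in> G n \<Longrightarrow> ns_ideal P G n x"
| zero: "n \<ge> 1 \<Longrightarrow> ns_ideal P G n 0"
| add: "ns_ideal P G n x \<Longrightarrow> ns_ideal P G n y \<Longrightarrow> ns_ideal P G n (x + y)"
| scale: "ns_ideal P G n x \<Longrightarrow> ns_ideal P G n (c *\<^sub>Q x)"
| pcomp_left: "\<lbrakk>ns_ideal P G m x; n \<ge> 1; g \<in> arity_space P n; 1 \<le> i; i \<le> m\<rbrakk>
    \<Longrightarrow> ns_ideal P G (m + n - 1) (pcomp P m n i x g)"
| pcomp_right: "\<lbrakk>ns_ideal P G n x; m \<ge> 1; f \<in> arity_space P m; 1 \<le> i; i \<le> m\<rbrakk>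
    \<Longrightarrow> ns_ideal P G (m + n - 1) (pcomp P m n i f x)"

inductive operad_ideal ::
  "('a::rat_vector, 'm) operad_scheme \<Rightarrow> (nat \<Rightarrow> 'a set) \<Rightarrow> nat \<Rightarrow> 'a \<Rightarrow> bool"
  for P G where
  generator: "x \<in> G n \<Longrightarrow> operad_ideal P G n x"
| zero: "n \<ge> 1 \<Longrightarrow> operad_ideal P G n 0"
| add: "operad_ideal P G n x \<Longrightarrow> operad_ideal P G n y \<Longrightarrow> operad_ideal P G n (x + y)"
| scale: "operad_ideal P G n x \<Longrightarrow> operad_ideal P G n (c *\<^sub>Q x)"
| act: "\<lbrakk>operad_ideal P G n x; \<sigma> permutes {1..n}\<rbrakk> \<Longrightarrow> operad_ideal P G n (op_act P n \<sigma> x)"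
| pcomp_left: "\<lbrakk>operad_ideal P G m x; n \<ge> 1; g \<in> arity_space P n; 1 \<le> i; i \<le> m\<rbrakk>
    \<Longrightarrow> operad_ideal P G (m + n - 1) (pcomp P m n i x g)"
| pcomp_right: "\<lbrakk>operad_ideal P G n x; m \<ge> 1; f \<in> arity_space P m; 1 \<le> i; i \<le> m\<rbrakk>
    \<Longrightarrow> operad_ideal P G (m + n - 1) (pcomp P m n i f x)"

text \<open>For a linear map \<open>q\<close> whose kernel on the components of \<open>P\<close> is an ideal, the following are
  the quotient operads: the operations are computed on representatives of the right arity.\<close>

definition ns_quotient :: "('a \<Rightarrow> 'b) \<Rightarrow> ('a, 'm) ns_operad_scheme \<Rightarrow> 'b ns_operad" where
  "ns_quotient q P = \<lparr>
     arity_space = (\<lambda>n. q ` arity_space P n),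
     op_unit = q (op_unit P),
     pcomp = (\<lambda>m n i f g. q (pcomp P m n i
       (inv_into (arity_space P m) q f) (inv_into (arity_space P n) q g)))\<rparr>"

definition operad_quotient :: "('a \<Rightarrow> 'b) \<Rightarrow> ('a, 'm) operad_scheme \<Rightarrow> 'b operad" where
  "operad_quotient q P = \<lparr>
     arity_space = (\<lambda>n. q ` arity_space P n),
     op_unit = q (op_unit P),
     pcomp = (\<lambda>m n i f g. q (pcomp P m n i
       (inv_into (arity_space P m) q f) (inv_into (arity_space P n) q g))),
     op_act = (\<lambda>n \<sigma> f. q (op_act P n \<sigma> (inv_into (arity_space P n) q f)))\<rparr>"

text \<open>The symmetric operad with components \<open>P(n) \<otimes> \<rat>S\<^sub>n\<close>: the element \<open>E \<otimes> \<pi>\<close> is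
  \<open>Poly_Mapping.single \<pi> E\<close> and stands for \<open>E(x\<^bsub>\<pi>(1)\<^esub>, \<dots>, x\<^bsub>\<pi>(n)\<^esub>)\<close>, so that
  \<open>\<sigma> \<cdot> (E \<otimes> \<pi>) = E \<otimes> \<sigma>\<pi>\<close>; in \<open>(E \<otimes> \<sigma>) \<circ>\<^sub>i (E' \<otimes> \<rho>)\<close> the variable \<open>x\<^sub>i\<close> sits
  at position \<open>\<sigma>\<^sup>-\<^sup>1(i)\<close> of \<open>E\<close>.\<close>

definition symmetrization ::
  "('a::rat_vector, 'm) ns_operad_scheme \<Rightarrow> ((nat \<Rightarrow> nat) \<Rightarrow>\<^sub>0 'a) operad" where
  "symmetrization P = \<lparr>
     arity_space = (\<lambda>n. {F. Poly_Mapping.keys F \<subseteq> {\<pi>. \<pi> permutes {1..n}}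
        \<and> (\<forall>\<pi>. Poly_Mapping.lookup F \<pi> \<in> arity_space P n)}),
     op_unit = Poly_Mapping.single id (op_unit P),
     pcomp = (\<lambda>m n i F G. \<Sum>\<sigma>\<in>Poly_Mapping.keys F. \<Sum>\<rho>\<in>Poly_Mapping.keys G.
        Poly_Mapping.single (block_perm n (inv \<sigma> i) \<sigma> \<rho>)
          (pcomp P m n (inv \<sigma> i) (Poly_Mapping.lookup F \<sigma>) (Poly_Mapping.lookup G \<rho>))),
     op_act = (\<lambda>n \<sigma> F. \<Sum>\<pi>\<in>Poly_Mapping.keys F.
        Poly_Mapping.single (\<sigma> \<circ> \<pi>) (Poly_Mapping.lookup F \<pi>))\<rparr>"

lemma equivp_span: "equivp (\<lambda>x y. x - y \<in> rat_vector.span S)"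
proof (rule equivpI)
  show "reflp (\<lambda>x y. x - y \<in> rat_vector.span S)"
    by (simp add: reflp_def rat_vector.span_zero)
  show "symp (\<lambda>x y. x - y \<in> rat_vector.span S)"
    by (metis (no_types, lifting) minus_diff_eq rat_vector.span_neg sympI)
  show "transp (\<lambda>x y. x - y \<in> rat_vector.span S)"
  proof (rule transpI)
    fix x y z assume "x - y \<in> rat_vector.span S" "y - z \<in> rat_vector.span S"
    then have "(x - y) + (y - z) \<in> rat_vector.span S" by (rule rat_vector.span_add)
    then show "x - z \<in> rat_vector.span S" by simp
  qed
qed

lemma span_cong_add:
  assumes "x - y \<in> rat_vector.span S" "x' - y' \<in> rat_vector.span S"
  shows "(x + x') - (y + y') \<in> rat_vector.span S"
  using rat_vector.span_add[OF assms] by (simp add: algebra_simps)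

lemma span_cong_diff:
  assumes "x - y \<in> rat_vector.span S" "x' - y' \<in> rat_vector.span S"
  shows "(x - x') - (y - y') \<in> rat_vector.span S"
  using rat_vector.span_diff[OF assms] by (simp add: algebra_simps)

lemma span_cong_uminus:
  assumes "x - y \<in> rat_vector.span S"
  shows "(- x) - (- y) \<in> rat_vector.span S"
  using rat_vector.span_neg[OF assms] by (simp add: algebra_simps)

lemma span_cong_scale:
  assumes "x - y \<in> rat_vector.span S"
  shows "c *\<^sub>Q x - c *\<^sub>Q y \<in> rat_vector.span S"
  using rat_vector.span_scale[OF assms, of c] by (simp add: rat_vector.scale_right_diff_distrib)


section \<open>The operad Dend\<close>

text \<open>The basis of the free non-symmetric operad on two binary operations: the number of inputs
  is the number of leaves, and \<open>graft i t s\<close> plugs \<open>s\<close> into the \<open>i\<close>-th leaf of \<open>t\<close>.\<close>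

datatype tree = Leaf | Prec tree tree | Succ tree tree

primrec leaves :: "tree \<Rightarrow> nat" where
  "leaves Leaf = 1"
| "leaves (Prec l r) = leaves l + leaves r"
| "leaves (Succ l r) = leaves l + leaves r"

primrec graft :: "nat \<Rightarrow> tree \<Rightarrow> tree \<Rightarrow> tree" where
  "graft i Leaf s = s"
| "graft i (Prec l r) s =
     (if i \<le> leaves l then Prec (graft i l s) r else Prec l (graft (i - leaves l) r s))"
| "graft i (Succ l r) s =
     (if i \<le> leaves l then Succ (graft i l s) r else Succ l (graft (i - leaves l) r s))"

definition Free_dend :: "(tree \<Rightarrow>\<^sub>0 rat) ns_operad" where
  "Free_dend = \<lparr>
     arity_space = (\<lambda>n. {x. \<forall>t\<in>Poly_Mapping.keys x. leaves t = n}),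
     op_unit = basis_vec Leaf,
     pcomp = (\<lambda>m n i. bilin_ext (graft i))\<rparr>"

definition dend_relations :: "nat \<Rightarrow> (tree \<Rightarrow>\<^sub>0 rat) set" where
  "dend_relations n = (if n = 3 then
     { basis_vec (Prec (Prec Leaf Leaf) Leaf)
         - (basis_vec (Prec Leaf (Prec Leaf Leaf)) + basis_vec (Prec Leaf (Succ Leaf Leaf))),
       basis_vec (Succ Leaf (Prec Leaf Leaf)) - basis_vec (Prec (Succ Leaf Leaf) Leaf),
       basis_vec (Succ Leaf (Succ Leaf Leaf))
         - (basis_vec (Succ (Succ Leaf Leaf) Leaf) + basis_vec (Succ (Prec Leaf Leaf) Leaf)) }
     else {})"

text \<open>The direct sum of the components of the ideal of relations; its intersection with the
  arity \<open>n\<close> component of the free operad is the arity \<open>n\<close> component of the ideal.\<close>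

definition dend_ideal :: "(tree \<Rightarrow>\<^sub>0 rat) set" where
  "dend_ideal = rat_vector.span (\<Union>n. {x. ns_ideal Free_dend dend_relations n x})"

quotient_type dend = "tree \<Rightarrow>\<^sub>0 rat" / "\<lambda>x y. x - y \<in> dend_ideal"
  unfolding dend_ideal_def by (rule equivp_span)

instantiation dend :: rat_vector
begin
lift_definition zero_dend :: dend is 0 .
lift_definition plus_dend :: "dend \<Rightarrow> dend \<Rightarrow> dend" is "(+)"
  unfolding dend_ideal_def by (rule span_cong_add)
lift_definition minus_dend :: "dend \<Rightarrow> dend \<Rightarrow> dend" is "(-)"
  unfolding dend_ideal_def by (rule span_cong_diff)
lift_definition uminus_dend :: "dend \<Rightarrow> dend" is uminus
  unfolding dend_ideal_def by (rule span_cong_uminus)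
lift_definition scaleQ_dend :: "rat \<Rightarrow> dend \<Rightarrow> dend" is scaleQ
  unfolding dend_ideal_def by (rule span_cong_scale)
instance
  by standard
    (transfer; simp add: dend_ideal_def rat_vector.span_zero scaleQ_add_right scaleQ_add_left
      scaleQ_scaleQ scaleQ_one add.assoc add.commute)+
end

definition Dend_ns :: "dend ns_operad" where
  "Dend_ns = ns_quotient abs_dend Free_dend"

definition dend_prec :: dend where
  "dend_prec = abs_dend (basis_vec (Prec Leaf Leaf))"

definition dend_succ :: dend where
  "dend_succ = abs_dend (basis_vec (Succ Leaf Leaf))"

definition Dend :: "((nat \<Rightarrow> nat) \<Rightarrow>\<^sub>0 dend) operad" where
  "Dend = symmetrization Dend_ns"


section \<open>The operad Zinb\<close>

text \<open>\<open>x\<^sub>1 \<prec> x\<^sub>2 - x\<^sub>2 \<succ> x\<^sub>1\<close>\<close>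

definition zinb_relations :: "nat \<Rightarrow> ((nat \<Rightarrow> nat) \<Rightarrow>\<^sub>0 dend) set" where
  "zinb_relations n = (if n = 2 then
     { Poly_Mapping.single id dend_prec
         - Poly_Mapping.single (Transposition.transpose 1 2) dend_succ } else {})"

definition zinb_ideal :: "((nat \<Rightarrow> nat) \<Rightarrow>\<^sub>0 dend) set" where
  "zinb_ideal = rat_vector.span (\<Union>n. {x. operad_ideal Dend zinb_relations n x})"

quotient_type zinb = "(nat \<Rightarrow> nat) \<Rightarrow>\<^sub>0 dend" / "\<lambda>x y. x - y \<in> zinb_ideal"
  unfolding zinb_ideal_def by (rule equivp_span)

instantiation zinb :: rat_vector
begin
lift_definition zero_zinb :: zinb is 0 .
lift_definition plus_zinb :: "zinb \<Rightarrow> zinb \<Rightarrow> zinb" is "(+)"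
  unfolding zinb_ideal_def by (rule span_cong_add)
lift_definition minus_zinb :: "zinb \<Rightarrow> zinb \<Rightarrow> zinb" is "(-)"
  unfolding zinb_ideal_def by (rule span_cong_diff)
lift_definition uminus_zinb :: "zinb \<Rightarrow> zinb" is uminus
  unfolding zinb_ideal_def by (rule span_cong_uminus)
lift_definition scaleQ_zinb :: "rat \<Rightarrow> zinb \<Rightarrow> zinb" is scaleQ
  unfolding zinb_ideal_def by (rule span_cong_scale)
instance
  by standard
    (transfer; simp add: zinb_ideal_def rat_vector.span_zero scaleQ_add_right scaleQ_add_left
      scaleQ_scaleQ scaleQ_one add.assoc add.commute)+
end

definition Zinb :: "zinb operad" where
  "Zinb = operad_quotient abs_zinb Dend"


section \<open>The Lie modules\<close>

text \<open>The free Lie algebra on variables \<open>x\<^sub>i\<close>, \<open>i \<in> \<nat>\<close>, is the quotient of the free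
  nonassociative algebra by the two-sided ideal generated by antisymmetry and the Jacobi identity.\<close>

datatype bracketing = Var nat | Br bracketing bracketing

primrec letters :: "bracketing \<Rightarrow> nat list" where
  "letters (Var i) = [i]"
| "letters (Br s t) = letters s @ letters t"

primrec rename :: "(nat \<Rightarrow> nat) \<Rightarrow> bracketing \<Rightarrow> bracketing" where
  "rename \<sigma> (Var i) = Var (\<sigma> i)"
| "rename \<sigma> (Br s t) = Br (rename \<sigma> s) (rename \<sigma> t)"

abbreviation free_bracket ::
  "(bracketing \<Rightarrow>\<^sub>0 rat) \<Rightarrow> (bracketing \<Rightarrow>\<^sub>0 rat) \<Rightarrow> (bracketing \<Rightarrow>\<^sub>0 rat)" where
  "free_bracket \<equiv> bilin_ext Br"

inductive_set lie_ideal :: "(bracketing \<Rightarrow>\<^sub>0 rat) set" where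
  alternating: "free_bracket x x \<in> lie_ideal"
| jacobi: "free_bracket x (free_bracket y z) + free_bracket y (free_bracket z x)
    + free_bracket z (free_bracket x y) \<in> lie_ideal"
| zero: "0 \<in> lie_ideal"
| add: "x \<in> lie_ideal \<Longrightarrow> y \<in> lie_ideal \<Longrightarrow> x + y \<in> lie_ideal"
| scale: "x \<in> lie_ideal \<Longrightarrow> c *\<^sub>Q x \<in> lie_ideal"
| bracket_left: "x \<in> lie_ideal \<Longrightarrow> free_bracket x y \<in> lie_ideal"
| bracket_right: "y \<in> lie_ideal \<Longrightarrow> free_bracket x y \<in> lie_ideal"

lemma span_lie_ideal: "rat_vector.span lie_ideal = lie_ideal"
  by (rule rat_vector.span_eq_iff[THEN iffD2])
    (auto simp: rat_vector.subspace_def intro: lie_ideal.intros)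

quotient_type free_lie = "bracketing \<Rightarrow>\<^sub>0 rat" / "\<lambda>x y. x - y \<in> lie_ideal"
  using equivp_span[of lie_ideal] unfolding span_lie_ideal .

instantiation free_lie :: rat_vector
begin
lift_definition zero_free_lie :: free_lie is 0 .
lift_definition plus_free_lie :: "free_lie \<Rightarrow> free_lie \<Rightarrow> free_lie" is "(+)"
  using span_cong_add[where S = lie_ideal] unfolding span_lie_ideal .
lift_definition minus_free_lie :: "free_lie \<Rightarrow> free_lie \<Rightarrow> free_lie" is "(-)"
  using span_cong_diff[where S = lie_ideal] unfolding span_lie_ideal .
lift_definition uminus_free_lie :: "free_lie \<Rightarrow> free_lie" is uminus
  using span_cong_uminus[where S = lie_ideal] unfolding span_lie_ideal .
lift_definition scaleQ_free_lie :: "rat \<Rightarrow> free_lie \<Rightarrow> free_lie" is scaleQ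
  using span_cong_scale[where S = lie_ideal] unfolding span_lie_ideal .
instance
  by standard
    (transfer; simp add: lie_ideal.zero scaleQ_add_right scaleQ_add_left
      scaleQ_scaleQ scaleQ_one add.assoc add.commute)+
end

definition linear_rename :: "(nat \<Rightarrow> nat) \<Rightarrow> (bracketing \<Rightarrow>\<^sub>0 rat) \<Rightarrow> (bracketing \<Rightarrow>\<^sub>0 rat)" where
  "linear_rename \<sigma> x = (\<Sum>t\<in>Poly_Mapping.keys x.
     Poly_Mapping.single (rename \<sigma> t) (Poly_Mapping.lookup x t))"

lemma linear_rename_superset:
  assumes "finite A" "Poly_Mapping.keys x \<subseteq> A"
  shows "linear_rename \<sigma> x
    = (\<Sum>t\<in>A. Poly_Mapping.single (rename \<sigma> t) (Poly_Mapping.lookup x t))"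
  unfolding linear_rename_def
  by (rule sum.mono_neutral_left) (use assms in \<open>auto simp: in_keys_iff\<close>)

lemma linear_rename_add: "linear_rename \<sigma> (x + y) = linear_rename \<sigma> x + linear_rename \<sigma> y"
proof -
  let ?A = "Poly_Mapping.keys x \<union> Poly_Mapping.keys y"
  have "Poly_Mapping.keys (x + y) \<subseteq> ?A" by (rule keys_add)
  then show ?thesis
    by (simp add: linear_rename_superset[of ?A] lookup_add single_add sum.distrib)
qed

lemma lookup_scaleQ: "Poly_Mapping.lookup (c *\<^sub>Q x) t = c *\<^sub>Q Poly_Mapping.lookup x t"
  by transfer simp

lemma scaleQ_single: "c *\<^sub>Q Poly_Mapping.single a p = Poly_Mapping.single a (c *\<^sub>Q p)"
  by (rule poly_mapping_eqI) (auto simp: lookup_scaleQ lookup_single when_def)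

lemma linear_rename_scale: "linear_rename \<sigma> (c *\<^sub>Q x) = c *\<^sub>Q linear_rename \<sigma> x"
proof -
  have "Poly_Mapping.keys (c *\<^sub>Q x) \<subseteq> Poly_Mapping.keys x"
    by (auto simp: in_keys_iff lookup_scaleQ)
  then show ?thesis
    by (simp add: linear_rename_superset[of "Poly_Mapping.keys x"] lookup_scaleQ
        rat_vector.scale_sum_right scaleQ_single)
qed

lemma linear_rename_sum: "linear_rename \<sigma> (sum g A) = (\<Sum>a\<in>A. linear_rename \<sigma> (g a))"
  by (induction A rule: infinite_finite_induct)
    (simp_all add: linear_rename_add, simp_all add: linear_rename_def)

lemma linear_rename_single:
  "linear_rename \<sigma> (Poly_Mapping.single t c) = Poly_Mapping.single (rename \<sigma> t) c"
  by (simp add: linear_rename_def)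

lemma bilin_ext_superset:
  assumes "finite A" "Poly_Mapping.keys x \<subseteq> A" "finite B" "Poly_Mapping.keys y \<subseteq> B"
  shows "bilin_ext f x y = (\<Sum>a\<in>A. \<Sum>b\<in>B.
    Poly_Mapping.single (f a b) (Poly_Mapping.lookup x a * Poly_Mapping.lookup y b))"
proof -
  have "bilin_ext f x y = (\<Sum>a\<in>Poly_Mapping.keys x. \<Sum>b\<in>B.
      Poly_Mapping.single (f a b) (Poly_Mapping.lookup x a * Poly_Mapping.lookup y b))"
    unfolding bilin_ext_def
    by (intro sum.cong refl sum.mono_neutral_left) (use assms in \<open>auto simp: in_keys_iff\<close>)
  also have "\<dots> = (\<Sum>a\<in>A. \<Sum>b\<in>B.
      Poly_Mapping.single (f a b) (Poly_Mapping.lookup x a * Poly_Mapping.lookup y b))"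
    by (rule sum.mono_neutral_left) (use assms in \<open>auto simp: in_keys_iff\<close>)
  finally show ?thesis .
qed

lemma bilin_ext_add_left: "bilin_ext f (x + y) z = bilin_ext f x z + bilin_ext f y z"
proof -
  let ?A = "Poly_Mapping.keys x \<union> Poly_Mapping.keys y"
  have "Poly_Mapping.keys (x + y) \<subseteq> ?A" by (rule keys_add)
  then show ?thesis
    by (simp add: bilin_ext_superset[of ?A _ "Poly_Mapping.keys z"] lookup_add single_add
        sum.distrib distrib_right)
qed

lemma bilin_ext_add_right: "bilin_ext f z (x + y) = bilin_ext f z x + bilin_ext f z y"
proof -
  let ?A = "Poly_Mapping.keys x \<union> Poly_Mapping.keys y"
  have "Poly_Mapping.keys (x + y) \<subseteq> ?A" by (rule keys_add)
  then show ?thesis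
    by (simp add: bilin_ext_superset[of "Poly_Mapping.keys z" _ ?A] lookup_add single_add
        sum.distrib distrib_left)
qed

lemma bilin_ext_sum_left: "bilin_ext f (sum g A) z = (\<Sum>a\<in>A. bilin_ext f (g a) z)"
  by (induction A rule: infinite_finite_induct)
    (simp_all add: bilin_ext_add_left, simp_all add: bilin_ext_def)

lemma bilin_ext_sum_right: "bilin_ext f z (sum g A) = (\<Sum>a\<in>A. bilin_ext f z (g a))"
  by (induction A rule: infinite_finite_induct)
    (simp_all add: bilin_ext_add_right, simp_all add: bilin_ext_def)

lemma bilin_ext_single: "bilin_ext f (Poly_Mapping.single a p) (Poly_Mapping.single b q)
    = Poly_Mapping.single (f a b) (p * q)"
  by (simp add: bilin_ext_def)

lemma linear_rename_bracket:
  "linear_rename \<sigma> (free_bracket x y) = free_bracket (linear_rename \<sigma> x) (linear_rename \<sigma> y)"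
  unfolding linear_rename_def[of \<sigma> x] linear_rename_def[of \<sigma> y]
  by (simp add: bilin_ext_def[of Br x y] linear_rename_sum linear_rename_single
      bilin_ext_sum_left bilin_ext_sum_right bilin_ext_single)
    (rule sum.swap)

lemma linear_rename_ideal: "x \<in> lie_ideal \<Longrightarrow> linear_rename \<sigma> x \<in> lie_ideal"
proof (induction rule: lie_ideal.induct)
  case zero
  show ?case by (simp add: linear_rename_def lie_ideal.zero)
qed (auto simp: linear_rename_add linear_rename_scale linear_rename_bracket intro: lie_ideal.intros)

lemma linear_rename_diff: "linear_rename \<sigma> (x - y) = linear_rename \<sigma> x - linear_rename \<sigma> y"
  using linear_rename_add[of \<sigma> "x - y" y] by simp

text \<open>The endomorphism \<open>x\<^sub>i \<mapsto> x\<^bsub>\<sigma>(i)\<^esub>\<close> of the free Lie algebra.\<close>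

lift_definition lie_act :: "(nat \<Rightarrow> nat) \<Rightarrow> free_lie \<Rightarrow> free_lie" is linear_rename
  unfolding linear_rename_diff[symmetric] by (rule linear_rename_ideal)

text \<open>The multilinear part in \<open>x\<^sub>1, \<dots>, x\<^sub>N\<close>: the span of the bracketings in which each of
  these variables occurs exactly once and no other variable occurs.\<close>

definition Lie :: "nat \<Rightarrow> free_lie set" where
  "Lie N = abs_free_lie ` {x. \<forall>t\<in>Poly_Mapping.keys x.
     distinct (letters t) \<and> set (letters t) = {1..N}}"

end

theory Submission
  imports Defs "HOL-Library.Function_Algebras"
begin

text \<open>
  The idea is to view \<open>Zinb(n)\<close> as the dual of \<open>Lie(n+1)\<close> and then to identify the Lie module with its
  dual by a positive definite invariant form.

  Rational functions on words form a Zinbiel algebra under the half-shuffle \<open>f \<lhd> g\<close>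
  (\<open>zinbiel_identity\<close>). Dendriform and Zinbiel operations therefore act on such functions; the ideals
  of relations act by zero. A bracketing \<open>s\<close> expands into words and so defines a functional \<open>word_sum s\<close>
  on functions on words, which kills all shuffles of functions without constant term
  (\<open>word_sum_shuffle\<close>). Because \<open>f \<lhd> g + g \<lhd> f\<close> is such a shuffle, \<open>\<langle>f, g\<rangle> = word_sum s (g \<lhd> f)\<close> is
  antisymmetric, and the Zinbiel identity gives two invariance rules (\<open>form_prec\<close>, \<open>form_succ\<close>). The
  anticyclic identities determine \<open>\<tau>\<close> on trees by a recursion in which exactly these rules appear, so
  \<open>\<langle>(\<tau> d)(p\<^sub>1, \<dots>, p\<^sub>n), p\<^bsub>n+1\<^esub>\<rangle>\<close> arises from \<open>\<langle>d(p\<^sub>1, \<dots>, p\<^sub>n), p\<^bsub>n+1\<^esub>\<rangle>\<close> by a cyclic permutation of the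
  \<open>p\<^sub>i\<close> (\<open>cyclic_form_tau\<close>). The permutations of the first \<open>n\<close> letters and the long cycle generate
  everything, so the whole group acts by permuting the \<open>n + 1\<close> arguments of the form
  (\<open>zinb_form_cyc\<close>).

  Now take letters as arguments. The right comb \<open>x\<^bsub>\<pi>(1)\<^esub>(x\<^bsub>\<pi>(2)\<^esub>(\<dots> x\<^bsub>\<pi>(n)\<^esub>))\<close> then pairs with \<open>s\<close> to the
  coefficient of the word \<open>x\<^bsub>n+1\<^esub> x\<^bsub>\<pi>(1)\<^esub> \<dots> x\<^bsub>\<pi>(n)\<^esub>\<close> in \<open>s\<close> (\<open>zinb_form_basis\<close>). The right combs span
  \<open>Zinb(n)\<close> (\<open>arity_space_Zinb_comb_span\<close>). The left combs \<open>[\<dots>[[x\<^bsub>n+1\<^esub>, x\<^bsub>\<pi>(1)\<^esub>], x\<^bsub>\<pi>(2)\<^esub>], \<dots>, x\<^bsub>\<pi>(n)\<^esub>]\<close> span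
  \<open>Lie(n+1)\<close> (\<open>lie_of_expand\<close>), and these coefficients of theirs form the identity matrix
  (\<open>left_comb_coefficient\<close>). So the pairing of \<open>Zinb(n)\<close> with \<open>Lie(n+1)\<close> is perfect, and it is invariant
  under the symmetric group on \<open>n + 1\<close> letters.

  The scalar product for which words are orthonormal is also invariant, and it is positive definite on
  Lie elements (\<open>lie_form_definite\<close>). Through the pairing it becomes an injective equivariant map
  \<open>lie_to_zinb\<close> from \<open>Lie(n+1)\<close> to \<open>Zinb(n)\<close>, which is bijective because the source has \<open>n!\<close>
  independent elements and the target is spanned by \<open>n!\<close> elements.
\<close>

section \<open>Linear algebra over the rationals\<close>

instantiation "fun" :: (type, rat_vector) rat_vector
begin
definition scaleQ_fun :: "rat \<Rightarrow> ('a \<Rightarrow> 'b) \<Rightarrow> 'a \<Rightarrow> 'b" where "scaleQ_fun c f = (\<lambda>x. c *\<^sub>Q f x)"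
instance
  by standard
    (simp_all add: scaleQ_fun_def fun_eq_iff scaleQ_add_right scaleQ_add_left scaleQ_scaleQ
      scaleQ_one)
end

lemma scaleQ_apply [simp]: "(c *\<^sub>Q f) x = c *\<^sub>Q f x"
  by (simp add: scaleQ_fun_def)

lemma scaleQ_rat [simp]: "c *\<^sub>Q (x::rat) = c * x"
  by (simp add: scaleQ_rat_def)

lemma sum_apply [simp]: "(\<Sum>a\<in>A. f a) x = (\<Sum>a\<in>A. f a x)"
  by (induction A rule: infinite_finite_induct) auto

global_interpretation rat_vector_pair:
  vector_space_pair "scaleQ :: rat \<Rightarrow> 'a \<Rightarrow> 'a::rat_vector" "scaleQ :: rat \<Rightarrow> 'b \<Rightarrow> 'b::rat_vector"
  ..

text \<open>A constant rather than an abbreviation, so that simplification does not enter the two scalar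
  actions.\<close>

definition qlinear :: "('a::rat_vector \<Rightarrow> 'b::rat_vector) \<Rightarrow> bool" where
  "qlinear = Vector_Spaces.linear scaleQ scaleQ"

lemma qlinearI:
  assumes "\<And>x y. h (x + y) = h x + h y" "\<And>c x. h (c *\<^sub>Q x) = c *\<^sub>Q h x"
  shows "qlinear h"
  by (simp add: qlinear_def Vector_Spaces.linear_iff assms rat_vector.vector_space_axioms)

lemmas qlinear_add = rat_vector_pair.linear_add[folded qlinear_def]
  and qlinear_scale = rat_vector_pair.linear_scale[folded qlinear_def]
  and qlinear_0 = rat_vector_pair.linear_0[folded qlinear_def]
  and qlinear_neg = rat_vector_pair.linear_neg[folded qlinear_def]
  and qlinear_diff = rat_vector_pair.linear_diff[folded qlinear_def]
  and qlinear_sum = rat_vector_pair.linear_sum[folded qlinear_def]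
  and qlinear_subspace_image = rat_vector_pair.linear_subspace_image[folded qlinear_def]
  and qlinear_compose_sum = rat_vector_pair.linear_compose_sum[folded qlinear_def]
  and qlinear_compose_scale_right = rat_vector_pair.linear_compose_scale_right[folded qlinear_def]

lemma qlinear_apply: "qlinear (\<lambda>f. f x)"
  by (rule qlinearI) auto

lemma qlinear_compose: "qlinear f \<Longrightarrow> qlinear g \<Longrightarrow> qlinear (\<lambda>x. f (g x))"
  using Vector_Spaces.linear_compose[of scaleQ scaleQ g scaleQ f] by (simp add: o_def qlinear_def)

definition lin_ext :: "('a \<Rightarrow> 'b::rat_vector) \<Rightarrow> ('a \<Rightarrow>\<^sub>0 rat) \<Rightarrow> 'b" where
  "lin_ext f x = (\<Sum>t\<in>Poly_Mapping.keys x. Poly_Mapping.lookup x t *\<^sub>Q f t)"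

lemma lin_ext_superset:
  assumes "finite A" "Poly_Mapping.keys x \<subseteq> A"
  shows "lin_ext f x = (\<Sum>t\<in>A. Poly_Mapping.lookup x t *\<^sub>Q f t)"
  unfolding lin_ext_def
  by (rule sum.mono_neutral_left) (use assms in \<open>auto simp: in_keys_iff\<close>)

lemma lin_ext_cong:
  "(\<And>t. t \<in> Poly_Mapping.keys x \<Longrightarrow> f t = g t) \<Longrightarrow> lin_ext f x = lin_ext g x"
  unfolding lin_ext_def by (rule sum.cong) auto

lemma lin_ext_add: "lin_ext f (x + y) = lin_ext f x + lin_ext f y"
proof -
  let ?A = "Poly_Mapping.keys x \<union> Poly_Mapping.keys y"
  have "Poly_Mapping.keys (x + y) \<subseteq> ?A" by (rule keys_add)
  then show ?thesis
    by (simp add: lin_ext_superset[of ?A] lookup_add scaleQ_add_left sum.distrib)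
qed

lemma lin_ext_scale: "lin_ext f (c *\<^sub>Q x) = c *\<^sub>Q lin_ext f x"
proof -
  have "Poly_Mapping.keys (c *\<^sub>Q x) \<subseteq> Poly_Mapping.keys x"
    by (auto simp: in_keys_iff lookup_scaleQ)
  then show ?thesis
    by (simp add: lin_ext_superset[of "Poly_Mapping.keys x"] lookup_scaleQ
        rat_vector.scale_sum_right scaleQ_scaleQ)
qed

lemma qlinear_lin_ext: "qlinear (lin_ext f)"
  by (rule qlinearI) (rule lin_ext_add lin_ext_scale)+

lemma lin_ext_single [simp]: "lin_ext f (Poly_Mapping.single t c) = c *\<^sub>Q f t"
  by (simp add: lin_ext_def)

lemma lin_ext_basis_vec [simp]: "lin_ext f (basis_vec t) = f t"
  by (simp add: basis_vec_def scaleQ_one)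

lemma sum_singles:
  "(\<Sum>t\<in>Poly_Mapping.keys x. Poly_Mapping.single t (Poly_Mapping.lookup x t)) = x"
  by (rule poly_mapping_eqI) (simp add: lookup_sum lookup_single when_def in_keys_iff)

lemma sum_basis_vecs: "lin_ext basis_vec x = x"
  unfolding lin_ext_def basis_vec_def using sum_singles[of x] by (simp add: scaleQ_single)

lemma qlinear_eq_lin_ext:
  assumes "qlinear h"
  shows "h x = lin_ext (\<lambda>t. h (basis_vec t)) x"
proof -
  have "h x = h (lin_ext basis_vec x)" by (simp add: sum_basis_vecs)
  also have "\<dots> = lin_ext (\<lambda>t. h (basis_vec t)) x"
    unfolding lin_ext_def
    by (simp add: qlinear_sum[OF assms] qlinear_scale[OF assms])
  finally show ?thesis .
qed

lemma qlinear_lin_ext_swap: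
  assumes "qlinear h"
  shows "h (lin_ext f x) = lin_ext (\<lambda>t. h (f t)) x"
  unfolding lin_ext_def
  by (simp add: qlinear_sum[OF assms] qlinear_scale[OF assms])

lemma bilin_ext_scale_left: "bilin_ext f (c *\<^sub>Q x) y = c *\<^sub>Q bilin_ext f x y"
proof -
  have "Poly_Mapping.keys (c *\<^sub>Q x) \<subseteq> Poly_Mapping.keys x"
    by (auto simp: in_keys_iff lookup_scaleQ)
  then show ?thesis
    by (simp add: bilin_ext_superset[of "Poly_Mapping.keys x" _ "Poly_Mapping.keys y"] lookup_scaleQ
        rat_vector.scale_sum_right scaleQ_single mult.assoc)
qed

lemma bilin_ext_scale_right: "bilin_ext f x (c *\<^sub>Q y) = c *\<^sub>Q bilin_ext f x y"
proof -
  have "Poly_Mapping.keys (c *\<^sub>Q y) \<subseteq> Poly_Mapping.keys y"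
    by (auto simp: in_keys_iff lookup_scaleQ)
  then show ?thesis
    by (simp add: bilin_ext_superset[of "Poly_Mapping.keys x" _ "Poly_Mapping.keys y"] lookup_scaleQ
        rat_vector.scale_sum_right scaleQ_single mult.left_commute)
qed

lemma qlinear_bilin_ext_left: "qlinear (\<lambda>x. bilin_ext f x y)"
  by (rule qlinearI) (rule bilin_ext_add_left bilin_ext_scale_left)+

lemma qlinear_bilin_ext_right: "qlinear (bilin_ext f x)"
  by (rule qlinearI) (rule bilin_ext_add_right bilin_ext_scale_right)+

lemma bilin_ext_basis_vec [simp]: "bilin_ext f (basis_vec a) (basis_vec b) = basis_vec (f a b)"
  by (simp add: basis_vec_def bilin_ext_single)

lemma lin_ext_bilin_ext:
  "lin_ext h (bilin_ext f x y) = lin_ext (\<lambda>a. lin_ext (\<lambda>b. h (f a b)) y) x"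
proof -
  have "lin_ext h (bilin_ext f x y) = lin_ext (\<lambda>a. lin_ext h (bilin_ext f (basis_vec a) y)) x"
    by (rule qlinear_eq_lin_ext)
      (rule qlinear_compose[OF qlinear_lin_ext qlinear_bilin_ext_left])
  also have "\<dots> = lin_ext (\<lambda>a. lin_ext (\<lambda>b. h (f a b)) y) x"
    using qlinear_eq_lin_ext[OF qlinear_compose[OF qlinear_lin_ext qlinear_bilin_ext_right], of h f _ y]
    by simp
  finally show ?thesis .
qed

lemma lin_ext_apply: "lin_ext f x w = lin_ext (\<lambda>t. f t w) x"
  by (simp add: lin_ext_def)

lemma lin_ext_swap: "lin_ext (\<lambda>a. lin_ext (\<lambda>b. F a b) y) x = lin_ext (\<lambda>b. lin_ext (\<lambda>a. F a b) x) y"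
  unfolding lin_ext_def rat_vector.scale_sum_right
  by (subst sum.swap) (simp add: scaleQ_scaleQ mult.commute)

lemma lin_ext_in_subspace:
  assumes "rat_vector.subspace S" "\<And>t. t \<in> Poly_Mapping.keys x \<Longrightarrow> f t \<in> S"
  shows "lin_ext f x \<in> S"
  unfolding lin_ext_def
  by (rule rat_vector.subspace_sum[OF assms(1)], rule rat_vector.subspace_scale[OF assms(1)],
      rule assms(2))

lemma qlinear_ident: "qlinear (\<lambda>x. x)"
  by (rule qlinearI) (rule refl)+

lemma subspace_eq: "qlinear f \<Longrightarrow> qlinear g \<Longrightarrow> rat_vector.subspace {x. f x = g x}"
  by (simp add: rat_vector.subspace_def qlinear_0 qlinear_add qlinear_scale)

lemma qlinear_scaleQ_left: "qlinear f \<Longrightarrow> qlinear (\<lambda>x. f x *\<^sub>Q v)" for f :: "_ \<Rightarrow> rat"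
  by (rule qlinearI) (simp_all add: qlinear_add qlinear_scale scaleQ_add_left scaleQ_scaleQ)

lemma linear_between_sum:
  assumes "linear_between A B h" "rat_vector.subspace A" "\<And>i. i \<in> I \<Longrightarrow> g i \<in> A"
  shows "h (\<Sum>i\<in>I. g i) = (\<Sum>i\<in>I. h (g i))"
proof -
  have 0: "h 0 = 0"
    using assms(1) rat_vector.subspace_0[OF assms(2)]
    unfolding linear_between_def by (metis rat_vector.scale_zero_left)
  show ?thesis
    using assms(3)
  proof (induction I rule: infinite_finite_induct)
    case (insert x F)
    then have "sum g F \<in> A" by (intro rat_vector.subspace_sum[OF assms(2)]) auto
    then show ?case using insert assms(1) by (simp add: linear_between_def)
  qed (simp_all add: 0)
qed

lemma sym_rep_closed: "sym_rep N A \<rho> \<Longrightarrow> \<sigma> permutes {1..N} \<Longrightarrow> x \<in> A \<Longrightarrow> \<rho> \<sigma> x \<in> A"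
  unfolding sym_rep_def linear_between_def by blast

lemma linear_between_0:
  assumes "linear_between A B h" "rat_vector.subspace A"
  shows "h 0 = 0"
  using linear_between_sum[OF assms, of "{}"] by simp

lemma linear_between_span:
  assumes "linear_between A B h" "rat_vector.subspace A" "S \<subseteq> A" "x \<in> rat_vector.span S"
    "rat_vector.subspace T" "\<And>y. y \<in> S \<Longrightarrow> h y \<in> T"
  shows "h x \<in> T"
proof -
  have "rat_vector.subspace {x \<in> A. h x \<in> T}"
    unfolding rat_vector.subspace_def
    using assms(1) linear_between_0[OF assms(1,2)] rat_vector.subspace_0[OF assms(2)]
      rat_vector.subspace_0[OF assms(5)] rat_vector.subspace_add[OF assms(2)] rat_vector.subspace_scale[OF assms(2)]
      rat_vector.subspace_add[OF assms(5)] rat_vector.subspace_scale[OF assms(5)]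
    unfolding linear_between_def by auto
  then have "rat_vector.span S \<subseteq> {x \<in> A. h x \<in> T}"
    using assms(3,6) by (intro rat_vector.span_minimal) auto
  then show ?thesis using assms(4) by auto
qed

text \<open>A vector of \<open>T\<close> outside the span of \<open>S\<close> could be added to \<open>S\<close>, giving more independent vectors
  than the spanning set \<open>T\<close> has elements.\<close>

lemma (in vector_space) independent_span_eq:
  assumes "finite T" "independent S" "S \<subseteq> span T" "card T \<le> card S"
  shows "T \<subseteq> span S"
proof
  fix v assume v: "v \<in> T"
  have fin: "finite S" using independent_span_bound[OF assms(1-3)] by simp
  show "v \<in> span S"
  proof (rule ccontr)
    assume *: "v \<notin> span S"
    then have "independent (insert v S)" using assms(2) by (simp add: independent_insert)
    moreover have "insert v S \<subseteq> span T" using assms(3) v by (auto intro: span_base)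
    ultimately have "card (insert v S) \<le> card T" using independent_span_bound[OF assms(1)] by blast
    moreover have "v \<notin> S" using * span_base by blast
    ultimately show False using assms(4) fin by simp
  qed
qed

section \<open>Words and the half-shuffle product\<close>

text \<open>The sum of \<open>F u v\<close> over all splittings of a word into complementary subwords \<open>u\<close> and \<open>v\<close>. On
  functions on words this is the coproduct dual to the shuffle product.\<close>

primrec unshuffle :: "'b list \<Rightarrow> ('b list \<Rightarrow> 'b list \<Rightarrow> 'a::rat_vector) \<Rightarrow> 'a" where
  "unshuffle [] F = F [] []"
| "unshuffle (x # w) F = unshuffle w (\<lambda>u v. F (x # u) v + F u (x # v))"

lemma unshuffle_add: "unshuffle w (\<lambda>u v. F u v + G u v) = unshuffle w F + unshuffle w G"
proof (induction w arbitrary: F G)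
  case (Cons x w)
  show ?case
    using Cons[of "\<lambda>u v. F (x # u) v + F u (x # v)" "\<lambda>u v. G (x # u) v + G u (x # v)"]
    by (simp add: algebra_simps)
qed simp

lemma unshuffle_scale: "unshuffle w (\<lambda>u v. c *\<^sub>Q F u v) = c *\<^sub>Q unshuffle w F"
  by (induction w arbitrary: F) (simp_all flip: scaleQ_add_right)

lemma unshuffle_scale_rat: "unshuffle w (\<lambda>u v. c * F u v) = c * unshuffle w F" for c :: rat
  using unshuffle_scale[of w c F] by simp

lemma unshuffle_linear:
  assumes "qlinear h"
  shows "h (unshuffle w F) = unshuffle w (\<lambda>u v. h (F u v))"
  by (induction w arbitrary: F) (simp_all add: qlinear_add[OF assms])

lemma unshuffle_swap: "unshuffle w (\<lambda>u v. F v u) = unshuffle w F"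
proof (induction w arbitrary: F)
  case (Cons x w)
  show ?case using Cons[of "\<lambda>u v. F (x # u) v + F u (x # v)"] by (simp add: add.commute)
qed simp

lemma unshuffle_coassoc:
  "unshuffle w (\<lambda>u v. unshuffle u (\<lambda>a b. F a b v)) = unshuffle w (\<lambda>u v. unshuffle v (\<lambda>b c. F u b c))"
proof (induction w arbitrary: F)
  case (Cons x w)
  show ?case
    using Cons[of "\<lambda>a b c. F (x # a) b c + F a (x # b) c + F a b (x # c)"]
    by (simp add: unshuffle_add add.assoc)
qed simp

text \<open>Unshuffling is multiplicative for concatenation; this is what makes Lie elements primitive.\<close>

lemma unshuffle_append:
  "unshuffle (w @ w') F = unshuffle w (\<lambda>u v. unshuffle w' (\<lambda>u' v'. F (u @ u') (v @ v')))"
  by (induction w arbitrary: F) (simp_all add: unshuffle_add)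

lemma unshuffle_indicator:
  fixes G H :: "'b list \<Rightarrow> 'a::rat_vector"
  shows
  "unshuffle w (\<lambda>u v. if u = [] then G v else 0) = G w"
  "unshuffle w (\<lambda>u v. if v = [] then H u else 0) = H w"
proof -
  show "unshuffle w (\<lambda>u v. if u = [] then G v else 0) = G w" for G :: "'b list \<Rightarrow> 'a"
    by (induction w arbitrary: G) simp_all
  show "unshuffle w (\<lambda>u v. if v = [] then H u else 0) = H w" for H :: "'b list \<Rightarrow> 'a"
    by (induction w arbitrary: H) simp_all
qed

type_synonym word_fun = "nat list \<Rightarrow> rat"

text \<open>Forgetting the value at the empty word in the second factor of a half-shuffle makes the Zinbiel
  relation hold for all functions on words, without a restriction to those that vanish there.\<close>

definition reduced :: "word_fun \<Rightarrow> word_fun" where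
  "reduced g w = (if w = [] then 0 else g w)"

text \<open>The transpose of the half-shuffle of words: the first letter always goes to the left factor.\<close>

definition half_shuffle :: "word_fun \<Rightarrow> word_fun \<Rightarrow> word_fun"  (infixl \<open>\<lhd>\<close> 70) where
  "(f \<lhd> g) w = (case w of [] \<Rightarrow> 0
     | x # w' \<Rightarrow> unshuffle w' (\<lambda>u v. f (x # u) * reduced g v))"

lemma half_shuffle_Nil [simp]: "(f \<lhd> g) [] = 0"
  by (simp add: half_shuffle_def)

lemma half_shuffle_Cons: "(f \<lhd> g) (x # w) = unshuffle w (\<lambda>u v. f (x # u) * reduced g v)"
  by (simp add: half_shuffle_def)

lemma qlinear_half_shuffle_left: "qlinear (\<lambda>f. f \<lhd> g)"
proof (rule qlinearI; rule ext)
  show "((x + y) \<lhd> g) w = (x \<lhd> g + y \<lhd> g) w" for x y w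
    by (cases w) (simp_all add: half_shuffle_Cons distrib_right unshuffle_add)
  show "((c *\<^sub>Q x) \<lhd> g) w = (c *\<^sub>Q (x \<lhd> g)) w" for c x w
    by (cases w) (simp_all add: half_shuffle_Cons mult.assoc
        unshuffle_scale_rat)
qed

lemma qlinear_half_shuffle_right: "qlinear (half_shuffle f)"
proof (rule qlinearI; rule ext)
  have *: "reduced (x + y) v = reduced x v + reduced y v"
    "reduced (c *\<^sub>Q x) v = c * reduced x v" for x y c v
    by (simp_all add: reduced_def)
  show "(f \<lhd> (x + y)) w = (f \<lhd> x + f \<lhd> y) w" for x y w
    by (cases w) (simp_all add: half_shuffle_Cons distrib_left unshuffle_add *)
  show "(f \<lhd> (c *\<^sub>Q x)) w = (c *\<^sub>Q (f \<lhd> x)) w" for c x w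
    by (cases w) (simp_all add: half_shuffle_Cons mult.left_commute *
        unshuffle_scale_rat)
qed

text \<open>The first letter goes to one of the two factors, so the two half-shuffles add up to the shuffle
  product.\<close>

lemma half_shuffle_symmetrized:
  assumes "w \<noteq> []"
  shows "(f \<lhd> g) w + (g \<lhd> f) w = unshuffle w (\<lambda>u v. reduced f u * reduced g v)"
proof -
  obtain x w' where w: "w = x # w'" using assms by (cases w) auto
  have "(g \<lhd> f) w = unshuffle w' (\<lambda>u v. reduced f u * g (x # v))"
    unfolding w half_shuffle_Cons
    by (subst unshuffle_swap[symmetric]) (simp add: mult.commute)
  then show ?thesis
    by (simp add: w half_shuffle_Cons unshuffle_add) (simp add: reduced_def)
qed

text \<open>On both sides the first letter goes to \<open>f\<close> and the others are distributed freely among \<open>f\<close>, \<open>g\<close> and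
  \<open>h\<close>, with something left for \<open>g\<close> and for \<open>h\<close>; coassociativity of unshuffling identifies the two sums.\<close>

lemma zinbiel_identity: "(f \<lhd> g) \<lhd> h = f \<lhd> (g \<lhd> h + h \<lhd> g)"
proof
  fix w
  show "((f \<lhd> g) \<lhd> h) w = (f \<lhd> (g \<lhd> h + h \<lhd> g)) w"
  proof (cases w)
    case (Cons x w')
    have mult: "qlinear (\<lambda>y::rat. c * y)" for c
      by (rule qlinearI) (simp_all add: algebra_simps)
    have mult': "qlinear (\<lambda>y::rat. y * c)" for c
      by (rule qlinearI) (simp_all add: algebra_simps)
    have red: "reduced (g \<lhd> h + h \<lhd> g) v = unshuffle v (\<lambda>b c. reduced g b * reduced h c)" for v
      by (cases "v = []") (simp_all add: reduced_def half_shuffle_symmetrized[unfolded reduced_def])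
    show ?thesis
      unfolding Cons half_shuffle_Cons red unshuffle_linear[OF mult] unshuffle_linear[OF mult']
      by (subst unshuffle_coassoc) (simp add: mult.assoc)
  qed simp
qed

lemma unshuffle_map: "unshuffle (map h w) F = unshuffle w (\<lambda>u v. F (map h u) (map h v))"
  by (induction w arbitrary: F) simp_all

lemma half_shuffle_map: "(f \<lhd> g) (map h w) = ((\<lambda>w. f (map h w)) \<lhd> (\<lambda>w. g (map h w))) w"
  by (cases w) (simp_all add: half_shuffle_Cons unshuffle_map reduced_def)

definition word :: "nat list \<Rightarrow> word_fun" where
  "word u w = (if w = u then 1 else 0)"

text \<open>Hence a right comb of letters evaluates to a single word.\<close>

lemma letter_half_shuffle:
  assumes "u \<noteq> []"
  shows "word [x] \<lhd> word u = word (x # u)"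
proof
  fix w
  show "(word [x] \<lhd> word u) w = word (x # u) w"
  proof (cases w)
    case (Cons y w')
    have "(word [x] \<lhd> word u) w =
      unshuffle w' (\<lambda>a v. if a = [] then (if y = x \<and> v = u then 1 else 0) else 0)"
      unfolding Cons half_shuffle_Cons
      by (rule arg_cong[where f = "unshuffle w'"]) (use assms in \<open>auto simp: word_def reduced_def fun_eq_iff\<close>)
    then show ?thesis by (simp add: unshuffle_indicator Cons word_def)
  qed (simp add: word_def)
qed

section \<open>Words of a bracketing\<close>

text \<open>This is \<open>\<Sum>\<^sub>w c\<^sub>w f(w)\<close>, where \<open>\<Sum>\<^sub>w c\<^sub>w w\<close> is the image of the bracketing in the free associative
  algebra. The values of \<open>f\<close> lie in any vector space, since \<open>f\<close> will also take Lie elements as values.\<close>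

primrec word_sum :: "bracketing \<Rightarrow> (nat list \<Rightarrow> 'a::rat_vector) \<Rightarrow> 'a" where
  "word_sum (Var i) f = f [i]"
| "word_sum (Br s t) f = word_sum s (\<lambda>u. word_sum t (\<lambda>v. f (u @ v) - f (v @ u)))"

lemma word_sum_add: "word_sum t (\<lambda>w. f w + g w) = word_sum t f + word_sum t g"
proof (induction t arbitrary: f g)
  case (Br s t)
  show ?case by (simp add: add_diff_add Br)
qed simp

lemma word_sum_scale: "word_sum t (\<lambda>w. c *\<^sub>Q f w) = c *\<^sub>Q word_sum t f"
  by (induction t arbitrary: f) (simp_all flip: rat_vector.scale_right_diff_distrib)

lemma qlinear_word_sum: "qlinear (word_sum t)"
  by (rule qlinearI)
    (simp_all add: word_sum_add[of t] word_sum_scale[of t] plus_fun_def scaleQ_fun_def)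

lemma word_sum_zero [simp]: "word_sum t (\<lambda>w. 0) = 0"
  using word_sum_scale[of t 0 "\<lambda>w. 0"] by simp

lemma word_sum_minus: "word_sum t (\<lambda>w. - f w) = - word_sum t f"
  using word_sum_add[of t f "\<lambda>w. - f w"] by (simp add: add_eq_0_iff)

lemma word_sum_diff: "word_sum t (\<lambda>w. f w - g w) = word_sum t f - word_sum t g"
  using word_sum_add[of t f "\<lambda>w. - g w"] by (simp add: word_sum_minus)

lemma word_sum_linear:
  assumes "qlinear h"
  shows "h (word_sum t f) = word_sum t (\<lambda>w. h (f w))"
  by (induction t arbitrary: f) (simp_all add: qlinear_diff[OF assms])

lemma word_sum_swap: "word_sum s (\<lambda>u. word_sum t (F u)) = word_sum t (\<lambda>v. word_sum s (\<lambda>u. F u v))"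
proof (induction s arbitrary: F)
  case (Br a b)
  show ?case by (simp add: Br word_sum_diff[symmetric])
qed simp

lemma word_sum_antisym: "word_sum (Br s t) f = - word_sum (Br t s) f"
  by (simp add: word_sum_swap[of s t] flip: word_sum_minus)

lemma word_sum_cong:
  assumes "\<And>w. mset w = mset (letters t) \<Longrightarrow> f w = g w"
  shows "word_sum t f = word_sum t g"
  using assms
proof (induction t arbitrary: f g)
  case (Br s t)
  show ?case unfolding word_sum.simps
    by (rule Br.IH(1), rule Br.IH(2)) (simp add: Br.prems)
qed simp

lemma word_sum_rename: "word_sum (rename h t) f = word_sum t (\<lambda>w. f (map h w))"
  by (induction t arbitrary: f) simp_all

lemma word_sum_unshuffle:
  "word_sum t (\<lambda>v. unshuffle u (\<lambda>a b. F v a b)) = unshuffle u (\<lambda>a b. word_sum t (\<lambda>v. F v a b))"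
  by (induction u arbitrary: F) (simp_all add: word_sum_add)

text \<open>The easy half of the theorem of Ree: a bracketing is primitive for the unshuffle coproduct, that is,
  only the two trivial splittings survive. In the induction step the two terms that split
  \<open>s t - t s\<close> between \<open>s\<close> and \<open>t\<close> cancel.\<close>

lemma word_sum_shuffle:
  "word_sum t (\<lambda>w. unshuffle w F) = word_sum t (\<lambda>w. F w []) + word_sum t (\<lambda>w. F [] w)"
proof (induction t arbitrary: F)
  case (Br s t)
  have 1: "word_sum t (\<lambda>v. unshuffle (u @ v) F) =
      unshuffle u (\<lambda>a b. word_sum t (\<lambda>v. F (a @ v) b + F a (b @ v)))" for u
    by (simp add: unshuffle_append word_sum_unshuffle Br.IH(2) word_sum_add)
  have 2: "word_sum s (\<lambda>u. unshuffle (v @ u) F) =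
      unshuffle v (\<lambda>a b. word_sum s (\<lambda>u. F (a @ u) b + F a (b @ u)))" for v
    by (simp add: unshuffle_append word_sum_unshuffle Br.IH(1) word_sum_add)
  have "word_sum (Br s t) (\<lambda>w. unshuffle w F) =
      word_sum s (\<lambda>u. word_sum t (\<lambda>v. unshuffle (u @ v) F))
      - word_sum t (\<lambda>v. word_sum s (\<lambda>u. unshuffle (v @ u) F))"
    by (simp add: word_sum_diff word_sum_swap[of t s])
  also have "\<dots> = word_sum (Br s t) (\<lambda>w. F w []) + word_sum (Br s t) (\<lambda>w. F [] w)"
    unfolding 1 2 Br.IH
    by (simp add: word_sum_diff word_sum_add word_sum_swap[of t s])
  finally show ?case .
qed simp

lemma word_sum_word_expand:
  assumes "finite W" "\<And>w. mset w = mset (letters t) \<Longrightarrow> w \<in> W"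
  shows "word_sum t f = (\<Sum>w\<in>W. word_sum t (word w) *\<^sub>Q f w)"
proof -
  have "word_sum t f = word_sum t (\<Sum>w\<in>W. (\<lambda>v. word w v *\<^sub>Q f w))"
  proof (rule word_sum_cong)
    fix v assume "mset v = mset (letters t)"
    then have "v \<in> W" by (rule assms(2))
    have "(\<Sum>w\<in>W. (\<lambda>v. word w v *\<^sub>Q f w)) v = (\<Sum>w\<in>W. if v = w then f w else 0)"
      unfolding sum_apply by (rule sum.cong) (auto simp: word_def scaleQ_one)
    then show "f v = (\<Sum>w\<in>W. (\<lambda>v. word w v *\<^sub>Q f w)) v"
      using assms(1) \<open>v \<in> W\<close> by simp
  qed
  also have "\<dots> = (\<Sum>w\<in>W. word_sum t (\<lambda>v. word w v *\<^sub>Q f w))"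
    by (rule qlinear_sum[OF qlinear_word_sum])
  also have "\<dots> = (\<Sum>w\<in>W. word_sum t (word w) *\<^sub>Q f w)"
  proof (rule sum.cong[OF refl])
    fix w
    have "qlinear (\<lambda>c. c *\<^sub>Q f w)"
      by (rule qlinearI) (simp_all add: scaleQ_add_left scaleQ_scaleQ)
    from word_sum_linear[OF this]
    show "word_sum t (\<lambda>v. word w v *\<^sub>Q f w) = word_sum t (word w) *\<^sub>Q f w" by (rule sym)
  qed
  finally show ?thesis .
qed

section \<open>The free Lie algebra\<close>

lemma lin_ext_bracket:
  "lin_ext word_sum (free_bracket x y) f
    = lin_ext word_sum x (\<lambda>u. lin_ext word_sum y (\<lambda>v. f (u @ v) - f (v @ u)))"
proof -
  have *: "lin_ext (\<lambda>b. word_sum (Br a b) f) y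
      = word_sum a (\<lambda>u. lin_ext word_sum y (\<lambda>v. f (u @ v) - f (v @ u)))" for a
    using qlinear_lin_ext_swap[OF qlinear_word_sum, of a "\<lambda>b u. word_sum b (\<lambda>v. f (u @ v) - f (v @ u))" y]
    by (simp add: lin_ext_apply[abs_def])
  have "lin_ext word_sum (free_bracket x y) f
      = lin_ext (\<lambda>a. lin_ext (\<lambda>b. word_sum (Br a b) f) y) x"
    by (simp only: lin_ext_bilin_ext lin_ext_apply)
  then show ?thesis unfolding * by (simp only: lin_ext_apply)
qed

lemma lin_ext_word_sum_swap:
  "lin_ext word_sum x (\<lambda>u. lin_ext word_sum y (F u)) = lin_ext word_sum y (\<lambda>v. lin_ext word_sum x (\<lambda>u. F u v))"
proof -
  have "lin_ext word_sum x (\<lambda>u. lin_ext word_sum y (F u))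
    = lin_ext (\<lambda>a. lin_ext (\<lambda>b. word_sum a (\<lambda>u. word_sum b (F u))) y) x" for x y and F :: "nat list \<Rightarrow> nat list \<Rightarrow> 'a"
    using qlinear_lin_ext_swap[OF qlinear_word_sum, of _ "\<lambda>b u. word_sum b (F u)" y]
    by (simp add: lin_ext_apply[abs_def])
  note * = this
  show ?thesis
    unfolding * by (rule trans[OF lin_ext_swap]) (simp only: word_sum_swap[of _ _ F])
qed

lemma qlinear_lin_ext_word_sum: "qlinear (lin_ext word_sum x)"
  by (rule qlinearI; simp add: lin_ext_apply lin_ext_def qlinear_add[OF qlinear_word_sum]
     qlinear_scale[OF qlinear_word_sum] scaleQ_add_right sum.distrib
     rat_vector.scale_sum_right scaleQ_scaleQ mult.commute)

lemmas lin_ext_word_sum_add =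
  qlinear_add[OF qlinear_lin_ext_word_sum, unfolded plus_fun_def]
lemmas lin_ext_word_sum_diff =
  qlinear_diff[OF qlinear_lin_ext_word_sum, unfolded fun_diff_def]

lemma lin_ext_word_sum_0 [simp]: "lin_ext word_sum x (\<lambda>w. 0) = 0"
  using qlinear_0[OF qlinear_lin_ext_word_sum] by (simp add: zero_fun_def)

text \<open>The commutator of the free associative algebra is alternating and satisfies the Jacobi identity, so
  the expansion into words factors through the free Lie algebra.\<close>

lemma lie_ideal_word_sum: "x \<in> lie_ideal \<Longrightarrow> lin_ext word_sum x f = (0 :: 'a::rat_vector)"
proof (induction arbitrary: f rule: lie_ideal.induct)
  case (alternating x)
  show ?case
    unfolding lin_ext_bracket lin_ext_word_sum_diff
    by (subst lin_ext_word_sum_swap) simp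
next
  case (jacobi x y z)
  let ?F = "\<lambda>u v w. f (u @ v @ w) - f (v @ w @ u) - (f (u @ w @ v) - f (w @ v @ u))"
  have triple: "lin_ext word_sum (free_bracket a (free_bracket b c)) f
      = lin_ext word_sum a (\<lambda>u. lin_ext word_sum b (\<lambda>v. lin_ext word_sum c (?F u v)))" for a b c
    by (simp only: lin_ext_bracket append_assoc)
  let ?L = "\<lambda>F. lin_ext word_sum x (\<lambda>u. lin_ext word_sum y (\<lambda>v. lin_ext word_sum z (F u v)))"
  have "lin_ext word_sum (free_bracket y (free_bracket z x)) f = ?L (\<lambda>u v w. ?F v w u)"
    unfolding triple lin_ext_word_sum_swap[of z x] lin_ext_word_sum_swap[of y x] ..
  moreover have "lin_ext word_sum (free_bracket z (free_bracket x y)) f = ?L (\<lambda>u v w. ?F w u v)"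
    unfolding triple lin_ext_word_sum_swap[of z x] lin_ext_word_sum_swap[of z y] ..
  ultimately have "lin_ext word_sum (free_bracket x (free_bracket y z)
      + free_bracket y (free_bracket z x) + free_bracket z (free_bracket x y)) f
      = ?L (\<lambda>u v w. ?F u v w + ?F v w u + ?F w u v)"
    unfolding lin_ext_add plus_fun_def lin_ext_word_sum_add triple[of x y z] by (simp only:)
  moreover have "?F u v w + ?F v w u + ?F w u v = 0" for u v w
    by (simp only: diff_conv_add_uminus minus_add_distrib minus_minus) (simp add: ac_simps)
  then have "?L (\<lambda>u v w. ?F u v w + ?F v w u + ?F w u v) = ?L (\<lambda>u v w. 0)"
    by (simp only:)
  ultimately show ?case by simp
next
  case (add x y) then show ?case by (simp add: lin_ext_add)
next
  case (scale x c) then show ?case by (simp add: lin_ext_scale)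
next
  case (bracket_left x y) then show ?case unfolding lin_ext_bracket by simp
next
  case (bracket_right y x)
  then show ?case unfolding lin_ext_bracket by simp
qed (simp add: lin_ext_def)

lift_definition lie_word_sum :: "free_lie \<Rightarrow> word_fun \<Rightarrow> rat" is "lin_ext word_sum"
proof (rule ext)
  fix x y :: "bracketing \<Rightarrow>\<^sub>0 rat" and f :: word_fun
  assume "x - y \<in> lie_ideal"
  then have "lin_ext word_sum (x - y) f = 0" by (rule lie_ideal_word_sum)
  then show "lin_ext word_sum x f = lin_ext word_sum y f"
    by (simp add: qlinear_diff[OF qlinear_lin_ext])
qed

definition lie_of :: "bracketing \<Rightarrow> free_lie" where
  "lie_of t = abs_free_lie (basis_vec t)"

lemma qlinear_abs_free_lie: "qlinear abs_free_lie"
  by (rule qlinearI) (simp_all add: plus_free_lie.abs_eq scaleQ_free_lie.abs_eq)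

lemma abs_free_lie_eq: "abs_free_lie x = lin_ext lie_of x"
  unfolding lie_of_def by (rule qlinear_eq_lin_ext[OF qlinear_abs_free_lie])

lemma lie_word_sum_lie_of [simp]: "lie_word_sum (lie_of t) f = word_sum t f"
  by (simp add: lie_of_def lie_word_sum.abs_eq)

lemma qlinear_lie_word_sum: "qlinear lie_word_sum"
  by (rule qlinearI; transfer) (rule lin_ext_add lin_ext_scale)+

lift_definition lie_bracket :: "free_lie \<Rightarrow> free_lie \<Rightarrow> free_lie" is free_bracket
proof -
  fix x x' y y' :: "bracketing \<Rightarrow>\<^sub>0 rat"
  assume *: "x - x' \<in> lie_ideal" "y - y' \<in> lie_ideal"
  have "free_bracket (x - x') y + free_bracket x' (y - y') \<in> lie_ideal"
    by (intro lie_ideal.add lie_ideal.bracket_left lie_ideal.bracket_right *)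
  then show "free_bracket x y - free_bracket x' y' \<in> lie_ideal"
    by (simp add: qlinear_diff[OF qlinear_bilin_ext_left]
        qlinear_diff[OF qlinear_bilin_ext_right])
qed

lemma lie_bracket_lie_of [simp]: "lie_bracket (lie_of s) (lie_of t) = lie_of (Br s t)"
  by (simp add: lie_of_def lie_bracket.abs_eq)

lemma qlinear_lie_bracket_left: "qlinear (\<lambda>x. lie_bracket x y)"
  by (rule qlinearI; transfer)
    (simp_all add: bilin_ext_add_left bilin_ext_scale_left lie_ideal.zero)

lemma qlinear_lie_bracket_right: "qlinear (lie_bracket x)"
  by (rule qlinearI; transfer)
    (simp_all add: bilin_ext_add_right bilin_ext_scale_right lie_ideal.zero)

lemma lie_bracket_self: "lie_bracket x x = 0"
  by transfer (simp add: lie_ideal.alternating)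

lemma lie_bracket_antisym: "lie_bracket x y = - lie_bracket y x"
proof -
  have "lie_bracket (x + y) (x + y) = lie_bracket x y + lie_bracket y x"
    unfolding qlinear_add[OF qlinear_lie_bracket_left]
      qlinear_add[OF qlinear_lie_bracket_right] by (simp add: lie_bracket_self)
  then show ?thesis by (simp add: lie_bracket_self eq_neg_iff_add_eq_0)
qed

lemma lie_jacobi:
  "lie_bracket x (lie_bracket y z) + lie_bracket y (lie_bracket z x) + lie_bracket z (lie_bracket x y) = 0"
  by transfer (simp add: lie_ideal.jacobi)

lemma lie_bracket_nested:
  "lie_bracket x (lie_bracket y z) = lie_bracket (lie_bracket x y) z - lie_bracket (lie_bracket x z) y"
proof -
  have "lie_bracket y (lie_bracket z x) = lie_bracket (lie_bracket x z) y"
    unfolding lie_bracket_antisym[of z x] lie_bracket_antisym[of y "- lie_bracket x z"]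
    by (simp add: qlinear_neg[OF qlinear_lie_bracket_left])
  moreover have "lie_bracket z (lie_bracket x y) = - lie_bracket (lie_bracket x y) z"
    by (rule lie_bracket_antisym)
  ultimately show ?thesis using lie_jacobi[of x y z] by (simp add: algebra_simps)
qed

definition ad_word :: "free_lie \<Rightarrow> nat list \<Rightarrow> free_lie" where
  "ad_word = foldl (\<lambda>x i. lie_bracket x (lie_of (Var i)))"

lemma ad_word_simps [simp]:
  "ad_word x [] = x"
  "ad_word x (i # w) = ad_word (lie_bracket x (lie_of (Var i))) w"
  "ad_word x (u @ w) = ad_word (ad_word x u) w"
  by (simp_all add: ad_word_def)

lemma ad_word_0 [simp]: "ad_word 0 w = 0"
  by (induction w) (simp_all add: qlinear_0[OF qlinear_lie_bracket_left])

text \<open>By the Jacobi identity, bracketing with \<open>[s, t]\<close> is the commutator of bracketing with \<open>s\<close> and with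
  \<open>t\<close>. So bracketing with \<open>t\<close> expands like \<open>t\<close> itself, each word acting letter by letter.\<close>

lemma lie_bracket_eq_word_sum: "lie_bracket x (lie_of t) = word_sum t (ad_word x)"
proof (induction t arbitrary: x)
  case (Br s t)
  have "lie_bracket x (lie_of (Br s t)) = lie_bracket (lie_bracket x (lie_of s)) (lie_of t)
      - lie_bracket (lie_bracket x (lie_of t)) (lie_of s)"
    unfolding lie_bracket_lie_of[symmetric] by (rule lie_bracket_nested)
  also have "lie_bracket (lie_bracket x (lie_of s)) (lie_of t)
      = word_sum s (\<lambda>u. word_sum t (\<lambda>v. ad_word x (u @ v)))"
    unfolding Br.IH(1) unfolding word_sum_linear[OF qlinear_lie_bracket_left]
    unfolding Br.IH(2) ad_word_simps ..
  also have "lie_bracket (lie_bracket x (lie_of t)) (lie_of s)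
      = word_sum t (\<lambda>v. word_sum s (\<lambda>u. ad_word x (v @ u)))"
    unfolding Br.IH(2) unfolding word_sum_linear[OF qlinear_lie_bracket_left]
    unfolding Br.IH(1) ad_word_simps ..
  finally show ?case by (simp add: word_sum_diff word_sum_swap[of t s])
qed simp

definition left_comb :: "nat \<Rightarrow> nat list \<Rightarrow> bracketing" where
  "left_comb z = foldl (\<lambda>t i. Br t (Var i)) (Var z)"

lemma left_comb_snoc: "left_comb z (w @ [x]) = Br (left_comb z w) (Var x)"
  by (simp add: left_comb_def)

lemma letters_left_comb [simp]: "letters (left_comb z w) = z # w"
  by (induction w rule: rev_induct) (simp_all add: left_comb_snoc, simp add: left_comb_def)

lemma lie_of_left_comb: "lie_of (left_comb z w) = ad_word (lie_of (Var z)) w"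
  by (induction w rule: rev_induct)
    (simp_all add: left_comb_snoc flip: lie_bracket_lie_of, simp add: left_comb_def)

text \<open>Each of the brackets of the left comb adds its letter either at the end or at the front, and \<open>z\<close>
  remains the first letter only if all of them are added at the end.\<close>

lemma left_comb_coefficient:
  assumes "z \<notin> set v"
  shows "word_sum (left_comb z v) (word (z # w)) = (if v = w then 1 else 0)"
  using assms
proof (induction v arbitrary: w rule: rev_induct)
  case Nil
  show ?case by (simp add: left_comb_def word_def)
next
  case (snoc x v)
  have *: "(\<lambda>u. word (z # w) (u @ [x]) - word (z # w) (x # u))
      = (if w \<noteq> [] \<and> last w = x then word (z # butlast w) else (\<lambda>u. 0))"
    using snoc.prems by (cases w rule: rev_cases) (auto simp: fun_eq_iff word_def Cons_eq_append_conv append_eq_Cons_conv)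
  show ?case
    unfolding left_comb_snoc word_sum.simps append_Cons append_Nil *
    using snoc by (cases w rule: rev_cases) auto
qed

lemma letters_nonempty: "letters t \<noteq> []"
  by (induction t) auto

definition leading :: "nat \<Rightarrow> nat list \<Rightarrow> free_lie" where
  "leading z w = (if w \<noteq> [] \<and> hd w = z then lie_of (left_comb z (tl w)) else 0)"

text \<open>A multilinear bracketing is recovered from the words of its expansion that begin with a chosen
  letter \<open>z\<close>. For \<open>[s, t]\<close> with \<open>z\<close> in \<open>s\<close>, the words in which \<open>t\<close> comes first do not begin with \<open>z\<close>, and
  the others let the words of \<open>t\<close> act on the left combs that make up \<open>s\<close>.\<close>

lemma lie_of_eq_word_sum:
  assumes "distinct (letters t)" "z \<in> set (letters t)"
  shows "lie_of t = word_sum t (leading z)"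
  using assms
proof (induction t)
  case (Var i)
  then show ?case by (simp add: leading_def left_comb_def)
next
  case (Br s t)
  have left: "lie_of (Br a b) = word_sum (Br a b) (leading z)"
    if a: "lie_of a = word_sum a (leading z)" and z: "z \<notin> set (letters b)" for a b
  proof -
    have "word_sum (Br a b) (leading z) = word_sum a (\<lambda>u. word_sum b (ad_word (leading z u)))"
      unfolding word_sum.simps
    proof (rule word_sum_cong, rule word_sum_cong)
      fix u v assume "mset u = mset (letters a)" "mset v = mset (letters b)"
      then have "set v = set (letters b)" "u \<noteq> []" "v \<noteq> []"
        using letters_nonempty mset_zero_iff by (auto dest: mset_eq_setD)
      then have "u \<noteq> []" "v \<noteq> []" "hd v \<noteq> z"
        using z hd_in_set[of v] by auto
      then show "leading z (u @ v) - leading z (v @ u) = ad_word (leading z u) v"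
        by (auto simp: leading_def lie_of_left_comb)
    qed
    also have "\<dots> = lie_bracket (word_sum a (leading z)) (lie_of b)"
      by (simp add: lie_bracket_eq_word_sum[symmetric] word_sum_linear[OF qlinear_lie_bracket_left])
    finally show ?thesis by (simp flip: a)
  qed
  show ?case
  proof (cases "z \<in> set (letters s)")
    case True
    then show ?thesis using Br by (intro left) auto
  next
    case False
    then have "lie_of (Br t s) = word_sum (Br t s) (leading z)" using Br by (intro left) auto
    moreover have "lie_of (Br s t) = - lie_of (Br t s)"
      unfolding lie_bracket_lie_of[symmetric] by (rule lie_bracket_antisym)
    ultimately show ?thesis using word_sum_antisym[of s t "leading z"] by (simp only:)
  qed
qed

section \<open>Dendriform trees acting on words\<close>

text \<open>Inputs are numbered from 1. Since \<open>x \<succ> y\<close> becomes \<open>y \<prec> x\<close> in the Zinbiel operad, \<open>Succ\<close> is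
  evaluated as the half-shuffle with its arguments exchanged.\<close>

primrec tree_eval :: "tree \<Rightarrow> (nat \<Rightarrow> word_fun) \<Rightarrow> word_fun" where
  "tree_eval Leaf a = a 1"
| "tree_eval (Prec l r) a = tree_eval l a \<lhd> tree_eval r (\<lambda>i. a (i + leaves l))"
| "tree_eval (Succ l r) a = tree_eval r (\<lambda>i. a (i + leaves l)) \<lhd> tree_eval l a"

lemma leaves_pos: "1 \<le> leaves t"
  by (induction t) auto

lemma tree_eval_cong:
  assumes "\<And>i. 1 \<le> i \<Longrightarrow> i \<le> leaves t \<Longrightarrow> a i = b i"
  shows "tree_eval t a = tree_eval t b"
  using assms
proof (induction t arbitrary: a b)
  case (Prec l r)
  have "tree_eval l a = tree_eval l b" by (rule Prec.IH) (simp add: Prec.prems)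
  moreover have "tree_eval r (\<lambda>i. a (i + leaves l)) = tree_eval r (\<lambda>i. b (i + leaves l))"
    by (rule Prec.IH) (simp add: Prec.prems)
  ultimately show ?case by simp
next
  case (Succ l r)
  have "tree_eval l a = tree_eval l b" by (rule Succ.IH) (simp add: Succ.prems)
  moreover have "tree_eval r (\<lambda>i. a (i + leaves l)) = tree_eval r (\<lambda>i. b (i + leaves l))"
    by (rule Succ.IH) (simp add: Succ.prems)
  ultimately show ?case by simp
qed simp

lemma qlinear_tree_eval_slot:
  assumes "1 \<le> i" "i \<le> leaves t"
  shows "qlinear (\<lambda>b. tree_eval t (a(i := b)))"
  using assms
proof (induction t arbitrary: a i)
  case Leaf
  then have "i = 1" by simp
  show ?case unfolding \<open>i = 1\<close> unfolding tree_eval.simps fun_upd_same by (rule qlinearI) (rule refl)+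
next
  case (Prec l r)
  show ?case
  proof (cases "i \<le> leaves l")
    case True
    then have *: "tree_eval r (\<lambda>j. (a(i := b)) (j + leaves l)) = tree_eval r (\<lambda>j. a (j + leaves l))" for b
      by (intro tree_eval_cong) auto
    show ?thesis unfolding tree_eval.simps *
      by (rule qlinear_compose[OF qlinear_half_shuffle_left Prec.IH(1)[OF Prec.prems(1) True]])
  next
    case False
    then have 1: "tree_eval l (a(i := b)) = tree_eval l a" for b
      by (intro tree_eval_cong) auto
    have 2: "(\<lambda>j. (a(i := b)) (j + leaves l)) = (\<lambda>j. a (j + leaves l))(i - leaves l := b)" for b
      using False by (auto simp: fun_eq_iff)
    have "1 \<le> i - leaves l" "i - leaves l \<le> leaves r" using False Prec.prems by auto
    then show ?thesis unfolding tree_eval.simps 1 2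
      by (intro qlinear_compose[OF qlinear_half_shuffle_right Prec.IH(2)])
  qed
next
  case (Succ l r)
  show ?case
  proof (cases "i \<le> leaves l")
    case True
    then have *: "tree_eval r (\<lambda>j. (a(i := b)) (j + leaves l)) = tree_eval r (\<lambda>j. a (j + leaves l))" for b
      by (intro tree_eval_cong) auto
    show ?thesis unfolding tree_eval.simps *
      by (rule qlinear_compose[OF qlinear_half_shuffle_right Succ.IH(1)[OF Succ.prems(1) True]])
  next
    case False
    then have 1: "tree_eval l (a(i := b)) = tree_eval l a" for b
      by (intro tree_eval_cong) auto
    have 2: "(\<lambda>j. (a(i := b)) (j + leaves l)) = (\<lambda>j. a (j + leaves l))(i - leaves l := b)" for b
      using False by (auto simp: fun_eq_iff)
    have "1 \<le> i - leaves l" "i - leaves l \<le> leaves r" using False Succ.prems by auto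
    then show ?thesis unfolding tree_eval.simps 1 2
      by (intro qlinear_compose[OF qlinear_half_shuffle_left Succ.IH(2)])
  qed
qed

text \<open>The inputs of \<open>f\<close> when \<open>f \<circ>\<^sub>i g\<close>, with \<open>g\<close> of arity \<open>n\<close> and value \<open>b\<close>, is applied to \<open>a\<close>.\<close>

definition plug :: "nat \<Rightarrow> nat \<Rightarrow> 'b \<Rightarrow> (nat \<Rightarrow> 'b) \<Rightarrow> nat \<Rightarrow> 'b" where
  "plug i n b a j = (if j < i then a j else if j = i then b else a (j + n - 1))"

lemma plug_eq_upd: "plug i n b a = (plug i n b' a)(i := b)"
  by (auto simp: plug_def fun_eq_iff)

lemma leaves_graft: "leaves (graft i t s) = leaves t + leaves s - 1"
proof (induction t arbitrary: i)
  case (Prec l r)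
  then show ?case using leaves_pos[of l] leaves_pos[of r] leaves_pos[of s] by (simp add: add_ac)
next
  case (Succ l r)
  then show ?case using leaves_pos[of l] leaves_pos[of r] leaves_pos[of s] by (simp add: add_ac)
qed simp

lemma tree_eval_graft:
  assumes "1 \<le> i" "i \<le> leaves t"
  shows "tree_eval (graft i t s) a
    = tree_eval t (plug i (leaves s) (tree_eval s (\<lambda>k. a (k + i - 1))) a)"
  using assms
proof (induction t arbitrary: i a)
  case Leaf
  then show ?case by (simp add: plug_def)
next
  case (Prec l r)
  let ?b = "tree_eval s (\<lambda>k. a (k + i - 1))"
  have s: "1 \<le> leaves s" and l: "1 \<le> leaves l" by (rule leaves_pos)+
  show ?case
  proof (cases "i \<le> leaves l")
    case True
    have "tree_eval r (\<lambda>j. a (j + leaves (graft i l s)))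
        = tree_eval r (\<lambda>j. plug i (leaves s) ?b a (j + leaves l))"
      using True s l by (intro tree_eval_cong) (simp add: plug_def leaves_graft add.assoc)
    then show ?thesis using True Prec by simp
  next
    case False
    have "tree_eval l a = tree_eval l (plug i (leaves s) ?b a)"
      using False by (intro tree_eval_cong) (simp add: plug_def)
    moreover have "plug (i - leaves l) (leaves s) (tree_eval s (\<lambda>k. a (k + (i - leaves l) - 1 + leaves l)))
        (\<lambda>j. a (j + leaves l)) = (\<lambda>j. plug i (leaves s) ?b a (j + leaves l))"
    proof -
      have "(\<lambda>k. a (k + (i - leaves l) - 1 + leaves l)) = (\<lambda>k. a (k + i - 1))"
        by (rule ext, rule arg_cong[where f = a]) (use False in simp)
      then show ?thesis
        by (simp only:) (rule ext, use False s in \<open>auto simp: plug_def add_ac\<close>)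
    qed
    ultimately show ?thesis using False Prec.prems Prec.IH(2)[of "i - leaves l"] by simp
  qed
next
  case (Succ l r)
  let ?b = "tree_eval s (\<lambda>k. a (k + i - 1))"
  have s: "1 \<le> leaves s" and l: "1 \<le> leaves l" by (rule leaves_pos)+
  show ?case
  proof (cases "i \<le> leaves l")
    case True
    have "tree_eval r (\<lambda>j. a (j + leaves (graft i l s)))
        = tree_eval r (\<lambda>j. plug i (leaves s) ?b a (j + leaves l))"
      using True s l by (intro tree_eval_cong) (simp add: plug_def leaves_graft add.assoc)
    then show ?thesis using True Succ by simp
  next
    case False
    have "tree_eval l a = tree_eval l (plug i (leaves s) ?b a)"
      using False by (intro tree_eval_cong) (simp add: plug_def)
    moreover have "plug (i - leaves l) (leaves s) (tree_eval s (\<lambda>k. a (k + (i - leaves l) - 1 + leaves l)))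
        (\<lambda>j. a (j + leaves l)) = (\<lambda>j. plug i (leaves s) ?b a (j + leaves l))"
    proof -
      have "(\<lambda>k. a (k + (i - leaves l) - 1 + leaves l)) = (\<lambda>k. a (k + i - 1))"
        by (rule ext, rule arg_cong[where f = a]) (use False in simp)
      then show ?thesis
        by (simp only:) (rule ext, use False s in \<open>auto simp: plug_def add_ac\<close>)
    qed
    ultimately show ?thesis using False Succ.prems Succ.IH(2)[of "i - leaves l"] by simp
  qed
qed

section \<open>The dendriform operad acting on words\<close>

lemma Free_dend_simps:
  "arity_space Free_dend n = {x. \<forall>t\<in>Poly_Mapping.keys x. leaves t = n}"
  "pcomp Free_dend m n i = bilin_ext (graft i)"
  "op_unit Free_dend = basis_vec Leaf"
  by (simp_all add: Free_dend_def)

lemma keys_basis_vec [simp]: "Poly_Mapping.keys (basis_vec t) = {t}"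
  by (simp add: basis_vec_def)

lemma subspace_keys: "rat_vector.subspace {x :: 'a \<Rightarrow>\<^sub>0 rat. \<forall>t\<in>Poly_Mapping.keys x. P t}"
  unfolding rat_vector.subspace_def
  using keys_add by (fastforce simp: in_keys_iff lookup_scaleQ lookup_add)

lemma subspace_Free_dend: "rat_vector.subspace (arity_space Free_dend n)"
  unfolding Free_dend_simps by (rule subspace_keys)

lemma keys_bilin_ext:
  "Poly_Mapping.keys (bilin_ext f x y) \<subseteq> (\<lambda>(a, b). f a b) ` (Poly_Mapping.keys x \<times> Poly_Mapping.keys y)"
proof -
  show ?thesis
  proof
    fix k assume "k \<in> Poly_Mapping.keys (bilin_ext f x y)"
    then obtain a where a: "a \<in> Poly_Mapping.keys x" "k \<in> Poly_Mapping.keys (\<Sum>b\<in>Poly_Mapping.keys y.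
        Poly_Mapping.single (f a b) (Poly_Mapping.lookup x a * Poly_Mapping.lookup y b))"
      unfolding bilin_ext_def using Poly_Mapping.keys_sum by fast
    then obtain b where "b \<in> Poly_Mapping.keys y"
      "k \<in> Poly_Mapping.keys (Poly_Mapping.single (f a b) (Poly_Mapping.lookup x a * Poly_Mapping.lookup y b))"
      using Poly_Mapping.keys_sum by fast
    then show "k \<in> (\<lambda>(a, b). f a b) ` (Poly_Mapping.keys x \<times> Poly_Mapping.keys y)"
      using a(1) by (auto split: if_splits)
  qed
qed

lemma free_comp_arity:
  assumes "x \<in> arity_space Free_dend m" "y \<in> arity_space Free_dend n"
  shows "bilin_ext (graft i) x y \<in> arity_space Free_dend (m + n - 1)"
  using assms keys_bilin_ext[of "graft i" x y] by (fastforce simp: Free_dend_simps leaves_graft)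

lemma lin_ext_tree_eval_graft:
  assumes "x \<in> arity_space Free_dend m" "y \<in> arity_space Free_dend n" "1 \<le> i" "i \<le> m"
  shows "lin_ext tree_eval (bilin_ext (graft i) x y) a
    = lin_ext tree_eval x (plug i n (lin_ext tree_eval y (\<lambda>k. a (k + i - 1))) a)"
proof -
  have "lin_ext (\<lambda>s. tree_eval (graft i t s)) y a
      = tree_eval t (plug i n (lin_ext tree_eval y (\<lambda>k. a (k + i - 1))) a)"
    if "t \<in> Poly_Mapping.keys x" for t
  proof -
    have t: "leaves t = m" using that assms(1) by (simp add: Free_dend_simps)
    have "lin_ext (\<lambda>s. tree_eval (graft i t s)) y a
        = lin_ext (\<lambda>s. tree_eval t ((plug i n 0 a)(i := tree_eval s (\<lambda>k. a (k + i - 1))))) y"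
      unfolding lin_ext_apply[of _ y a]
      by (rule lin_ext_cong)
        (use assms t in \<open>simp add: Free_dend_simps tree_eval_graft flip: plug_eq_upd\<close>)
    also have "\<dots> = tree_eval t ((plug i n 0 a)(i := lin_ext tree_eval y (\<lambda>k. a (k + i - 1))))"
      unfolding lin_ext_apply[of tree_eval]
      by (subst qlinear_lin_ext_swap[OF qlinear_tree_eval_slot]) (use assms t in auto)
    finally show ?thesis by (simp flip: plug_eq_upd)
  qed
  then have "lin_ext (\<lambda>t. lin_ext (\<lambda>s. tree_eval (graft i t s)) y a) x
      = lin_ext (\<lambda>t. tree_eval t (plug i n (lin_ext tree_eval y (\<lambda>k. a (k + i - 1))) a)) x"
    by (rule lin_ext_cong)
  then show ?thesis by (simp add: lin_ext_bilin_ext lin_ext_apply)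
qed

lemma tree_eval_slot_0:
  assumes "x \<in> arity_space Free_dend m" "1 \<le> i" "i \<le> m"
  shows "lin_ext tree_eval x (plug i n 0 a) = 0"
proof -
  have "tree_eval t (plug i n 0 a) = 0" if "t \<in> Poly_Mapping.keys x" for t
  proof -
    have "qlinear (\<lambda>b. tree_eval t ((plug i n 0 a)(i := b)))"
      using that assms by (intro qlinear_tree_eval_slot) (auto simp: Free_dend_simps)
    then show ?thesis
      using qlinear_0 by (fastforce simp flip: plug_eq_upd)
  qed
  then show ?thesis by (simp add: lin_ext_apply lin_ext_def)
qed

text \<open>With \<open>x \<succ> y\<close> read as \<open>y \<prec> x\<close> the relations hold in every Zinbiel algebra, and the property of vanishing under evaluation is
  preserved by composition on either side.\<close>

lemma ns_ideal_tree_eval: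
  assumes "ns_ideal Free_dend dend_relations n x"
  shows "1 \<le> n \<and> x \<in> arity_space Free_dend n \<and> lin_ext tree_eval x = 0"
  using assms
proof (induction rule: ns_ideal.induct)
  case (generator x n)
  have "rat_vector.subspace {x :: tree \<Rightarrow>\<^sub>0 rat. \<forall>t\<in>Poly_Mapping.keys x. leaves t = 3}" by (rule subspace_keys)
  note mem = rat_vector.subspace_add[OF this] rat_vector.subspace_diff[OF this]
  have "x \<in> {x. \<forall>t\<in>Poly_Mapping.keys x. leaves t = 3}"
    using generator unfolding dend_relations_def
    by (simp only: split: if_splits)
      ((elim insertE emptyE; hypsubst), (intro mem; simp)+, simp)
  moreover have "lin_ext tree_eval x = 0"
    using generator unfolding dend_relations_def
    by (auto split: if_splits simp: qlinear_diff[OF qlinear_lin_ext] fun_eq_iff[of _ "0 :: _ \<Rightarrow> word_fun"]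
        qlinear_add[OF qlinear_lin_ext] zinbiel_identity qlinear_add[OF qlinear_half_shuffle_right] add.commute)
  ultimately show ?case using generator by (auto simp: dend_relations_def Free_dend_simps split: if_splits)
next
  case (zero n)
  then show ?case by (simp add: Free_dend_simps lin_ext_def)
next
  case (add n x y)
  then show ?case
    using rat_vector.subspace_add[OF subspace_Free_dend] by (simp add: lin_ext_add)
next
  case (scale n x c)
  then show ?case
    using rat_vector.subspace_scale[OF subspace_Free_dend] by (simp add: lin_ext_scale)
next
  case (pcomp_left m x n g i)
  then show ?case
    using free_comp_arity[of x m g n i] by (auto simp: Free_dend_simps(2) lin_ext_tree_eval_graft)
next
  case (pcomp_right n x m f i)
  then have x: "1 \<le> n" "x \<in> arity_space Free_dend n" "lin_ext tree_eval x b = 0" for b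
    by (simp_all add: zero_fun_def)
  have "lin_ext tree_eval (bilin_ext (graft i) f x) a = 0" for a
    unfolding lin_ext_tree_eval_graft[OF pcomp_right(3) x(2) pcomp_right(4,5)] x(3)
    by (rule tree_eval_slot_0) (use pcomp_right in auto)
  then have "lin_ext tree_eval (bilin_ext (graft i) f x) = 0" by (simp add: fun_eq_iff)
  with x show ?case
    using free_comp_arity[OF pcomp_right(3) x(2)] pcomp_right(2) by (auto simp: Free_dend_simps(2))
qed

lemma dend_ideal_tree_eval: "x \<in> dend_ideal \<Longrightarrow> lin_ext tree_eval x = 0"
  unfolding dend_ideal_def
proof (induction rule: rat_vector.span_induct_alt)
  case base
  show ?case by (simp add: lin_ext_def)
next
  case (step c x y)
  then show ?case by (auto simp: lin_ext_add lin_ext_scale dest: ns_ideal_tree_eval)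
qed

lift_definition dend_eval :: "dend \<Rightarrow> (nat \<Rightarrow> word_fun) \<Rightarrow> word_fun" is "lin_ext tree_eval"
proof -
  fix x y :: "tree \<Rightarrow>\<^sub>0 rat"
  assume "x - y \<in> dend_ideal"
  then have "lin_ext tree_eval (x - y) = 0" by (rule dend_ideal_tree_eval)
  then show "lin_ext tree_eval x = lin_ext tree_eval y"
    by (simp add: qlinear_diff[OF qlinear_lin_ext])
qed

lemma qlinear_dend_eval: "qlinear dend_eval"
  by (rule qlinearI; transfer) (rule lin_ext_add lin_ext_scale)+

lemma qlinear_abs_dend: "qlinear abs_dend"
  by (rule qlinearI) (simp_all add: plus_dend.abs_eq scaleQ_dend.abs_eq)

text \<open>An index beyond the last leaf acts as the index of the last leaf.\<close>

lemma graft_clip: "1 \<le> i \<Longrightarrow> graft (min i (leaves t)) t s = graft i t s"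
proof (induction t arbitrary: i)
  case (Prec l r)
  have "1 \<le> leaves r" by (rule leaves_pos)
  moreover have "min i (leaves l + leaves r) - leaves l = min (i - leaves l) (leaves r)" by simp
  ultimately show ?case using Prec by auto
next
  case (Succ l r)
  have "1 \<le> leaves r" by (rule leaves_pos)
  moreover have "min i (leaves l + leaves r) - leaves l = min (i - leaves l) (leaves r)" by simp
  ultimately show ?case using Succ by auto
qed simp

text \<open>An element of the ideal is a sum of components of several arities, and \<open>i\<close> may be too large for
  some of them; for these it can be replaced by a valid index.\<close>

lemma dend_ideal_graft_left:
  assumes "x \<in> dend_ideal" "y \<in> arity_space Free_dend n" "1 \<le> n" "1 \<le> i"
  shows "bilin_ext (graft i) x y \<in> dend_ideal"
  using assms(1) unfolding dend_ideal_def
proof (induction rule: rat_vector.span_induct_alt)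
  case base
  show ?case by (simp add: bilin_ext_def rat_vector.span_zero)
next
  case (step c x z)
  then obtain m where m: "ns_ideal Free_dend dend_relations m x" by auto
  note mx = ns_ideal_tree_eval[OF m]
  have "bilin_ext (graft i) x y = bilin_ext (graft (min i m)) x y"
    unfolding bilin_ext_def
    by (intro sum.cong refl) (use mx graft_clip[OF assms(4)] in \<open>auto simp: Free_dend_simps\<close>)
  also have "\<dots> = pcomp Free_dend m n (min i m) x y" by (simp add: Free_dend_simps)
  also have "ns_ideal Free_dend dend_relations (m + n - 1) \<dots>"
    using m mx assms by (intro ns_ideal.pcomp_left) auto
  finally have "bilin_ext (graft i) x y
      \<in> rat_vector.span (\<Union>n. {x. ns_ideal Free_dend dend_relations n x})"
    by (intro rat_vector.span_base) auto
  then show ?case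
    using step.IH by (simp add: bilin_ext_add_left bilin_ext_scale_left rat_vector.span_add rat_vector.span_scale)
qed

lemma dend_ideal_graft_right:
  assumes "y \<in> dend_ideal" "x \<in> arity_space Free_dend m" "1 \<le> m" "1 \<le> i" "i \<le> m"
  shows "bilin_ext (graft i) x y \<in> dend_ideal"
  using assms(1) unfolding dend_ideal_def
proof (induction rule: rat_vector.span_induct_alt)
  case base
  show ?case by (simp add: bilin_ext_def rat_vector.span_zero)
next
  case (step c y z)
  then obtain n where n: "ns_ideal Free_dend dend_relations n y" by auto
  then have "ns_ideal Free_dend dend_relations (m + n - 1) (pcomp Free_dend m n i x y)"
    using assms by (intro ns_ideal.pcomp_right) auto
  then have "bilin_ext (graft i) x y
      \<in> rat_vector.span (\<Union>n. {x. ns_ideal Free_dend dend_relations n x})"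
    by (intro rat_vector.span_base) (auto simp: Free_dend_simps)
  then show ?case
    using step.IH by (simp add: bilin_ext_add_right bilin_ext_scale_right rat_vector.span_add rat_vector.span_scale)
qed

lemma arity_space_Dend_ns: "arity_space Dend_ns n = abs_dend ` arity_space Free_dend n"
  by (simp add: Dend_ns_def ns_quotient_def)

text \<open>The quotient operad computes with chosen representatives; by the ideal property any others of the
  right arity give the same result.\<close>

lemma pcomp_Dend_ns:
  assumes x: "x \<in> arity_space Free_dend m" and y: "y \<in> arity_space Free_dend n"
    and "1 \<le> n" "1 \<le> i" "i \<le> m"
  shows "pcomp Dend_ns m n i (abs_dend x) (abs_dend y) = abs_dend (bilin_ext (graft i) x y)"
proof -
  define x' where "x' = inv_into (arity_space Free_dend m) abs_dend (abs_dend x)"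
  define y' where "y' = inv_into (arity_space Free_dend n) abs_dend (abs_dend y)"
  have x': "x' \<in> arity_space Free_dend m" "abs_dend x' = abs_dend x"
    unfolding x'_def using x by (auto intro: inv_into_into f_inv_into_f)
  have y': "y' \<in> arity_space Free_dend n" "abs_dend y' = abs_dend y"
    unfolding y'_def using y by (auto intro: inv_into_into f_inv_into_f)
  have d: "x' - x \<in> dend_ideal" "y' - y \<in> dend_ideal"
    using x'(2) y'(2) by (simp_all add: dend.abs_eq_iff)
  have "bilin_ext (graft i) (x' - x) y' + bilin_ext (graft i) x (y' - y) \<in> dend_ideal"
    using dend_ideal_graft_left[OF d(1) y'(1)] dend_ideal_graft_right[OF d(2) x] assms
    unfolding dend_ideal_def by (intro rat_vector.span_add) auto
  then have "bilin_ext (graft i) x' y' - bilin_ext (graft i) x y \<in> dend_ideal"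
    by (simp add: qlinear_diff[OF qlinear_bilin_ext_left]
        qlinear_diff[OF qlinear_bilin_ext_right])
  then show ?thesis
    by (simp add: Dend_ns_def ns_quotient_def Free_dend_simps(2) dend.abs_eq_iff
        flip: x'_def y'_def)
qed

lemma dend_eval_pcomp:
  assumes "f \<in> arity_space Dend_ns m" "g \<in> arity_space Dend_ns n" "1 \<le> n" "1 \<le> i" "i \<le> m"
  shows "dend_eval (pcomp Dend_ns m n i f g) a
    = dend_eval f (plug i n (dend_eval g (\<lambda>k. a (k + i - 1))) a)"
  using assms
  by (auto simp: arity_space_Dend_ns pcomp_Dend_ns dend_eval.abs_eq lin_ext_tree_eval_graft)

lemma dend_eval_cong:
  assumes "d \<in> arity_space Dend_ns n" "\<And>i. 1 \<le> i \<Longrightarrow> i \<le> n \<Longrightarrow> a i = b i"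
  shows "dend_eval d a = dend_eval d b"
proof -
  obtain x where x: "x \<in> arity_space Free_dend n" "d = abs_dend x"
    using assms(1) by (auto simp: arity_space_Dend_ns)
  have "tree_eval t a = tree_eval t b" if "t \<in> Poly_Mapping.keys x" for t
    using that x assms(2) by (intro tree_eval_cong) (auto simp: Free_dend_simps)
  then show ?thesis
    by (auto simp: x dend_eval.abs_eq lin_ext_apply intro: lin_ext_cong)
qed

lemma qlinear_dend_eval_slot:
  assumes "d \<in> arity_space Dend_ns n" "1 \<le> i" "i \<le> n"
  shows "qlinear (\<lambda>b. dend_eval d (a(i := b)))"
proof -
  obtain x where x: "x \<in> arity_space Free_dend n" "d = abs_dend x"
    using assms(1) by (auto simp: arity_space_Dend_ns)
  have t: "qlinear (\<lambda>b. tree_eval t (a(i := b)))" if "t \<in> Poly_Mapping.keys x" for t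
    using that x assms by (intro qlinear_tree_eval_slot) (auto simp: Free_dend_simps)
  have "dend_eval d b = (\<Sum>t\<in>Poly_Mapping.keys x. Poly_Mapping.lookup x t *\<^sub>Q tree_eval t b)" for b
    by (rule ext) (simp add: x dend_eval.abs_eq lin_ext_apply, simp add: lin_ext_def)
  then show ?thesis
    by (simp only:) (intro qlinear_compose_sum qlinear_compose_scale_right ballI t)
qed

definition dend_of :: "tree \<Rightarrow> dend" where
  "dend_of t = abs_dend (basis_vec t)"

lemma dend_eval_dend_of [simp]: "dend_eval (dend_of t) = tree_eval t"
  by (simp add: dend_of_def dend_eval.abs_eq)

lemma dend_of_arity: "leaves t = n \<Longrightarrow> dend_of t \<in> arity_space Dend_ns n"
  by (auto simp: dend_of_def arity_space_Dend_ns Free_dend_simps)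

lemma pcomp_dend_of:
  assumes "leaves t = m" "leaves s = n" "1 \<le> i" "i \<le> m"
  shows "pcomp Dend_ns m n i (dend_of t) (dend_of s) = dend_of (graft i t s)"
  unfolding dend_of_def
  by (subst pcomp_Dend_ns) (use assms leaves_pos in \<open>auto simp: Free_dend_simps\<close>)

lemma dend_prec_eq: "dend_prec = dend_of (Prec Leaf Leaf)"
  and dend_succ_eq: "dend_succ = dend_of (Succ Leaf Leaf)"
  by (simp_all add: dend_of_def dend_prec_def dend_succ_def)

lemma op_unit_Dend_ns: "op_unit Dend_ns = dend_of Leaf"
  by (simp add: Dend_ns_def ns_quotient_def Free_dend_simps dend_of_def)

lemma arity_space_Dend_ns_span:
  "arity_space Dend_ns n = rat_vector.span (dend_of ` {t. leaves t = n})"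
proof
  have "abs_dend x = lin_ext dend_of x" for x
    unfolding dend_of_def by (rule qlinear_eq_lin_ext[OF qlinear_abs_dend])
  then show "arity_space Dend_ns n \<subseteq> rat_vector.span (dend_of ` {t. leaves t = n})"
    by (auto simp: arity_space_Dend_ns Free_dend_simps rat_vector.span_base
        intro!: lin_ext_in_subspace)
  have "rat_vector.subspace (arity_space Dend_ns n)"
    unfolding arity_space_Dend_ns Free_dend_simps
    by (rule qlinear_subspace_image[OF qlinear_abs_dend subspace_keys])
  then show "rat_vector.span (dend_of ` {t. leaves t = n}) \<subseteq> arity_space Dend_ns n"
    by (intro rat_vector.span_minimal) (auto simp: dend_of_arity)
qed

section \<open>The invariant form and the long cycle\<close>

text \<open>The sum of the two half-shuffles is a shuffle of functions that vanish on the empty word, and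
  \<open>word_sum_shuffle\<close> annihilates it.\<close>

lemma word_sum_half_shuffle_antisym: "word_sum s (f \<lhd> g) = - word_sum s (g \<lhd> f)"
proof -
  have "word_sum s (f \<lhd> g) + word_sum s (g \<lhd> f) = word_sum s (\<lambda>w. (f \<lhd> g) w + (g \<lhd> f) w)"
    by (simp add: word_sum_add)
  also have "\<dots> = word_sum s (\<lambda>w. unshuffle w (\<lambda>u v. reduced f u * reduced g v))"
  proof (rule word_sum_cong)
    fix w assume "mset w = mset (letters s)"
    then have "w \<noteq> []" using letters_nonempty[of s] by auto
    then show "(f \<lhd> g) w + (g \<lhd> f) w = unshuffle w (\<lambda>u v. reduced f u * reduced g v)"
      by (rule half_shuffle_symmetrized)
  qed
  also have "\<dots> = 0" by (simp add: word_sum_shuffle) (simp add: reduced_def)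
  finally show ?thesis by (simp add: add_eq_0_iff)
qed

text \<open>With \<open>\<langle>f, g\<rangle> = word_sum s (g \<lhd> f)\<close> this reads \<open>\<langle>f \<prec> g, h\<rangle> = \<langle>f, g \<prec> h + h \<prec> g\<rangle>\<close>; it is the
  Zinbiel identity for \<open>f\<close>, \<open>g\<close>, \<open>h\<close>, with antisymmetry applied on both sides.\<close>

lemma form_prec: "word_sum s (h \<lhd> (f \<lhd> g)) = word_sum s ((g \<lhd> h + h \<lhd> g) \<lhd> f)"
  unfolding word_sum_half_shuffle_antisym[of s h] zinbiel_identity
  by (simp flip: word_sum_half_shuffle_antisym)

text \<open>In the same notation, \<open>\<langle>g \<prec> f, h\<rangle> = - \<langle>f, g \<prec> h\<rangle>\<close>: by the Zinbiel identity \<open>(g \<prec> f) \<prec> h\<close> is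
  symmetric in \<open>f\<close> and \<open>h\<close>.\<close>

lemma form_succ: "word_sum s (h \<lhd> (g \<lhd> f)) = - word_sum s ((g \<lhd> h) \<lhd> f)"
  unfolding word_sum_half_shuffle_antisym[of s h] zinbiel_identity by (simp add: add.commute)

text \<open>The number \<open>\<langle>d(p\<^sub>1, \<dots>, p\<^sub>n), p\<^bsub>n+1\<^esub>\<rangle>\<close>, in which the output of \<open>d\<close> is treated as a further input.\<close>

definition cyclic_form :: "bracketing \<Rightarrow> nat \<Rightarrow> dend \<Rightarrow> (nat \<Rightarrow> word_fun) \<Rightarrow> rat" where
  "cyclic_form s n d p = word_sum s (p (n + 1) \<lhd> dend_eval d p)"

lemma qlinear_cyclic_form: "qlinear (\<lambda>d. cyclic_form s n d p)"
  unfolding cyclic_form_def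
  by (rule qlinear_compose[OF qlinear_word_sum], rule qlinear_compose[OF qlinear_half_shuffle_right],
      rule qlinear_compose[OF qlinear_apply qlinear_dend_eval])

locale dend_anticyclic = ns_anticyclic_operad Dend_ns \<tau> for \<tau> +
  assumes tau_succ: "\<tau> 2 dend_succ = dend_prec"
    and tau_prec: "\<tau> 2 dend_prec = - dend_prec - dend_succ"
begin

lemma tau_pcomp:
  assumes "1 \<le> m" "1 \<le> n" "f \<in> arity_space Dend_ns m" "g \<in> arity_space Dend_ns n"
  shows "2 \<le> i \<Longrightarrow> i \<le> m
      \<Longrightarrow> \<tau> (m + n - 1) (pcomp Dend_ns m n i f g) = pcomp Dend_ns m n (i - 1) (\<tau> m f) g"
    and "\<tau> (m + n - 1) (pcomp Dend_ns m n 1 f g) = - pcomp Dend_ns n m n (\<tau> n g) (\<tau> m f)"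
  using tau_identities assms unfolding anticyclic_identities_def by blast+

lemma tau_mem: "1 \<le> n \<Longrightarrow> d \<in> arity_space Dend_ns n \<Longrightarrow> \<tau> n d \<in> arity_space Dend_ns n"
  using tau_linear[of n] by (auto simp: linear_between_def)

lemma generators_arity: "dend_prec \<in> arity_space Dend_ns 2" "dend_succ \<in> arity_space Dend_ns 2"
  by (auto simp: dend_prec_eq dend_succ_eq intro!: dend_of_arity)

text \<open>A node with operation \<open>e\<close> and subtrees \<open>l\<close>, \<open>r\<close> is \<open>(e \<circ>\<^sub>2 r) \<circ>\<^sub>1 l\<close>. The anticyclic identities turn
  it into \<open>- \<tau>(l) \<circ>\<^sub>m (\<tau>(e) \<circ>\<^sub>1 r)\<close>, so \<open>\<tau>\<close> is known on trees by recursion along the left branch.\<close>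

lemma tau_node:
  assumes e: "e \<in> arity_space Dend_ns 2" and k: "leaves r = k" and m: "leaves l = m"
  shows "\<tau> (m + k) (pcomp Dend_ns (k + 1) m 1 (pcomp Dend_ns 2 k 2 e (dend_of r)) (dend_of l))
    = - pcomp Dend_ns m (k + 1) m (\<tau> m (dend_of l)) (pcomp Dend_ns 2 k 1 (\<tau> 2 e) (dend_of r))"
    (is "?A = ?B")
    and "pcomp Dend_ns 2 k 1 (\<tau> 2 e) (dend_of r) \<in> arity_space Dend_ns (k + 1)"
proof -
  have pos: "1 \<le> k" "1 \<le> m" using k m leaves_pos by auto
  have r: "dend_of r \<in> arity_space Dend_ns k" and l: "dend_of l \<in> arity_space Dend_ns m"
    using k m by (auto intro: dend_of_arity)
  have mem: "pcomp Dend_ns 2 k j e' (dend_of r) \<in> arity_space Dend_ns (k + 1)"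
    if "e' \<in> arity_space Dend_ns 2" "1 \<le> j" "j \<le> 2" for e' j
    using pcomp_linear_left[of 2 k j "dend_of r"] r that pos by (auto simp: linear_between_def)
  show "pcomp Dend_ns 2 k 1 (\<tau> 2 e) (dend_of r) \<in> arity_space Dend_ns (k + 1)"
    by (rule mem) (simp_all add: tau_mem e)
  have 1: "\<tau> (2 + k - 1) (pcomp Dend_ns 2 k 2 e (dend_of r)) = pcomp Dend_ns 2 k (2 - 1) (\<tau> 2 e) (dend_of r)"
    by (rule tau_pcomp) (use e r pos in auto)
  have "\<tau> ((k + 1) + m - 1) (pcomp Dend_ns (k + 1) m 1 (pcomp Dend_ns 2 k 2 e (dend_of r)) (dend_of l))
      = - pcomp Dend_ns m (k + 1) m (\<tau> m (dend_of l)) (\<tau> (k + 1) (pcomp Dend_ns 2 k 2 e (dend_of r)))"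
    by (rule tau_pcomp) (use mem[OF e, of 2] l pos in auto)
  with 1 show "?A = ?B" by (simp add: add.commute)
qed

text \<open>The recursion for \<open>\<tau>\<close>, evaluated: the value of \<open>l\<close> at the rotated inputs is paired with the value of
  \<open>\<tau>(e)\<close> at the value of \<open>r\<close> and the input \<open>p (m + k)\<close>, which the rotation makes the last one.\<close>

lemma cyclic_form_node:
  assumes e: "e \<in> arity_space Dend_ns 2" and k: "leaves r = k" and m: "leaves l = m"
    and IH: "\<And>p. cyclic_form s m (\<tau> m (dend_of l)) p = cyclic_form s m (dend_of l) (p \<circ> long_cycle m)"
  shows "cyclic_form s (m + k)
      (\<tau> (m + k) (pcomp Dend_ns (k + 1) m 1 (pcomp Dend_ns 2 k 2 e (dend_of r)) (dend_of l))) p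
    = - word_sum s (dend_eval (\<tau> 2 e)
          (\<lambda>i. if i = 1 then tree_eval r (\<lambda>j. p (j + m - 1)) else p (m + k))
        \<lhd> tree_eval l (p \<circ> long_cycle (m + k)))"
proof -
  have pos: "1 \<le> k" "1 \<le> m" using k m leaves_pos by auto
  define X where "X = dend_eval (pcomp Dend_ns 2 k 1 (\<tau> 2 e) (dend_of r)) (\<lambda>j. p (j + m - 1))"
  have r: "dend_of r \<in> arity_space Dend_ns k" and l: "dend_of l \<in> arity_space Dend_ns m"
    using k m by (auto intro: dend_of_arity)
  have "X = dend_eval (\<tau> 2 e) (plug 1 k (tree_eval r (\<lambda>j. p (j + m - 1))) (\<lambda>j. p (j + m - 1)))"
    unfolding X_def using r pos e by (subst dend_eval_pcomp) (auto simp: tau_mem)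
  also have "\<dots> = dend_eval (\<tau> 2 e)
      (\<lambda>i. if i = 1 then tree_eval r (\<lambda>j. p (j + m - 1)) else p (m + k))"
    using pos e by (intro dend_eval_cong[OF tau_mem]) (auto simp: plug_def add.commute le_Suc_eq numeral_2_eq_2)
  finally have X: "X = dend_eval (\<tau> 2 e)
      (\<lambda>i. if i = 1 then tree_eval r (\<lambda>j. p (j + m - 1)) else p (m + k))" .
  \<comment> \<open>The inputs of \<open>\<tau>(l)\<close>: its last one is \<open>X\<close>, and the next entry of \<open>?q\<close> is \<open>p (m + k + 1)\<close>.\<close>
  let ?q = "plug m (k + 1) X p"
  have "cyclic_form s (m + k)
      (\<tau> (m + k) (pcomp Dend_ns (k + 1) m 1 (pcomp Dend_ns 2 k 2 e (dend_of r)) (dend_of l))) p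
    = - cyclic_form s (m + k) (pcomp Dend_ns m (k + 1) m (\<tau> m (dend_of l))
         (pcomp Dend_ns 2 k 1 (\<tau> 2 e) (dend_of r))) p"
    unfolding tau_node(1)[OF e k m] by (rule qlinear_neg[OF qlinear_cyclic_form])
  also have "cyclic_form s (m + k) (pcomp Dend_ns m (k + 1) m (\<tau> m (dend_of l))
         (pcomp Dend_ns 2 k 1 (\<tau> 2 e) (dend_of r))) p = cyclic_form s m (\<tau> m (dend_of l)) ?q"
    unfolding cyclic_form_def X_def
    using pos tau_node(2)[OF e k m] l by (subst dend_eval_pcomp) (auto simp: tau_mem plug_def add_ac)
  also have "\<dots> = word_sum s (X \<lhd> tree_eval l (?q \<circ> long_cycle m))"
    unfolding IH using pos by (simp add: cyclic_form_def long_cycle_def plug_def)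
  also have "tree_eval l (?q \<circ> long_cycle m) = tree_eval l (p \<circ> long_cycle (m + k))"
    by (rule tree_eval_cong) (use pos m in \<open>auto simp: long_cycle_def plug_def add_ac\<close>)
  finally show ?thesis unfolding X .
qed

text \<open>By induction along the left branch: the values of \<open>\<tau>\<close> at the two generators turn the recursion into
  the two invariance rules \<open>form_prec\<close> and \<open>form_succ\<close>, and at a leaf \<open>\<tau> = - 1\<close> is antisymmetry.\<close>

lemma cyclic_form_tau_tree:
  assumes "leaves t = n"
  shows "cyclic_form s n (\<tau> n (dend_of t)) p = cyclic_form s n (dend_of t) (p \<circ> long_cycle n)"
  using assms
proof (induction t arbitrary: n p)
  case Leaf
  have "\<tau> 1 (dend_of Leaf) = - dend_of Leaf"
    using tau_identities by (simp add: anticyclic_identities_def op_unit_Dend_ns)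
  then have "cyclic_form s 1 (\<tau> 1 (dend_of Leaf)) p = - cyclic_form s 1 (dend_of Leaf) p"
    by (simp add: qlinear_neg[OF qlinear_cyclic_form])
  also have "\<dots> = cyclic_form s 1 (dend_of Leaf) (p \<circ> long_cycle 1)"
    by (simp add: cyclic_form_def long_cycle_def numeral_2_eq_2
        word_sum_half_shuffle_antisym[of s "p (Suc (Suc 0))"])
  finally show ?case using Leaf by (simp add: comp_def)
next
  case (Prec l r)
  define m k where "m = leaves l" and "k = leaves r"
  have pos: "1 \<le> k" "1 \<le> m" unfolding k_def m_def by (rule leaves_pos)+
  have n: "n = m + k" using Prec.prems by (simp add: m_def k_def)
  let ?R = "tree_eval r (\<lambda>j. p (j + m - 1))" and ?L = "tree_eval l (p \<circ> long_cycle (m + k))"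
  have "dend_of (Prec l r) = pcomp Dend_ns (k + 1) m 1 (pcomp Dend_ns 2 k 2 dend_prec (dend_of r)) (dend_of l)"
    by (simp add: dend_prec_eq pcomp_dend_of m_def k_def)
  then have "cyclic_form s n (\<tau> n (dend_of (Prec l r))) p = - word_sum s (dend_eval (- dend_prec - dend_succ)
          (\<lambda>i. if i = 1 then ?R else p (m + k)) \<lhd> ?L)"
    unfolding n
    using cyclic_form_node[OF generators_arity(1) k_def[symmetric] m_def[symmetric] Prec.IH(1)[OF m_def[symmetric]]]
    by (simp add: tau_prec)
  also have "\<dots> = word_sum s ((?R \<lhd> p (m + k) + p (m + k) \<lhd> ?R) \<lhd> ?L)"
    by (simp add: qlinear_diff[OF qlinear_dend_eval] qlinear_neg[OF qlinear_dend_eval]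
        dend_prec_eq dend_succ_eq qlinear_diff[OF qlinear_half_shuffle_left]
        qlinear_neg[OF qlinear_half_shuffle_left] qlinear_add[OF qlinear_half_shuffle_left]
        qlinear_diff[OF qlinear_word_sum] qlinear_add[OF qlinear_word_sum]
        qlinear_neg[OF qlinear_word_sum])
  also have "\<dots> = word_sum s (p (m + k) \<lhd> (?L \<lhd> ?R))" by (rule form_prec[symmetric])
  also have "?R = tree_eval r (\<lambda>j. (p \<circ> long_cycle (m + k)) (j + m))"
    by (rule tree_eval_cong) (use pos k_def in \<open>auto simp: long_cycle_def\<close>)
  finally show ?case using pos by (simp add: n cyclic_form_def m_def long_cycle_def)
next
  case (Succ l r)
  define m k where "m = leaves l" and "k = leaves r"
  have pos: "1 \<le> k" "1 \<le> m" unfolding k_def m_def by (rule leaves_pos)+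
  have n: "n = m + k" using Succ.prems by (simp add: m_def k_def)
  let ?R = "tree_eval r (\<lambda>j. p (j + m - 1))" and ?L = "tree_eval l (p \<circ> long_cycle (m + k))"
  have "dend_of (Succ l r) = pcomp Dend_ns (k + 1) m 1 (pcomp Dend_ns 2 k 2 dend_succ (dend_of r)) (dend_of l)"
    by (simp add: dend_succ_eq pcomp_dend_of m_def k_def)
  then have "cyclic_form s n (\<tau> n (dend_of (Succ l r))) p = - word_sum s (dend_eval dend_prec
          (\<lambda>i. if i = 1 then ?R else p (m + k)) \<lhd> ?L)"
    unfolding n
    using cyclic_form_node[OF generators_arity(2) k_def[symmetric] m_def[symmetric] Succ.IH(1)[OF m_def[symmetric]]]
    by (simp add: tau_succ)
  also have "\<dots> = - word_sum s ((?R \<lhd> p (m + k)) \<lhd> ?L)" by (simp add: dend_prec_eq)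
  also have "\<dots> = word_sum s (p (m + k) \<lhd> (?R \<lhd> ?L))" by (rule form_succ[symmetric])
  also have "?R = tree_eval r (\<lambda>j. (p \<circ> long_cycle (m + k)) (j + m))"
    by (rule tree_eval_cong) (use pos k_def in \<open>auto simp: long_cycle_def\<close>)
  finally show ?case using pos by (simp add: n cyclic_form_def m_def long_cycle_def)
qed

lemma cyclic_form_tau:
  assumes "1 \<le> n" "d \<in> arity_space Dend_ns n"
  shows "cyclic_form s n (\<tau> n d) p = cyclic_form s n d (p \<circ> long_cycle n)"
proof -
  have sub: "rat_vector.subspace (arity_space Dend_ns n)" by (rule subspace[OF assms(1)])
  have lin: "\<tau> n (x + y) = \<tau> n x + \<tau> n y" "\<tau> n (c *\<^sub>Q x) = c *\<^sub>Q \<tau> n x"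
    if "x \<in> arity_space Dend_ns n" "y \<in> arity_space Dend_ns n" for x y c
    using that tau_linear[OF assms(1)] unfolding linear_between_def by auto
  have "\<tau> n 0 = 0"
    using lin(2)[of 0 0 0] rat_vector.subspace_0[OF sub] by simp
  have "rat_vector.subspace {d \<in> arity_space Dend_ns n.
      cyclic_form s n (\<tau> n d) p = cyclic_form s n d (p \<circ> long_cycle n)}"
    unfolding rat_vector.subspace_def
    using rat_vector.subspace_0[OF sub] rat_vector.subspace_add[OF sub] rat_vector.subspace_scale[OF sub]
    by (auto simp: lin \<open>\<tau> n 0 = 0\<close> qlinear_0[OF qlinear_cyclic_form]
        qlinear_add[OF qlinear_cyclic_form] qlinear_scale[OF qlinear_cyclic_form])
  then have "rat_vector.span (dend_of ` {t. leaves t = n}) \<subseteq> {d \<in> arity_space Dend_ns n.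
      cyclic_form s n (\<tau> n d) p = cyclic_form s n d (p \<circ> long_cycle n)}"
    by (intro rat_vector.span_minimal) (auto simp: dend_of_arity cyclic_form_tau_tree)
  then show ?thesis using assms(2) by (auto simp flip: arity_space_Dend_ns_span)
qed

end

section \<open>Symmetrized dendriform operations\<close>

lemma Dend_simps:
  "arity_space Dend n = {F. Poly_Mapping.keys F \<subseteq> {\<pi>. \<pi> permutes {1..n}}
        \<and> (\<forall>\<pi>. Poly_Mapping.lookup F \<pi> \<in> arity_space Dend_ns n)}"
  "op_unit Dend = Poly_Mapping.single id (op_unit Dend_ns)"
  "pcomp Dend m n i F G = (\<Sum>\<sigma>\<in>Poly_Mapping.keys F. \<Sum>\<rho>\<in>Poly_Mapping.keys G.
        Poly_Mapping.single (block_perm n (inv \<sigma> i) \<sigma> \<rho>)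
          (pcomp Dend_ns m n (inv \<sigma> i) (Poly_Mapping.lookup F \<sigma>) (Poly_Mapping.lookup G \<rho>)))"
  "op_act Dend n \<sigma> F = (\<Sum>\<pi>\<in>Poly_Mapping.keys F.
        Poly_Mapping.single (\<sigma> \<circ> \<pi>) (Poly_Mapping.lookup F \<pi>))"
  by (simp_all add: Dend_def symmetrization_def)

lemma op_act_Dend_single:
  "op_act Dend n \<sigma> (Poly_Mapping.single \<pi> E) = Poly_Mapping.single (\<sigma> \<circ> \<pi>) E"
  by (simp add: Dend_simps)

lemma qlinear_single: "qlinear (Poly_Mapping.single k)"
  by (rule qlinearI) (simp_all add: single_add scaleQ_single)

text \<open>The element \<open>E \<otimes> \<pi>\<close> maps \<open>p\<close> to \<open>E(p\<^bsub>\<pi>(1)\<^esub>, \<dots>, p\<^bsub>\<pi>(n)\<^esub>)\<close>.\<close>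

definition sym_eval :: "((nat \<Rightarrow> nat) \<Rightarrow>\<^sub>0 dend) \<Rightarrow> (nat \<Rightarrow> word_fun) \<Rightarrow> word_fun" where
  "sym_eval F p = (\<Sum>\<pi>\<in>Poly_Mapping.keys F. dend_eval (Poly_Mapping.lookup F \<pi>) (p \<circ> \<pi>))"

lemma sym_eval_superset:
  assumes "finite A" "Poly_Mapping.keys F \<subseteq> A"
  shows "sym_eval F p = (\<Sum>\<pi>\<in>A. dend_eval (Poly_Mapping.lookup F \<pi>) (p \<circ> \<pi>))"
  unfolding sym_eval_def
  by (rule sum.mono_neutral_left)
    (use assms in \<open>auto simp: in_keys_iff qlinear_0[OF qlinear_dend_eval]\<close>)

lemma qlinear_sym_eval: "qlinear (\<lambda>F. sym_eval F p)"
proof (rule qlinearI)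
  fix x y :: "(nat \<Rightarrow> nat) \<Rightarrow>\<^sub>0 dend" and c
  let ?A = "Poly_Mapping.keys x \<union> Poly_Mapping.keys y"
  have "Poly_Mapping.keys (x + y) \<subseteq> ?A" by (rule keys_add)
  then show "sym_eval (x + y) p = sym_eval x p + sym_eval y p"
    by (simp add: sym_eval_superset[of ?A] lookup_add qlinear_add[OF qlinear_dend_eval] sum.distrib)
  have "Poly_Mapping.keys (c *\<^sub>Q x) \<subseteq> Poly_Mapping.keys x"
    by (auto simp: in_keys_iff lookup_scaleQ)
  then show "sym_eval (c *\<^sub>Q x) p = c *\<^sub>Q sym_eval x p"
    by (simp add: sym_eval_superset[of "Poly_Mapping.keys x"] lookup_scaleQ
        qlinear_scale[OF qlinear_dend_eval] rat_vector.scale_sum_right)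
qed

lemma sym_eval_single [simp]: "sym_eval (Poly_Mapping.single \<pi> E) p = dend_eval E (p \<circ> \<pi>)"
  by (subst sym_eval_superset[of "{\<pi>}"]) auto

lemma sym_eval_act: "sym_eval (op_act Dend n \<sigma> F) p = sym_eval F (p \<circ> \<sigma>)"
  by (simp add: Dend_simps qlinear_sum[OF qlinear_sym_eval] comp_assoc)
    (simp add: sym_eval_def comp_assoc)

lemma sym_eval_pcomp:
  assumes F: "F \<in> arity_space Dend m" and G: "G \<in> arity_space Dend n"
    and i: "1 \<le> i" "i \<le> m" and n: "1 \<le> n"
  shows "sym_eval (pcomp Dend m n i F G) p = sym_eval F (plug i n (sym_eval G (\<lambda>k. p (k + i - 1))) p)"
proof -
  let ?b = "\<lambda>\<rho>. dend_eval (Poly_Mapping.lookup G \<rho>) ((\<lambda>k. p (k + i - 1)) \<circ> \<rho>)"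
  have main: "(\<Sum>\<rho>\<in>Poly_Mapping.keys G. dend_eval (pcomp Dend_ns m n (inv \<sigma> i) (Poly_Mapping.lookup F \<sigma>)
        (Poly_Mapping.lookup G \<rho>)) (p \<circ> block_perm n (inv \<sigma> i) \<sigma> \<rho>))
      = dend_eval (Poly_Mapping.lookup F \<sigma>) (plug i n (sym_eval G (\<lambda>k. p (k + i - 1))) p \<circ> \<sigma>)"
    if "\<sigma> \<in> Poly_Mapping.keys F" for \<sigma>
  proof -
    define j where "j = inv \<sigma> i"
    have \<sigma>: "\<sigma> permutes {1..m}" using that F by (auto simp: Dend_simps)
    have F\<sigma>: "Poly_Mapping.lookup F \<sigma> \<in> arity_space Dend_ns m" using F by (simp add: Dend_simps)
    have j: "\<sigma> j = i" "1 \<le> j" "j \<le> m"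
      using permutes_inverses(1)[OF \<sigma>, of i] permutes_in_image[OF permutes_inv[OF \<sigma>], of i] i
      by (auto simp: j_def)
    have inj: "\<sigma> q = i \<longleftrightarrow> q = j" for q
      using j(1) permutes_inj[OF \<sigma>] by (metis inj_eq)
    have slot: "dend_eval (pcomp Dend_ns m n j (Poly_Mapping.lookup F \<sigma>)
        (Poly_Mapping.lookup G \<rho>)) (p \<circ> block_perm n j \<sigma> \<rho>)
      = dend_eval (Poly_Mapping.lookup F \<sigma>) ((plug i n 0 p \<circ> \<sigma>)(j := ?b \<rho>))"
      if "\<rho> \<in> Poly_Mapping.keys G" for \<rho>
    proof -
      have \<rho>: "\<rho> permutes {1..n}" using that G by (auto simp: Dend_simps)
      have G\<rho>: "Poly_Mapping.lookup G \<rho> \<in> arity_space Dend_ns n" using G by (simp add: Dend_simps)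
      have "dend_eval (Poly_Mapping.lookup G \<rho>) (\<lambda>k. (p \<circ> block_perm n j \<sigma> \<rho>) (k + j - 1)) = ?b \<rho>"
        using j by (intro dend_eval_cong[OF G\<rho>]) (auto simp: block_perm_def Let_def add.commute)
      then have "dend_eval (pcomp Dend_ns m n j (Poly_Mapping.lookup F \<sigma>)
          (Poly_Mapping.lookup G \<rho>)) (p \<circ> block_perm n j \<sigma> \<rho>)
        = dend_eval (Poly_Mapping.lookup F \<sigma>) (plug j n (?b \<rho>) (p \<circ> block_perm n j \<sigma> \<rho>))"
        using F\<sigma> G\<rho> n j by (simp add: dend_eval_pcomp)
      also have "\<dots> = dend_eval (Poly_Mapping.lookup F \<sigma>) ((plug i n 0 p \<circ> \<sigma>)(j := ?b \<rho>))"
      proof (rule dend_eval_cong[OF F\<sigma>])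
        fix q
        consider "q < j" | "q = j" | "j < q" by linarith
        then show "plug j n (?b \<rho>) (p \<circ> block_perm n j \<sigma> \<rho>) q
            = ((plug i n 0 p \<circ> \<sigma>)(j := ?b \<rho>)) q"
        proof cases
          case 1
          then show ?thesis using inj[of q] by (simp add: plug_def block_perm_def j(1))
        next
          case 2
          then show ?thesis by (simp add: plug_def)
        next
          case 3
          then have "\<not> q + n - 1 < j" "\<not> q + n - 1 < j + n" "q + n - 1 + 1 - n = q" using n by auto
          then have "block_perm n j \<sigma> \<rho> (q + n - 1) = (if \<sigma> q < i then \<sigma> q else \<sigma> q + n - 1)"
            by (simp only: block_perm_def Let_def if_False j(1))
          then show ?thesis using 3 inj[of q] by (simp add: plug_def)
        qed
      qed
      finally show ?thesis .
    qed
    have "(\<Sum>\<rho>\<in>Poly_Mapping.keys G. dend_eval (pcomp Dend_ns m n j (Poly_Mapping.lookup F \<sigma>)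
        (Poly_Mapping.lookup G \<rho>)) (p \<circ> block_perm n j \<sigma> \<rho>))
      = (\<Sum>\<rho>\<in>Poly_Mapping.keys G. dend_eval (Poly_Mapping.lookup F \<sigma>) ((plug i n 0 p \<circ> \<sigma>)(j := ?b \<rho>)))"
      by (rule sum.cong) (auto simp: slot)
    also have "\<dots> = dend_eval (Poly_Mapping.lookup F \<sigma>)
        ((plug i n 0 p \<circ> \<sigma>)(j := sym_eval G (\<lambda>k. p (k + i - 1))))"
      unfolding sym_eval_def by (rule qlinear_sum[symmetric, OF qlinear_dend_eval_slot[OF F\<sigma> j(2,3)]])
    also have "\<dots> = dend_eval (Poly_Mapping.lookup F \<sigma>) (plug i n (sym_eval G (\<lambda>k. p (k + i - 1))) p \<circ> \<sigma>)"
      using inj by (intro arg_cong[where f = "dend_eval _"]) (auto simp: plug_def fun_eq_iff j(1))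
    finally show ?thesis unfolding j_def .
  qed
  have "sym_eval (pcomp Dend m n i F G) p = (\<Sum>\<sigma>\<in>Poly_Mapping.keys F. \<Sum>\<rho>\<in>Poly_Mapping.keys G.
      dend_eval (pcomp Dend_ns m n (inv \<sigma> i) (Poly_Mapping.lookup F \<sigma>)
        (Poly_Mapping.lookup G \<rho>)) (p \<circ> block_perm n (inv \<sigma> i) \<sigma> \<rho>))"
    by (simp add: Dend_simps qlinear_sum[OF qlinear_sym_eval])
  then show ?thesis by (simp add: main sym_eval_def[of F])
qed

lemma block_perm_id: "1 \<le> n \<Longrightarrow> block_perm n j id id = id"
  by (rule ext) (auto simp: block_perm_def Let_def)

lemma block_perm_permutes:
  assumes \<sigma>: "\<sigma> permutes {1..m}" and \<rho>: "\<rho> permutes {1..n}" and j: "1 \<le> j" "j \<le> m" and n: "1 \<le> n"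
  shows "block_perm n j \<sigma> \<rho> permutes {1..m + n - 1}"
proof -
  have \<sigma>1: "1 \<le> \<sigma> q \<and> \<sigma> q \<le> m \<longleftrightarrow> 1 \<le> q \<and> q \<le> m" for q using permutes_in_image[OF \<sigma>, of q] by auto
  have \<rho>1: "1 \<le> \<rho> q \<and> \<rho> q \<le> n \<longleftrightarrow> 1 \<le> q \<and> q \<le> n" for q using permutes_in_image[OF \<rho>, of q] by auto
  have \<sigma>i: "\<sigma> q = \<sigma> q' \<longleftrightarrow> q = q'" for q q' using permutes_inj[OF \<sigma>] by (auto dest: injD)
  have \<rho>i: "\<rho> q = \<rho> q' \<longleftrightarrow> q = q'" for q q' using permutes_inj[OF \<rho>] by (auto dest: injD)
  have sj: "1 \<le> \<sigma> j" "\<sigma> j \<le> m" using \<sigma>1 j by auto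
  let ?\<theta> = "block_perm n j \<sigma> \<rho>"
  have low: "?\<theta> p = (if \<sigma> p < \<sigma> j then \<sigma> p else \<sigma> p + n - 1)" if "p < j" for p
    using that by (simp add: block_perm_def)
  have mid: "?\<theta> (j + q - 1) = \<sigma> j + \<rho> q - 1" if "1 \<le> q" "q \<le> n" for q
  proof -
    have "\<not> j + q - 1 < j" "j + q - 1 < j + n" "j + q - 1 + 1 - j = q" using that j by auto
    then show ?thesis by (simp only: block_perm_def Let_def if_False if_True)
  qed
  have high: "?\<theta> (q + n - 1) = (if \<sigma> q < \<sigma> j then \<sigma> q else \<sigma> q + n - 1)" if "j < q" for q
  proof -
    have "\<not> q + n - 1 < j" "\<not> q + n - 1 < j + n" "q + n - 1 + 1 - n = q" using that n by auto
    then show ?thesis by (simp only: block_perm_def Let_def if_False)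
  qed
  have cases: "(\<exists>q. 1 \<le> q \<and> q \<le> m \<and> q \<noteq> j \<and> p = (if q < j then q else q + n - 1)
        \<and> ?\<theta> p = (if \<sigma> q < \<sigma> j then \<sigma> q else \<sigma> q + n - 1))
      \<or> (\<exists>q. 1 \<le> q \<and> q \<le> n \<and> p = j + q - 1 \<and> ?\<theta> p = \<sigma> j + \<rho> q - 1)"
    if "p \<in> {1..m + n - 1}" for p
  proof -
    consider "p < j" | "j \<le> p" "p < j + n" | "j + n \<le> p" by linarith
    then show ?thesis
    proof cases
      case 1 then show ?thesis using that j low[of p] by (intro disjI1 exI[of _ p]) auto
    next
      case 2 then show ?thesis using that j mid[of "p + 1 - j"] by (intro disjI2 exI[of _ "p + 1 - j"]) auto
    next
      case 3 then show ?thesis using that n high[of "p + 1 - n"] by (intro disjI1 exI[of _ "p + 1 - n"]) auto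
    qed
  qed
  have "inj_on ?\<theta> {1..m + n - 1}"
  proof (rule inj_onI)
    fix p p' assume p: "p \<in> {1..m + n - 1}" "p' \<in> {1..m + n - 1}" and eq: "?\<theta> p = ?\<theta> p'"
    have sh: "(if \<sigma> q < \<sigma> j then \<sigma> q else \<sigma> q + n - 1) = (if \<sigma> q' < \<sigma> j then \<sigma> q' else \<sigma> q' + n - 1)
        \<Longrightarrow> q = q'" if "q \<noteq> j" "q' \<noteq> j" for q q'
      using that \<sigma>i[of q j] \<sigma>i[of q' j] \<sigma>i[of q q'] n by (auto split: if_splits)
    have no: "(if \<sigma> q < \<sigma> j then \<sigma> q else \<sigma> q + n - 1) \<noteq> \<sigma> j + \<rho> q' - 1"
      if "q \<noteq> j" "1 \<le> q'" "q' \<le> n" for q q'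
      using that \<sigma>i[of q j] \<rho>1[of q'] by (auto split: if_splits)
    have mm: "\<sigma> j + \<rho> q - 1 = \<sigma> j + \<rho> q' - 1 \<Longrightarrow> q = q'"
      if "1 \<le> q" "q \<le> n" "1 \<le> q'" "q' \<le> n" for q q'
      using that \<rho>1[of q] \<rho>1[of q'] \<rho>i[of q q'] by auto
    show "p = p'"
      using cases[OF p(1)] cases[OF p(2)]
      apply (elim disjE exE conjE)
      subgoal for q q' using sh[of q q'] eq by auto
      subgoal for q q' using no[of q q'] eq by auto
      subgoal for q q' using no[of q' q] eq by auto
      subgoal for q q' using mm[of q q'] eq by auto
      done
  qed
  moreover have "?\<theta> ` {1..m + n - 1} \<subseteq> {1..m + n - 1}"
  proof
    fix y assume "y \<in> ?\<theta> ` {1..m + n - 1}"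
    then obtain p where p: "p \<in> {1..m + n - 1}" "y = ?\<theta> p" by auto
    from cases[OF p(1)] show "y \<in> {1..m + n - 1}"
    proof (elim disjE exE conjE)
      fix q assume q: "1 \<le> q" "q \<le> m" and e: "?\<theta> p = (if \<sigma> q < \<sigma> j then \<sigma> q else \<sigma> q + n - 1)"
      have "1 \<le> \<sigma> q" "\<sigma> q \<le> m" using \<sigma>1[of q] q by auto
      then show ?thesis using n unfolding p(2) e atLeastAtMost_iff by (auto split: if_splits)
    next
      fix q assume q: "1 \<le> q" "q \<le> n" and e: "?\<theta> p = \<sigma> j + \<rho> q - 1"
      have "1 \<le> \<rho> q" "\<rho> q \<le> n" using \<rho>1[of q] q by auto
      then show ?thesis using sj unfolding p(2) e atLeastAtMost_iff by auto
    qed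
  qed
  ultimately have "bij_betw ?\<theta> {1..m + n - 1} {1..m + n - 1}"
    by (simp add: bij_betw_def endo_inj_surj)
  moreover have "?\<theta> p = p" if "p \<notin> {1..m + n - 1}" for p
  proof (cases "p = 0")
    case True
    then show ?thesis using j sj permutes_not_in[OF \<sigma>, of 0] by (simp add: low)
  next
    case False
    then have "m + n \<le> p" using that by auto
    then show ?thesis
      using high[of "p + 1 - n"] n j sj permutes_not_in[OF \<sigma>, of "p + 1 - n"] by auto
  qed
  ultimately show ?thesis by (rule bij_imp_permutes)
qed

lemma qlinear_abs_zinb: "qlinear abs_zinb"
  by (rule qlinearI) (simp_all add: plus_zinb.abs_eq scaleQ_zinb.abs_eq)

lemma arity_space_Zinb: "arity_space Zinb n = abs_zinb ` arity_space Dend n"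
  by (simp add: Zinb_def operad_quotient_def)

text \<open>The value does not depend on the representative, but the proof needs the symmetrization to be an
  operad, which is an assumption of the context below.\<close>

definition zinb_eval :: "zinb \<Rightarrow> (nat \<Rightarrow> word_fun) \<Rightarrow> word_fun" where
  "zinb_eval z = sym_eval (rep_zinb z)"

section \<open>The symmetric group on n + 1 letters\<close>

lemma permutes_ident: "(\<lambda>a. a) permutes A"
  by (simp add: permutes_def)

lemma permutes_Suc: "\<pi> permutes {1..n::nat} \<Longrightarrow> \<pi> permutes {1..n + 1}"
  by (erule permutes_subset) auto

lemma long_cycle_permutes: "long_cycle n permutes {1..n + 1}"
proof (rule bij_imp_permutes)
  show "bij_betw (long_cycle n) {1..n + 1} {1..n + 1}"
    by (rule bij_betw_byWitness[where f' = "\<lambda>i. if i = n + 1 then 1 else i + 1"])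
      (auto simp: long_cycle_def)
qed (auto simp: long_cycle_def)

lemma long_cycle_pow: "j \<le> k \<Longrightarrow> k \<le> n + 1 \<Longrightarrow> j < k \<Longrightarrow> (long_cycle n ^^ j) k = k - j"
  by (induction j) (auto simp: long_cycle_def)

lemma long_cycle_pow_permutes: "(long_cycle n ^^ k) permutes {1..n + 1}"
proof (induction k)
  case (Suc k)
  show ?case unfolding funpow.simps(2) by (rule permutes_compose[OF Suc long_cycle_permutes])
qed (simp add: permutes_id[unfolded id_def] id_def)

text \<open>The power of the long cycle is the one that takes to \<open>n + 1\<close> the letter that \<open>h\<close> takes there.\<close>

lemma permutation_decomp:
  assumes h: "h permutes {1..n + 1}"
  obtains k \<pi> where "\<pi> permutes {1..n}" "h = \<pi> \<circ> (long_cycle n ^^ k)"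
proof -
  define j where "j = inv h (n + 1)"
  have j: "h j = n + 1" "1 \<le> j" "j \<le> n + 1"
    using permutes_inverses(1)[OF h] permutes_in_image[OF permutes_inv[OF h], of "n + 1"]
    by (auto simp: j_def)
  obtain k where k: "(long_cycle n ^^ k) j = n + 1"
  proof (cases "j = n + 1")
    case True
    then have "(long_cycle n ^^ 0) j = n + 1" by simp
    then show ?thesis by (rule that)
  next
    case False
    have "(long_cycle n ^^ Suc (j - 1)) j = n + 1"
      using long_cycle_pow[of "j - 1" j n] j unfolding funpow.simps(2) comp_apply
      by (simp add: long_cycle_def)
    then show ?thesis by (rule that)
  qed
  let ?c = "long_cycle n ^^ k"
  have c: "?c permutes {1..n + 1}"
    by (rule long_cycle_pow_permutes)
  let ?\<pi> = "h \<circ> inv ?c"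
  have "?\<pi> permutes {1..n + 1}" by (rule permutes_compose[OF permutes_inv[OF c] h])
  moreover have "?\<pi> (n + 1) = n + 1"
  proof -
    have "inv ?c (n + 1) = j" using permutes_inv_eq[OF c] k by blast
    then show ?thesis using j(1) by simp
  qed
  ultimately have "?\<pi> permutes {1..n}"
    unfolding permutes_def by (metis atLeastAtMost_iff le_Suc_eq Suc_eq_plus1)
  moreover have "h = ?\<pi> \<circ> ?c"
    using permutes_inv_o(2)[OF c] by (simp add: comp_assoc)
  ultimately show ?thesis by (rule that)
qed

section \<open>Zinbiel operations on words and the cyclic action\<close>

locale zinb_anticyclic = dend_anticyclic \<tau> + D: anticyclic_operad Dend cycD + Z: anticyclic_operad Zinb cycZ
  for \<tau> cycD cycZ +
  assumes cycD_tau: "1 \<le> k \<Longrightarrow> E \<in> arity_space Dend_ns k \<Longrightarrow>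
      cycD k (long_cycle k) (Poly_Mapping.single id E) = Poly_Mapping.single id (\<tau> k E)"
    and morphism: "anticyclic_morphism Dend cycD Zinb cycZ abs_zinb"
begin

lemma single_arity:
  assumes "1 \<le> n" "E \<in> arity_space Dend_ns n" "\<pi> permutes {1..n}"
  shows "Poly_Mapping.single \<pi> E \<in> arity_space Dend n"
  using assms rat_vector.subspace_0[OF subspace] by (auto simp: Dend_simps lookup_single when_def)

text \<open>The relation \<open>x\<^sub>1 \<prec> x\<^sub>2 = x\<^sub>2 \<succ> x\<^sub>1\<close> holds by the definition of \<open>tree_eval\<close> on \<open>Succ\<close>.\<close>

lemma zinb_ideal_sym_eval:
  assumes "operad_ideal Dend zinb_relations n x"
  shows "1 \<le> n \<and> x \<in> arity_space Dend n \<and> (\<forall>p. sym_eval x p = 0)"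
  using assms
proof (induction rule: operad_ideal.induct)
  case (generator x n)
  then have n: "n = 2" and x: "x = Poly_Mapping.single id dend_prec
         - Poly_Mapping.single (Transposition.transpose 1 2) dend_succ"
    by (auto simp: zinb_relations_def split: if_splits)
  have "Transposition.transpose 1 2 permutes {1..2::nat}" by (rule permutes_swap_id) auto
  then have "x \<in> arity_space Dend n"
    unfolding x n by (intro rat_vector.subspace_diff[OF D.subspace] single_arity generators_arity permutes_id) auto
  moreover have "sym_eval x p = 0" for p
    by (simp add: x qlinear_diff[OF qlinear_sym_eval] dend_prec_eq dend_succ_eq
        Transposition.transpose_def numeral_2_eq_2)
  ultimately show ?case using n by simp
next
  case (zero n)
  then show ?case using rat_vector.subspace_0[OF D.subspace] qlinear_0[OF qlinear_sym_eval] by auto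
next
  case (add n x y)
  then show ?case using rat_vector.subspace_add[OF D.subspace] by (simp add: qlinear_add[OF qlinear_sym_eval])
next
  case (scale n x c)
  then show ?case using rat_vector.subspace_scale[OF D.subspace] by (simp add: qlinear_scale[OF qlinear_sym_eval])
next
  case (act n x \<sigma>)
  then show ?case using sym_rep_closed[OF D.act_rep] by (auto simp: sym_eval_act)
next
  case (pcomp_left m x n g i)
  then have "pcomp Dend m n i x g \<in> arity_space Dend (m + n - 1)"
    using D.pcomp_linear_left[of m n i g] by (auto simp: linear_between_def)
  then show ?case using pcomp_left by (auto simp: sym_eval_pcomp)
next
  case (pcomp_right n x m f i)
  then have "pcomp Dend m n i f x \<in> arity_space Dend (m + n - 1)"
    using D.pcomp_linear_right[of m n i f] by (auto simp: linear_between_def)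
  moreover have "sym_eval (pcomp Dend m n i f x) p = 0" for p
  proof -
    have "sym_eval (pcomp Dend m n i f x) p = sym_eval f (plug i n 0 p)"
      using pcomp_right by (subst sym_eval_pcomp) (auto simp: zero_fun_def)
    also have "\<dots> = 0"
      unfolding sym_eval_def
    proof (rule sum.neutral, rule ballI)
      fix \<sigma> assume s: "\<sigma> \<in> Poly_Mapping.keys f"
      have \<sigma>: "\<sigma> permutes {1..m}" using s pcomp_right by (auto simp: Dend_simps)
      have f: "Poly_Mapping.lookup f \<sigma> \<in> arity_space Dend_ns m" using pcomp_right by (simp add: Dend_simps)
      define j where "j = inv \<sigma> i"
      have j: "\<sigma> j = i" "1 \<le> j" "j \<le> m"
        using permutes_inverses(1)[OF \<sigma>, of i] permutes_in_image[OF permutes_inv[OF \<sigma>], of i] pcomp_right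
        by (auto simp: j_def)
      have "plug i n 0 p \<circ> \<sigma> = (plug i n 0 p \<circ> \<sigma>)(j := 0)"
        using j(1) by (auto simp: fun_eq_iff plug_def)
      then show "dend_eval (Poly_Mapping.lookup f \<sigma>) (plug i n 0 p \<circ> \<sigma>) = 0"
        using qlinear_0[OF qlinear_dend_eval_slot[OF f j(2,3)]] by metis
    qed
    finally show ?thesis .
  qed
  ultimately show ?case using pcomp_right by auto
qed

lemma zinb_eval_abs: "zinb_eval (abs_zinb F) = sym_eval F"
proof
  fix p
  have "abs_zinb (rep_zinb (abs_zinb F)) = abs_zinb F" by (rule Quotient_abs_rep[OF Quotient_zinb])
  then have "rep_zinb (abs_zinb F) - F \<in> zinb_ideal" by (simp add: zinb.abs_eq_iff)
  then have "sym_eval (rep_zinb (abs_zinb F) - F) p = 0"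
    unfolding zinb_ideal_def
  proof (induction rule: rat_vector.span_induct_alt)
    case base
    show ?case by (simp add: qlinear_0[OF qlinear_sym_eval])
  next
    case (step c x y)
    then show ?case
      by (auto simp: qlinear_add[OF qlinear_sym_eval] qlinear_scale[OF qlinear_sym_eval] dest: zinb_ideal_sym_eval)
  qed
  then show "zinb_eval (abs_zinb F) p = sym_eval F p"
    by (simp add: zinb_eval_def qlinear_diff[OF qlinear_sym_eval])
qed

lemma qlinear_zinb_eval: "qlinear (\<lambda>z. zinb_eval z p)"
proof (rule qlinearI)
  fix x y and c
  obtain F G where *: "x = abs_zinb F" "y = abs_zinb G"
    by (metis Quotient_abs_rep[OF Quotient_zinb])
  show "zinb_eval (x + y) p = zinb_eval x p + zinb_eval y p"
    unfolding * plus_zinb.abs_eq zinb_eval_abs by (rule qlinear_add[OF qlinear_sym_eval])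
  show "zinb_eval (c *\<^sub>Q x) p = c *\<^sub>Q zinb_eval x p"
    unfolding * scaleQ_zinb.abs_eq zinb_eval_abs by (rule qlinear_scale[OF qlinear_sym_eval])
qed

lemma cycD_pow:
  assumes "1 \<le> n" "E \<in> arity_space Dend_ns n"
  shows "cycD n (long_cycle n ^^ k) (Poly_Mapping.single id E) = Poly_Mapping.single id ((\<tau> n ^^ k) E)"
    and "(\<tau> n ^^ k) E \<in> arity_space Dend_ns n"
proof -
  show mem: "(\<tau> n ^^ k) E \<in> arity_space Dend_ns n" for k
    by (induction k) (use assms in \<open>simp_all add: tau_mem\<close>)
  have rep: "sym_rep (n + 1) (arity_space Dend n) (cycD n)" by (rule D.cyc_rep[OF assms(1)])
  have s: "Poly_Mapping.single id ((\<tau> n ^^ k) E) \<in> arity_space Dend n" for k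
    by (rule single_arity[OF assms(1) mem permutes_id])
  show "cycD n (long_cycle n ^^ k) (Poly_Mapping.single id E) = Poly_Mapping.single id ((\<tau> n ^^ k) E)"
  proof (induction k)
    case 0
    then show ?case using rep s[of 0] by (simp add: sym_rep_def id_def)
  next
    case (Suc k)
    have "long_cycle n ^^ k permutes {1..n + 1}" by (rule long_cycle_pow_permutes)
    then have "cycD n (long_cycle n \<circ> (long_cycle n ^^ k)) (Poly_Mapping.single id E)
        = cycD n (long_cycle n) (cycD n (long_cycle n ^^ k) (Poly_Mapping.single id E))"
      using rep s[of 0] long_cycle_permutes[of n] unfolding sym_rep_def by simp
    then show ?case by (simp only: funpow.simps(2) comp_apply[of "\<tau> n"] Suc cycD_tau[OF assms(1) mem[of k]])
  qed
qed

lemma cyclic_form_pow: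
  assumes "1 \<le> n" "E \<in> arity_space Dend_ns n"
  shows "cyclic_form s n ((\<tau> n ^^ k) E) p = cyclic_form s n E (p \<circ> (long_cycle n ^^ k))"
proof (induction k arbitrary: p)
  case (Suc k)
  show ?case
    using cyclic_form_tau[OF assms(1) cycD_pow(2)[OF assms, of k]] Suc by (simp add: comp_assoc)
qed simp

text \<open>Since \<open>g \<circ> \<pi>\<close> is a permutation of the first \<open>n\<close> letters after a power of the long cycle, the action of
  \<open>g\<close> on \<open>E \<otimes> \<pi>\<close> is determined by \<open>\<tau>\<close>, and the form sees both factors as permutations of its inputs.\<close>

lemma cycD_single:
  assumes n: "1 \<le> n" and E: "E \<in> arity_space Dend_ns n" and \<pi>: "\<pi> permutes {1..n}"
    and g: "g permutes {1..n + 1}"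
  shows "word_sum s (p (n + 1) \<lhd> sym_eval (cycD n g (Poly_Mapping.single \<pi> E)) p)
    = word_sum s (p (g (n + 1)) \<lhd> sym_eval (Poly_Mapping.single \<pi> E) (p \<circ> g))"
proof -
  have rep: "sym_rep (n + 1) (arity_space Dend n) (cycD n)" by (rule D.cyc_rep[OF n])
  have comp: "cycD n (\<sigma> \<circ> \<rho>) x = cycD n \<sigma> (cycD n \<rho> x)"
    if "\<sigma> permutes {1..n + 1}" "\<rho> permutes {1..n + 1}" "x \<in> arity_space Dend n" for \<sigma> \<rho> x
    using rep that unfolding sym_rep_def by blast
  have ext: "cycD n \<sigma> (Poly_Mapping.single \<rho> E') = Poly_Mapping.single (\<sigma> \<circ> \<rho>) E'"
    if "\<sigma> permutes {1..n}" "\<rho> permutes {1..n}" "E' \<in> arity_space Dend_ns n" for \<sigma> \<rho> E'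
    using D.cyc_extends[OF n that(1) single_arity[OF n that(3,2)]] by (simp add: op_act_Dend_single)
  have "g \<circ> \<pi> permutes {1..n + 1}" by (rule permutes_compose[OF permutes_Suc[OF \<pi>] g])
  then obtain k \<pi>' where \<pi>': "\<pi>' permutes {1..n}" "g \<circ> \<pi> = \<pi>' \<circ> (long_cycle n ^^ k)"
    by (rule permutation_decomp)
  have id: "Poly_Mapping.single id E \<in> arity_space Dend n" by (rule single_arity[OF n E permutes_id])
  have "cycD n g (Poly_Mapping.single \<pi> E) = cycD n g (cycD n \<pi> (Poly_Mapping.single id E))"
    using ext[OF \<pi> permutes_id E] by simp
  also have "\<dots> = cycD n (\<pi>' \<circ> (long_cycle n ^^ k)) (Poly_Mapping.single id E)"
    unfolding \<pi>'(2)[symmetric] by (rule comp[symmetric, OF g permutes_Suc[OF \<pi>] id])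
  also have "\<dots> = cycD n \<pi>' (cycD n (long_cycle n ^^ k) (Poly_Mapping.single id E))"
    by (rule comp[OF permutes_Suc[OF \<pi>'(1)] long_cycle_pow_permutes id])
  also have "\<dots> = Poly_Mapping.single \<pi>' ((\<tau> n ^^ k) E)"
    using ext[OF \<pi>'(1) permutes_id cycD_pow(2)[OF n E]] by (simp add: cycD_pow(1)[OF n E])
  finally have "word_sum s (p (n + 1) \<lhd> sym_eval (cycD n g (Poly_Mapping.single \<pi> E)) p)
      = cyclic_form s n ((\<tau> n ^^ k) E) (p \<circ> \<pi>')"
    using permutes_not_in[OF \<pi>'(1), of "n + 1"] by (simp add: cyclic_form_def)
  also have "\<dots> = cyclic_form s n E (p \<circ> (g \<circ> \<pi>))"
    unfolding cyclic_form_pow[OF n E] \<pi>'(2) by (simp add: comp_assoc)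
  also have "\<dots> = word_sum s (p (g (n + 1)) \<lhd> sym_eval (Poly_Mapping.single \<pi> E) (p \<circ> g))"
    using permutes_not_in[OF \<pi>, of "n + 1"] by (simp add: cyclic_form_def comp_assoc)
  finally show ?thesis .
qed

definition zinb_form :: "bracketing \<Rightarrow> nat \<Rightarrow> zinb \<Rightarrow> (nat \<Rightarrow> word_fun) \<Rightarrow> rat" where
  "zinb_form s n z p = word_sum s (p (n + 1) \<lhd> zinb_eval z p)"

lemma qlinear_zinb_form: "qlinear (\<lambda>z. zinb_form s n z p)"
  unfolding zinb_form_def
  by (rule qlinear_compose[OF qlinear_word_sum], rule qlinear_compose[OF qlinear_half_shuffle_right],
      rule qlinear_zinb_eval)

text \<open>The group acts on the associated forms by permuting all \<open>n + 1\<close> inputs, as in a cyclic operad.\<close>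

lemma zinb_form_cyc:
  assumes n: "1 \<le> n" and x: "x \<in> arity_space Zinb n" and g: "g permutes {1..n + 1}"
  shows "zinb_form s n (cycZ n g x) p = zinb_form s n x (p \<circ> g)"
proof -
  obtain F where F: "F \<in> arity_space Dend n" "x = abs_zinb F"
    using x by (auto simp: arity_space_Zinb)
  have Fk: "\<pi> permutes {1..n}" "Poly_Mapping.lookup F \<pi> \<in> arity_space Dend_ns n"
    if "\<pi> \<in> Poly_Mapping.keys F" for \<pi>
    using F(1) that by (auto simp: Dend_simps)
  let ?s = "\<lambda>\<pi>. Poly_Mapping.single \<pi> (Poly_Mapping.lookup F \<pi>)"
  have lin: "linear_between (arity_space Dend n) (arity_space Dend n) (cycD n g)"
    using D.cyc_rep[OF n] g unfolding sym_rep_def by blast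
  have "cycD n g F = cycD n g (\<Sum>\<pi>\<in>Poly_Mapping.keys F. ?s \<pi>)" by (simp add: sum_singles)
  also have "\<dots> = (\<Sum>\<pi>\<in>Poly_Mapping.keys F. cycD n g (?s \<pi>))"
    by (rule linear_between_sum[OF lin D.subspace[OF n]]) (intro single_arity n Fk)
  finally have cyc: "cycD n g F = (\<Sum>\<pi>\<in>Poly_Mapping.keys F. cycD n g (?s \<pi>))" .
  have q: "qlinear (\<lambda>F. word_sum s (f \<lhd> sym_eval F p))" for f p
    by (rule qlinear_compose[OF qlinear_word_sum], rule qlinear_compose[OF qlinear_half_shuffle_right],
      rule qlinear_sym_eval)
  have "cycZ n g x = abs_zinb (cycD n g F)"
    using morphism n g F unfolding anticyclic_morphism_def by auto
  then have "zinb_form s n (cycZ n g x) p = word_sum s (p (n + 1) \<lhd> sym_eval (cycD n g F) p)"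
    by (simp add: zinb_form_def zinb_eval_abs)
  also have "\<dots> = (\<Sum>\<pi>\<in>Poly_Mapping.keys F. word_sum s (p (n + 1) \<lhd> sym_eval (cycD n g (?s \<pi>)) p))"
    unfolding cyc by (rule qlinear_sum[OF q])
  also have "\<dots> = (\<Sum>\<pi>\<in>Poly_Mapping.keys F. word_sum s (p (g (n + 1)) \<lhd> sym_eval (?s \<pi>) (p \<circ> g)))"
    by (rule sum.cong[OF refl], rule cycD_single) (intro n Fk g; assumption)+
  also have "\<dots> = word_sum s (p (g (n + 1)) \<lhd> sym_eval (\<Sum>\<pi>\<in>Poly_Mapping.keys F. ?s \<pi>) (p \<circ> g))"
    by (rule qlinear_sum[OF q, symmetric])
  also have "\<dots> = zinb_form s n x (p \<circ> g)"
    by (simp add: sum_singles zinb_form_def F(2) zinb_eval_abs)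
  finally show ?thesis .
qed

end

section \<open>Right combs span the Zinbiel operad\<close>

primrec right_comb :: "nat \<Rightarrow> tree" where
  "right_comb 0 = Leaf"
| "right_comb (Suc k) = Prec Leaf (right_comb k)"

lemma leaves_right_comb [simp]: "leaves (right_comb k) = Suc k"
  by (induction k) auto

lemma tree_eval_right_comb:
  "tree_eval (right_comb k) (\<lambda>i. word [f i]) = word (map f [1..<k + 2])"
proof (induction k arbitrary: f)
  case (Suc k)
  have "[1..<Suc k + 2] = 1 # map Suc [1..<k + 2]"
    by (simp add: upt_conv_Cons map_Suc_upt del: upt_Suc)
  then have "map f [1..<Suc k + 2] = f 1 # map (\<lambda>i. f (i + 1)) [1..<k + 2]"
    by (simp del: upt_Suc)
  then show ?case
    using Suc[of "\<lambda>i. f (i + 1)"] by (simp add: letter_half_shuffle del: upt_Suc)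
qed simp

text \<open>Grafting \<open>z\<close>, \<open>y\<close>, \<open>x\<close> into the leaves of the first dendriform relation, from the last leaf to the first
  so that the earlier positions are not shifted.\<close>

lemma dend_left_nested:
  "dend_of (Prec (Prec x y) z) = dend_of (Prec x (Prec y z)) + dend_of (Prec x (Succ y z))"
proof -
  let ?r = "basis_vec (Prec (Prec Leaf Leaf) Leaf)
         - (basis_vec (Prec Leaf (Prec Leaf Leaf)) + basis_vec (Prec Leaf (Succ Leaf Leaf)))"
  have mem: "basis_vec t \<in> arity_space Free_dend (leaves t)" for t
    by (simp add: Free_dend_simps)
  have r: "ns_ideal Free_dend dend_relations 3 ?r"
    by (rule ns_ideal.generator) (simp add: dend_relations_def)
  note 1 = ns_ideal.pcomp_left[OF r leaves_pos mem[of z], of 3, simplified]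
  have "1 \<le> leaves z" "1 \<le> leaves y" by (rule leaves_pos)+
  note 2 = ns_ideal.pcomp_left[OF 1 leaves_pos mem[of y], of 2]
  note 3 = ns_ideal.pcomp_left[OF 2 leaves_pos mem[of x], of 1]
  let ?c = "\<lambda>v. bilin_ext (graft 1) (bilin_ext (graft 2) (bilin_ext (graft 3) v (basis_vec z)) (basis_vec y)) (basis_vec x)"
  have "?c ?r \<in> dend_ideal"
    unfolding dend_ideal_def
    by (rule rat_vector.span_base)
      (use 3 \<open>1 \<le> leaves z\<close> \<open>1 \<le> leaves y\<close> in \<open>auto simp: Free_dend_simps(2)\<close>)
  moreover have "?c ?r = basis_vec (Prec (Prec x y) z) - (basis_vec (Prec x (Prec y z)) + basis_vec (Prec x (Succ y z)))"
    by (simp add: qlinear_diff[OF qlinear_bilin_ext_left] qlinear_add[OF qlinear_bilin_ext_left])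
  ultimately have "abs_dend (basis_vec (Prec (Prec x y) z))
      = abs_dend (basis_vec (Prec x (Prec y z)) + basis_vec (Prec x (Succ y z)))"
    by (simp add: dend.abs_eq_iff)
  then show ?thesis by (simp add: dend_of_def plus_dend.abs_eq)
qed

context zinb_anticyclic
begin

definition zinb_of :: "tree \<Rightarrow> zinb" where
  "zinb_of t = abs_zinb (Poly_Mapping.single id (dend_of t))"

lemma zinb_of_arity: "leaves t = n \<Longrightarrow> zinb_of t \<in> arity_space Zinb n"
  unfolding zinb_of_def arity_space_Zinb
  by (intro imageI single_arity dend_of_arity permutes_id) (use leaves_pos in auto)

lemma abs_zinb_pcomp:
  assumes "1 \<le> m" "1 \<le> n" "1 \<le> i" "i \<le> m" "f \<in> arity_space Dend m" "g \<in> arity_space Dend n"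
  shows "abs_zinb (pcomp Dend m n i f g) = pcomp Zinb m n i (abs_zinb f) (abs_zinb g)"
  using morphism assms unfolding anticyclic_morphism_def by blast

lemma abs_zinb_act:
  assumes "1 \<le> n" "\<sigma> permutes {1..n}" "f \<in> arity_space Dend n"
  shows "abs_zinb (op_act Dend n \<sigma> f) = op_act Zinb n \<sigma> (abs_zinb f)"
proof -
  have "abs_zinb f \<in> arity_space Zinb n" using assms(3) by (simp add: arity_space_Zinb)
  then have "op_act Zinb n \<sigma> (abs_zinb f) = cycZ n \<sigma> (abs_zinb f)"
    using Z.cyc_extends assms by simp
  also have "\<dots> = abs_zinb (cycD n \<sigma> f)"
    using morphism assms permutes_Suc[OF assms(2)] unfolding anticyclic_morphism_def by simp
  finally show ?thesis using D.cyc_extends assms by simp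
qed

lemma pcomp_single_id:
  assumes "1 \<le> m" "1 \<le> n" "1 \<le> i" "i \<le> m" "f \<in> arity_space Dend_ns m" "g \<in> arity_space Dend_ns n"
  shows "pcomp Dend m n i (Poly_Mapping.single id f) (Poly_Mapping.single id g)
    = Poly_Mapping.single id (pcomp Dend_ns m n i f g)"
proof -
  have "pcomp Dend_ns m n i 0 g = 0" "pcomp Dend_ns m n i f 0 = 0"
    using linear_between_0[OF pcomp_linear_left subspace] linear_between_0[OF pcomp_linear_right subspace] assms
    by auto
  then show ?thesis using assms(2) by (auto simp: Dend_simps block_perm_id inv_id[unfolded id_def])
qed

lemma zinb_of_graft:
  assumes "leaves t = m" "leaves s = n" "1 \<le> i" "i \<le> m"
  shows "pcomp Zinb m n i (zinb_of t) (zinb_of s) = zinb_of (graft i t s)"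
proof -
  have pos: "1 \<le> m" "1 \<le> n" using assms leaves_pos by auto
  note d = dend_of_arity[OF assms(1)] dend_of_arity[OF assms(2)]
  have "zinb_of (graft i t s)
      = abs_zinb (pcomp Dend m n i (Poly_Mapping.single id (dend_of t)) (Poly_Mapping.single id (dend_of s)))"
    using pcomp_single_id[OF pos assms(3,4) d] assms by (simp add: zinb_of_def pcomp_dend_of)
  also have "\<dots> = pcomp Zinb m n i (zinb_of t) (zinb_of s)"
    unfolding zinb_of_def
    by (rule abs_zinb_pcomp) (use pos assms d in \<open>auto intro!: single_arity permutes_id\<close>)
  finally show ?thesis ..
qed

lemma zinb_of_left_nested:
  "zinb_of (Prec (Prec x y) z) = zinb_of (Prec x (Prec y z)) + zinb_of (Prec x (Succ y z))"
  by (simp add: zinb_of_def dend_left_nested single_add qlinear_add[OF qlinear_abs_zinb])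

text \<open>The defining relation of the Zinbiel operad, acted on by the transposition.\<close>

lemma zinb_of_succ: "zinb_of (Succ Leaf Leaf) = op_act Zinb 2 (Transposition.transpose 1 2) (zinb_of (Prec Leaf Leaf))"
proof -
  let ?t = "Transposition.transpose 1 (2::nat)"
  have t: "?t permutes {1..2}" by (rule permutes_swap_id) auto
  have "operad_ideal Dend zinb_relations 2 (Poly_Mapping.single id dend_prec - Poly_Mapping.single ?t dend_succ)"
    by (rule operad_ideal.generator) (simp add: zinb_relations_def)
  then have "Poly_Mapping.single id dend_prec - Poly_Mapping.single ?t dend_succ \<in> zinb_ideal"
    unfolding zinb_ideal_def by (intro rat_vector.span_base) auto
  then have "zinb_of (Prec Leaf Leaf) = abs_zinb (Poly_Mapping.single ?t dend_succ)"
    by (simp add: zinb_of_def zinb.abs_eq_iff flip: dend_prec_eq)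
  then have "op_act Zinb 2 ?t (zinb_of (Prec Leaf Leaf)) = abs_zinb (op_act Dend 2 ?t (Poly_Mapping.single ?t dend_succ))"
    using abs_zinb_act[of 2 ?t "Poly_Mapping.single ?t dend_succ"] t single_arity[OF _ generators_arity(2) t] by simp
  also have "\<dots> = zinb_of (Succ Leaf Leaf)"
    by (simp add: op_act_Dend_single zinb_of_def dend_succ_eq)
  finally show ?thesis ..
qed

definition zinb_basis :: "nat \<Rightarrow> (nat \<Rightarrow> nat) \<Rightarrow> zinb" where
  "zinb_basis n \<pi> = op_act Zinb n \<pi> (zinb_of (right_comb (n - 1)))"

definition comb_span :: "nat \<Rightarrow> zinb set" where
  "comb_span n = rat_vector.span (zinb_basis n ` {\<pi>. \<pi> permutes {1..n}})"

lemma subspace_comb_span: "rat_vector.subspace (comb_span n)"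
  unfolding comb_span_def by simp

lemma zinb_act_linear: "1 \<le> n \<Longrightarrow> \<sigma> permutes {1..n}
    \<Longrightarrow> linear_between (arity_space Zinb n) (arity_space Zinb n) (op_act Zinb n \<sigma>)"
  using Z.act_rep[of n] unfolding sym_rep_def by blast

lemma zinb_act_comp: "1 \<le> n \<Longrightarrow> \<sigma> permutes {1..n} \<Longrightarrow> \<pi> permutes {1..n} \<Longrightarrow> x \<in> arity_space Zinb n
    \<Longrightarrow> op_act Zinb n \<sigma> (op_act Zinb n \<pi> x) = op_act Zinb n (\<sigma> \<circ> \<pi>) x"
  using Z.act_rep[of n] unfolding sym_rep_def by auto

lemma zinb_act_id: "1 \<le> n \<Longrightarrow> x \<in> arity_space Zinb n \<Longrightarrow> op_act Zinb n id x = x"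
  using Z.act_rep[of n] unfolding sym_rep_def by auto

lemma comb_arity: "1 \<le> n \<Longrightarrow> zinb_of (right_comb (n - 1)) \<in> arity_space Zinb n"
  by (rule zinb_of_arity) simp

lemma zinb_basis_arity: "1 \<le> n \<Longrightarrow> \<pi> permutes {1..n} \<Longrightarrow> zinb_basis n \<pi> \<in> arity_space Zinb n"
  unfolding zinb_basis_def by (rule sym_rep_closed[OF Z.act_rep _ comb_arity])

lemma comb_span_arity: "1 \<le> n \<Longrightarrow> comb_span n \<subseteq> arity_space Zinb n"
  unfolding comb_span_def
  by (rule rat_vector.span_minimal) (auto simp: zinb_basis_arity Z.subspace)

lemma comb_span_act:
  assumes "1 \<le> n" "\<sigma> permutes {1..n}" "x \<in> comb_span n"
  shows "op_act Zinb n \<sigma> x \<in> comb_span n"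
proof (rule linear_between_span[OF zinb_act_linear[OF assms(1,2)] Z.subspace[OF assms(1)] _
      assms(3)[unfolded comb_span_def] subspace_comb_span])
  show "zinb_basis n ` {\<pi>. \<pi> permutes {1..n}} \<subseteq> arity_space Zinb n"
    using assms(1) by (auto simp: zinb_basis_arity)
  fix y assume "y \<in> zinb_basis n ` {\<pi>. \<pi> permutes {1..n}}"
  then obtain \<pi> where \<pi>: "\<pi> permutes {1..n}" "y = zinb_basis n \<pi>" by auto
  then have "op_act Zinb n \<sigma> y = zinb_basis n (\<sigma> \<circ> \<pi>)"
    unfolding \<pi>(2) zinb_basis_def
    by (intro zinb_act_comp[OF assms(1,2) \<pi>(1) comb_arity[OF assms(1)]])
  then show "op_act Zinb n \<sigma> y \<in> comb_span n"
    using permutes_compose[OF \<pi>(1) assms(2)] unfolding comb_span_def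
    by (auto intro!: rat_vector.span_base)
qed

lemma comb_span_comb: "zinb_of (right_comb k) \<in> comb_span (k + 1)"
proof -
  have "zinb_of (right_comb k) = zinb_basis (k + 1) id"
    using zinb_act_id[OF _ comb_arity[of "k + 1"]] by (simp add: zinb_basis_def)
  then show ?thesis unfolding comb_span_def by (auto intro!: rat_vector.span_base permutes_id)
qed

text \<open>Equivariance moves the two permutations out of the composition but changes the index, so the
  assumption is needed for every index.\<close>

lemma comb_span_pcomp_basis:
  assumes comb: "\<And>j. 1 \<le> j \<Longrightarrow> j \<le> m \<Longrightarrow> pcomp Zinb m n j x y \<in> comb_span (m + n - 1)"
    and x: "x \<in> arity_space Zinb m" and y: "y \<in> arity_space Zinb n"
    and "1 \<le> m" "1 \<le> n" "1 \<le> i" "i \<le> m"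
    and \<sigma>: "\<sigma> permutes {1..m}" and \<rho>: "\<rho> permutes {1..n}"
  shows "pcomp Zinb m n i (op_act Zinb m \<sigma> x) (op_act Zinb n \<rho> y) \<in> comb_span (m + n - 1)"
proof -
  define j where "j = inv \<sigma> i"
  have j: "\<sigma> j = i" "1 \<le> j" "j \<le> m"
    using permutes_inverses(1)[OF \<sigma>, of i] permutes_in_image[OF permutes_inv[OF \<sigma>], of i] assms(6,7)
    by (auto simp: j_def)
  have "pcomp Zinb m n (\<sigma> j) (op_act Zinb m \<sigma> x) (op_act Zinb n \<rho> y)
      = op_act Zinb (m + n - 1) (block_perm n j \<sigma> \<rho>) (pcomp Zinb m n j x y)"
    by (rule Z.equivariant) (use assms j in auto)
  also have "\<dots> \<in> comb_span (m + n - 1)"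
    by (rule comb_span_act[OF _ block_perm_permutes[OF \<sigma> \<rho> j(2,3)]]) (use assms j in auto)
  finally show ?thesis unfolding j(1) .
qed

lemma comb_span_pcomp:
  assumes comb: "\<And>j. 1 \<le> j \<Longrightarrow> j \<le> m \<Longrightarrow>
      pcomp Zinb m n j (zinb_of (right_comb (m - 1))) (zinb_of (right_comb (n - 1))) \<in> comb_span (m + n - 1)"
    and x: "x \<in> comb_span m" and y: "y \<in> comb_span n"
    and mn: "1 \<le> m" "1 \<le> n" and i: "1 \<le> i" "i \<le> m"
  shows "pcomp Zinb m n i x y \<in> comb_span (m + n - 1)"
proof -
  have sub: "zinb_basis k ` {\<pi>. \<pi> permutes {1..k}} \<subseteq> arity_space Zinb k" if "1 \<le> k" for k
    using that by (auto simp: zinb_basis_arity)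
  have y': "y \<in> arity_space Zinb n" using y comb_span_arity[OF mn(2)] by auto
  show ?thesis
  proof (rule linear_between_span[OF Z.pcomp_linear_left[OF mn i y'] Z.subspace[OF mn(1)] sub[OF mn(1)]
        x[unfolded comb_span_def] subspace_comb_span])
    fix x' assume "x' \<in> zinb_basis m ` {\<pi>. \<pi> permutes {1..m}}"
    then obtain \<sigma> where \<sigma>: "\<sigma> permutes {1..m}" "x' = zinb_basis m \<sigma>" by auto
    have x'': "x' \<in> arity_space Zinb m" using \<sigma> mn by (simp add: zinb_basis_arity)
    show "pcomp Zinb m n i x' y \<in> comb_span (m + n - 1)"
    proof (rule linear_between_span[OF Z.pcomp_linear_right[OF mn i x''] Z.subspace[OF mn(2)] sub[OF mn(2)]
          y[unfolded comb_span_def] subspace_comb_span])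
      fix y' assume "y' \<in> zinb_basis n ` {\<pi>. \<pi> permutes {1..n}}"
      then obtain \<rho> where \<rho>: "\<rho> permutes {1..n}" "y' = zinb_basis n \<rho>" by auto
      show "pcomp Zinb m n i x' y' \<in> comb_span (m + n - 1)"
        unfolding \<sigma>(2) \<rho>(2) zinb_basis_def
        by (rule comb_span_pcomp_basis[OF comb]) (use \<sigma> \<rho> mn i comb_arity in auto)
    qed
  qed
qed

lemma comb_span_node:
  assumes "y \<in> comb_span (k + 1)"
  shows "pcomp Zinb 2 (k + 1) 2 (zinb_of (right_comb 1)) y \<in> comb_span (k + 2)"
proof -
  have c: "zinb_of (right_comb 1) \<in> arity_space Zinb 2" by (rule zinb_of_arity) simp
  have sub: "zinb_basis (k + 1) ` {\<pi>. \<pi> permutes {1..k + 1}} \<subseteq> arity_space Zinb (k + 1)"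
    using zinb_basis_arity[of "k + 1"] by auto
  show ?thesis
  proof (rule linear_between_span[OF Z.pcomp_linear_right[of 2 "k + 1" 2, OF _ _ _ _ c] Z.subspace sub
        assms[unfolded comb_span_def] subspace_comb_span])
    fix y' assume "y' \<in> zinb_basis (k + 1) ` {\<pi>. \<pi> permutes {1..k + 1}}"
    then obtain \<rho> where \<rho>: "\<rho> permutes {1..k + 1}" "y' = zinb_basis (k + 1) \<rho>" by auto
    have "pcomp Zinb 2 (k + 1) (id 2) (op_act Zinb 2 id (zinb_of (right_comb 1)))
        (op_act Zinb (k + 1) \<rho> (zinb_of (right_comb k)))
      = op_act Zinb (2 + (k + 1) - 1) (block_perm (k + 1) 2 id \<rho>)
          (pcomp Zinb 2 (k + 1) 2 (zinb_of (right_comb 1)) (zinb_of (right_comb k)))"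
      by (rule Z.equivariant) (use \<rho> c in \<open>auto intro: permutes_ident zinb_of_arity\<close>)
    also have "pcomp Zinb 2 (k + 1) 2 (zinb_of (right_comb 1)) (zinb_of (right_comb k)) = zinb_of (right_comb (k + 1))"
      by (subst zinb_of_graft) auto
    also have "op_act Zinb (2 + (k + 1) - 1) (block_perm (k + 1) 2 id \<rho>) \<dots> \<in> comb_span (2 + (k + 1) - 1)"
      using block_perm_permutes[OF permutes_id[of "{1..2}"] \<rho>(1), of 2] comb_span_comb[of "k + 1"]
      by (intro comb_span_act) auto
    finally show "pcomp Zinb 2 (k + 1) 2 (zinb_of (right_comb 1)) y' \<in> comb_span (k + 2)"
      using zinb_act_id[OF _ c, unfolded id_def] by (simp add: \<rho>(2) zinb_basis_def)
  qed auto
qed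

text \<open>Induction on the total size. At an index other than 1 the composition takes place inside the right
  branch. At index 1 the result is \<open>(x \<prec> B) \<prec> A\<close>, which equals \<open>x \<prec> (B \<prec> A) + x \<prec> (B \<succ> A)\<close>; here
  \<open>B \<prec> A\<close> and, after a permutation of the inputs, \<open>B \<succ> A\<close> are compositions of smaller combs.\<close>

lemma comb_pcomp:
  assumes "1 \<le> i" "i \<le> a + 1"
  shows "pcomp Zinb (a + 1) (b + 1) i (zinb_of (right_comb a)) (zinb_of (right_comb b)) \<in> comb_span (a + b + 1)"
  using assms
proof (induction "a + b" arbitrary: a b i rule: less_induct)
  case less
  have closed: "pcomp Zinb (a' + 1) (b' + 1) i x y \<in> comb_span (a' + b' + 1)"
    if "a' + b' < a + b" "1 \<le> i" "i \<le> a' + 1" "x \<in> comb_span (a' + 1)" "y \<in> comb_span (b' + 1)" for a' b' i x y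
    using comb_span_pcomp[of "a' + 1" "b' + 1" x y i] less.hyps[OF that(1)] that by simp
  have node: "zinb_of (Prec Leaf t) \<in> comb_span (k + 2)" if "zinb_of t \<in> comb_span (k + 1)" "leaves t = k + 1" for t k
    using comb_span_node[OF that(1)] zinb_of_graft[of "right_comb 1" 2 t "k + 1" 2] that(2) by simp
  show ?case
  proof (cases "a = 0 \<or> b = 0")
    case True
    then consider "a = 0" | "b = 0" by blast
    then show ?thesis
    proof cases
      case 1
      then have "pcomp Zinb (a + 1) (b + 1) i (zinb_of (right_comb a)) (zinb_of (right_comb b)) = zinb_of (right_comb b)"
        using less.prems zinb_of_graft[of "right_comb a" "a + 1" "right_comb b" "b + 1" i] by simp
      then show ?thesis using comb_span_comb[of b] 1 by simp
    next
      case 2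
      have gl: "graft i t Leaf = t" for i t by (induction t arbitrary: i) auto
      have "pcomp Zinb (a + 1) (b + 1) i (zinb_of (right_comb a)) (zinb_of (right_comb b)) = zinb_of (right_comb a)"
        using 2 less.prems zinb_of_graft[of "right_comb a" "a + 1" "right_comb b" "b + 1" i] by (simp add: gl)
      then show ?thesis using comb_span_comb[of a] 2 by simp
    qed
  next
    case False
    then obtain a' b' where ab: "a = Suc a'" "b = Suc b'" by (metis not0_implies_Suc)
    have eq: "pcomp Zinb (a + 1) (b + 1) i (zinb_of (right_comb a)) (zinb_of (right_comb b))
        = zinb_of (graft i (right_comb a) (right_comb b))"
      by (rule zinb_of_graft) (use less.prems in auto)
    show ?thesis
    proof (cases "i = 1")
      case True
      let ?A = "right_comb a'" and ?B = "right_comb b'"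
      have 1: "zinb_of (Prec ?B ?A) \<in> comb_span (a' + b' + 2)"
      proof -
        have "zinb_of (Prec ?B ?A) = pcomp Zinb (a + 1) (b' + 1) 1 (zinb_of (right_comb a)) (zinb_of ?B)"
          by (subst zinb_of_graft) (auto simp: ab)
        also have "\<dots> \<in> comb_span (a + b' + 1)"
          by (rule closed[OF _ _ _ comb_span_comb comb_span_comb]) (auto simp: ab)
        finally show ?thesis by (simp add: ab)
      qed
      have 2: "zinb_of (Succ ?B ?A) \<in> comb_span (a' + b' + 2)"
      proof -
        let ?t = "Transposition.transpose 1 (2::nat)"
        have t: "?t permutes {1..2}" by (rule permutes_swap_id) auto
        have B: "zinb_of ?B \<in> arity_space Zinb (b' + 1)" by (rule zinb_of_arity) simp
        have c: "zinb_of (Prec Leaf Leaf) \<in> arity_space Zinb 2" by (rule zinb_of_arity) simp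
        \<comment> \<open>\<open>B \<succ> x\<close> is a permuted comb, because \<open>\<succ>\<close> is the permuted \<open>\<prec>\<close>.\<close>
        have "zinb_of (Succ ?B Leaf) = pcomp Zinb 2 (b' + 1) (?t 2) (zinb_of (Succ Leaf Leaf)) (zinb_of ?B)"
          by (subst zinb_of_graft) auto
        also have "\<dots> = pcomp Zinb 2 (b' + 1) (?t 2) (op_act Zinb 2 ?t (zinb_of (Prec Leaf Leaf)))
            (op_act Zinb (b' + 1) id (zinb_of ?B))"
          using zinb_act_id[OF _ B] by (simp add: zinb_of_succ)
        also have "\<dots> = op_act Zinb (2 + (b' + 1) - 1) (block_perm (b' + 1) 2 ?t id)
            (pcomp Zinb 2 (b' + 1) 2 (zinb_of (Prec Leaf Leaf)) (zinb_of ?B))"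
          by (rule Z.equivariant) (use t B c in \<open>auto intro: permutes_ident\<close>)
        also have "pcomp Zinb 2 (b' + 1) 2 (zinb_of (Prec Leaf Leaf)) (zinb_of ?B) = zinb_of (right_comb b)"
          by (subst zinb_of_graft) (auto simp: ab)
        also have "op_act Zinb (2 + (b' + 1) - 1) (block_perm (b' + 1) 2 ?t id) \<dots> \<in> comb_span (2 + (b' + 1) - 1)"
          using block_perm_permutes[OF t permutes_id[of "{1..b' + 1}"], of 2] comb_span_comb[of b]
          by (intro comb_span_act) (auto simp: ab)
        finally have sB: "zinb_of (Succ ?B Leaf) \<in> comb_span (b + 1)" by (simp add: ab)
        have "zinb_of (Succ ?B ?A) = pcomp Zinb (b + 1) (a' + 1) (b + 1) (zinb_of (Succ ?B Leaf)) (zinb_of ?A)"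
          by (subst zinb_of_graft) (auto simp: ab)
        also have "\<dots> \<in> comb_span (b + a' + 1)"
          by (rule closed[OF _ _ _ sB comb_span_comb]) (auto simp: ab)
        finally show ?thesis by (simp add: ab add.commute)
      qed
      have "graft i (right_comb a) (right_comb b) = Prec (Prec Leaf ?B) ?A"
        using True by (simp add: ab)
      moreover have "zinb_of (Prec Leaf (Prec ?B ?A)) \<in> comb_span (a' + b' + 1 + 2)"
        by (rule node) (use 1 in auto)
      moreover have "zinb_of (Prec Leaf (Succ ?B ?A)) \<in> comb_span (a' + b' + 1 + 2)"
        by (rule node) (use 2 in auto)
      ultimately show ?thesis
        unfolding eq using rat_vector.subspace_add[OF subspace_comb_span]
        by (simp add: zinb_of_left_nested ab)
    next
      case False
      have "zinb_of (graft (i - 1) (right_comb a') (right_comb b))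
          = pcomp Zinb (a' + 1) (b + 1) (i - 1) (zinb_of (right_comb a')) (zinb_of (right_comb b))"
        by (rule zinb_of_graft[symmetric]) (use less.prems False ab in auto)
      also have "\<dots> \<in> comb_span (a' + b + 1)"
        using less.prems False by (intro less.hyps) (auto simp: ab)
      finally have "zinb_of (Prec Leaf (graft (i - 1) (right_comb a') (right_comb b))) \<in> comb_span (a' + b + 2)"
        by (intro node) (auto simp: leaves_graft)
      then show ?thesis unfolding eq using less.prems False by (simp add: ab)
    qed
  qed
qed

lemma comb_span_closed:
  assumes "x \<in> comb_span m" "y \<in> comb_span n" "1 \<le> m" "1 \<le> n" "1 \<le> i" "i \<le> m"
  shows "pcomp Zinb m n i x y \<in> comb_span (m + n - 1)"
proof (rule comb_span_pcomp[OF _ assms])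
  have e: "m - 1 + 1 = m" "n - 1 + 1 = n" "m - 1 + (n - 1) + 1 = m + n - 1" using assms(3,4) by auto
  show "pcomp Zinb m n j (zinb_of (right_comb (m - 1))) (zinb_of (right_comb (n - 1))) \<in> comb_span (m + n - 1)"
    if "1 \<le> j" "j \<le> m" for j
    using comb_pcomp[of j "m - 1" "n - 1", unfolded e] that by simp
qed

lemma zinb_of_comb_span: "leaves t = n \<Longrightarrow> zinb_of t \<in> comb_span n"
proof (induction t arbitrary: n)
  case Leaf
  then show ?case using comb_span_comb[of 0] by simp
next
  case (Prec l r)
  have pos: "1 \<le> leaves l" "1 \<le> leaves r" by (rule leaves_pos)+
  have "zinb_of (Prec Leaf Leaf) \<in> comb_span 2" using comb_span_comb[of 1] by (simp add: numeral_2_eq_2)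
  then have "pcomp Zinb 2 (leaves r) 2 (zinb_of (Prec Leaf Leaf)) (zinb_of r) \<in> comb_span (2 + leaves r - 1)"
    using Prec.IH(2) pos by (intro comb_span_closed) auto
  also have "pcomp Zinb 2 (leaves r) 2 (zinb_of (Prec Leaf Leaf)) (zinb_of r) = zinb_of (Prec Leaf r)"
    by (subst zinb_of_graft) auto
  finally have "pcomp Zinb (leaves r + 1) (leaves l) 1 (zinb_of (Prec Leaf r)) (zinb_of l)
      \<in> comb_span (leaves r + 1 + leaves l - 1)"
    using Prec.IH(1) pos by (intro comb_span_closed) auto
  also have "pcomp Zinb (leaves r + 1) (leaves l) 1 (zinb_of (Prec Leaf r)) (zinb_of l) = zinb_of (Prec l r)"
    by (subst zinb_of_graft) auto
  finally show ?case using Prec.prems by (simp add: add.commute)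
next
  case (Succ l r)
  have pos: "1 \<le> leaves l" "1 \<le> leaves r" by (rule leaves_pos)+
  have "zinb_of (Prec Leaf Leaf) \<in> comb_span 2" using comb_span_comb[of 1] by (simp add: numeral_2_eq_2)
  moreover have "Transposition.transpose 1 2 permutes {1..2::nat}" by (rule permutes_swap_id) auto
  ultimately have "zinb_of (Succ Leaf Leaf) \<in> comb_span 2" unfolding zinb_of_succ by (intro comb_span_act) auto
  then have "pcomp Zinb 2 (leaves r) 2 (zinb_of (Succ Leaf Leaf)) (zinb_of r) \<in> comb_span (2 + leaves r - 1)"
    using Succ.IH(2) pos by (intro comb_span_closed) auto
  also have "pcomp Zinb 2 (leaves r) 2 (zinb_of (Succ Leaf Leaf)) (zinb_of r) = zinb_of (Succ Leaf r)"
    by (subst zinb_of_graft) auto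
  finally have "pcomp Zinb (leaves r + 1) (leaves l) 1 (zinb_of (Succ Leaf r)) (zinb_of l)
      \<in> comb_span (leaves r + 1 + leaves l - 1)"
    using Succ.IH(1) pos by (intro comb_span_closed) auto
  also have "pcomp Zinb (leaves r + 1) (leaves l) 1 (zinb_of (Succ Leaf r)) (zinb_of l) = zinb_of (Succ l r)"
    by (subst zinb_of_graft) auto
  finally show ?case using Succ.prems by (simp add: add.commute)
qed

text \<open>All trees are compositions of the two generators, so closure under composition suffices.\<close>

lemma arity_space_Zinb_comb_span:
  assumes n: "1 \<le> n"
  shows "arity_space Zinb n = comb_span n"
proof
  show "comb_span n \<subseteq> arity_space Zinb n" by (rule comb_span_arity[OF n])
  show "arity_space Zinb n \<subseteq> comb_span n"
  proof
    fix x assume "x \<in> arity_space Zinb n"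
    then obtain F where F: "F \<in> arity_space Dend n" "x = abs_zinb F" by (auto simp: arity_space_Zinb)
    have "abs_zinb (Poly_Mapping.single \<pi> E) \<in> comb_span n"
      if "\<pi> permutes {1..n}" "E \<in> arity_space Dend_ns n" for \<pi> E
    proof -
      have q: "qlinear (\<lambda>E. abs_zinb (Poly_Mapping.single \<pi> E))"
        by (rule qlinear_compose[OF qlinear_abs_zinb qlinear_single])
      have "abs_zinb (Poly_Mapping.single \<pi> (dend_of t)) \<in> comb_span n" if t: "leaves t = n" for t
      proof -
        have "abs_zinb (Poly_Mapping.single \<pi> (dend_of t)) = op_act Zinb n \<pi> (zinb_of t)"
          using abs_zinb_act[OF n \<open>\<pi> permutes {1..n}\<close> single_arity[OF n dend_of_arity[OF t] permutes_id]]
          by (simp add: op_act_Dend_single zinb_of_def)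
        then show ?thesis using comb_span_act[OF n \<open>\<pi> permutes {1..n}\<close> zinb_of_comb_span[OF t]] by simp
      qed
      moreover have "rat_vector.subspace {E. abs_zinb (Poly_Mapping.single \<pi> E) \<in> comb_span n}"
        unfolding rat_vector.subspace_def
        by (auto simp: qlinear_0[OF q] qlinear_add[OF q] qlinear_scale[OF q] rat_vector.subspace_0[OF subspace_comb_span]
            rat_vector.subspace_add[OF subspace_comb_span] rat_vector.subspace_scale[OF subspace_comb_span]
            simp del: single_zero)
      ultimately have "rat_vector.span (dend_of ` {t. leaves t = n}) \<subseteq> {E. abs_zinb (Poly_Mapping.single \<pi> E) \<in> comb_span n}"
        by (intro rat_vector.span_minimal) auto
      then show ?thesis using that(2) by (auto simp: arity_space_Dend_ns_span)
    qed
    then have "(\<Sum>\<pi>\<in>Poly_Mapping.keys F. abs_zinb (Poly_Mapping.single \<pi> (Poly_Mapping.lookup F \<pi>))) \<in> comb_span n"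
      using F(1) by (intro rat_vector.subspace_sum[OF subspace_comb_span]) (auto simp: Dend_simps)
    also have "(\<Sum>\<pi>\<in>Poly_Mapping.keys F. abs_zinb (Poly_Mapping.single \<pi> (Poly_Mapping.lookup F \<pi>))) = x"
      unfolding F(2) qlinear_sum[OF qlinear_abs_zinb, symmetric] sum_singles ..
    finally show "x \<in> comb_span n" .
  qed
qed

text \<open>Evaluated at letters, a comb is a word and its form is a coefficient of the expansion of \<open>s\<close>.\<close>

lemma zinb_form_basis:
  assumes "1 \<le> n" "\<pi> permutes {1..n}"
  shows "zinb_form s n (zinb_basis n \<pi>) (\<lambda>i. word [i]) = word_sum s (word ((n + 1) # map \<pi> [1..<n + 1]))"
proof -
  have a: "zinb_basis n \<pi> = abs_zinb (Poly_Mapping.single \<pi> (dend_of (right_comb (n - 1))))"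
    using abs_zinb_act[OF assms single_arity[OF assms(1) dend_of_arity permutes_id], of "right_comb (n - 1)"] assms(1)
    by (simp add: zinb_basis_def zinb_of_def op_act_Dend_single)
  have "n - 1 + 2 = n + 1" using assms(1) by simp
  then have "zinb_eval (zinb_basis n \<pi>) (\<lambda>i. word [i]) = word (map \<pi> [1..<n + 1])"
    using tree_eval_right_comb[of "n - 1" \<pi>] by (simp add: a zinb_eval_abs comp_def del: upt_Suc)
  then show ?thesis using assms(1) by (simp add: zinb_form_def letter_half_shuffle del: upt_Suc)
qed

end

section \<open>Multilinear Lie elements\<close>

definition multilinear :: "nat \<Rightarrow> bracketing set" where
  "multilinear N = {t. distinct (letters t) \<and> set (letters t) = {1..N}}"

lemma Lie_span: "Lie N = rat_vector.span (lie_of ` multilinear N)"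
proof
  show "Lie N \<subseteq> rat_vector.span (lie_of ` multilinear N)"
  proof
    fix y assume "y \<in> Lie N"
    then obtain x where x: "y = lin_ext lie_of x" "\<forall>t\<in>Poly_Mapping.keys x. t \<in> multilinear N"
      by (auto simp: Lie_def abs_free_lie_eq multilinear_def)
    show "y \<in> rat_vector.span (lie_of ` multilinear N)"
      unfolding x(1)
      by (rule lin_ext_in_subspace[OF rat_vector.subspace_span], rule rat_vector.span_base)
        (use x(2) in auto)
  qed
  have "rat_vector.subspace (Lie N)"
    unfolding Lie_def by (rule qlinear_subspace_image[OF qlinear_abs_free_lie subspace_keys])
  moreover have "lie_of t \<in> Lie N" if "t \<in> multilinear N" for t
    using that unfolding Lie_def lie_of_def multilinear_def by (intro imageI) auto
  ultimately show "rat_vector.span (lie_of ` multilinear N) \<subseteq> Lie N"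
    by (intro rat_vector.span_minimal) auto
qed

lemma subspace_Lie: "rat_vector.subspace (Lie N)"
  unfolding Lie_span by simp

lemma lie_of_Lie: "t \<in> multilinear N \<Longrightarrow> lie_of t \<in> Lie N"
  unfolding Lie_span by (intro rat_vector.span_base imageI)

lemma Lie_eqI:
  assumes "qlinear f" "qlinear g" "x \<in> Lie N" "\<And>t. t \<in> multilinear N \<Longrightarrow> f (lie_of t) = g (lie_of t)"
  shows "f x = g x"
proof -
  have "rat_vector.subspace {x. f x = g x}" by (rule subspace_eq[OF assms(1,2)])
  then have "rat_vector.span (lie_of ` multilinear N) \<subseteq> {x. f x = g x}"
    by (rule rat_vector.span_minimal[rotated]) (use assms(4) in auto)
  then show ?thesis using assms(3) by (auto simp: Lie_span)
qed

lemma qlinear_lie_word_sum_left: "qlinear (\<lambda>x. lie_word_sum x f)"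
  by (rule qlinear_compose[OF qlinear_apply qlinear_lie_word_sum])

lemma qlinear_lie_word_sum_right: "qlinear (lie_word_sum x)"
proof (rule qlinearI)
  show "lie_word_sum x (f + g) = lie_word_sum x f + lie_word_sum x g" for f g
    by transfer (rule qlinear_add[OF qlinear_lin_ext_word_sum])
  show "lie_word_sum x (c *\<^sub>Q f) = c *\<^sub>Q lie_word_sum x f" for c f
    by transfer (rule qlinear_scale[OF qlinear_lin_ext_word_sum])
qed

text \<open>The permutation in one-line notation.\<close>

definition line :: "nat \<Rightarrow> (nat \<Rightarrow> nat) \<Rightarrow> nat list" where
  "line n \<pi> = map \<pi> [1..<n + 1]"

lemma line_eq_iff:
  assumes "\<pi> permutes {1..n}" "\<rho> permutes {1..n}"
  shows "line n \<pi> = line n \<rho> \<longleftrightarrow> \<pi> = \<rho>"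
proof
  assume "line n \<pi> = line n \<rho>"
  then have "\<pi> i = \<rho> i" if "i \<in> {1..n}" for i
    using that unfolding line_def map_eq_conv by (auto simp del: upt_Suc)
  moreover have "\<pi> i = \<rho> i" if "i \<notin> {1..n}" for i
    using that assms by (simp add: permutes_not_in)
  ultimately show "\<pi> = \<rho>" by blast
qed simp

lemma set_line: "\<pi> permutes {1..n} \<Longrightarrow> set (line n \<pi>) = {1..n}"
  using permutes_image[of \<pi> "{1..n}"] by (simp add: line_def atLeastLessThanSuc_atLeastAtMost del: upt_Suc)

lemma distinct_line: "\<pi> permutes {1..n} \<Longrightarrow> distinct (line n \<pi>)"
  using permutes_inj_on[of \<pi> "{1..n}" "{1..n}"]
  by (simp add: line_def distinct_map atLeastLessThanSuc_atLeastAtMost del: upt_Suc)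

lemma line_surj:
  assumes "distinct v" "set v = {1..n}"
  obtains \<pi> where "\<pi> permutes {1..n}" "line n \<pi> = v"
proof -
  have len: "length v = n" using distinct_card[OF assms(1)] assms(2) by simp
  define \<pi> where "\<pi> i = (if i \<in> {1..n} then v ! (i - 1) else i)" for i
  have "\<pi> ` {1..n} = set v"
  proof
    show "\<pi> ` {1..n} \<subseteq> set v" using len by (auto simp: \<pi>_def)
    show "set v \<subseteq> \<pi> ` {1..n}"
    proof
      fix x assume "x \<in> set v"
      then obtain k where "k < n" "v ! k = x" using len by (auto simp: in_set_conv_nth)
      then have "x = \<pi> (k + 1)" "k + 1 \<in> {1..n}" by (auto simp: \<pi>_def)
      then show "x \<in> \<pi> ` {1..n}" by blast
    qed
  qed
  then have im: "\<pi> ` {1..n} = {1..n}" using assms(2) by simp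
  then have "bij_betw \<pi> {1..n} {1..n}" by (simp add: bij_betw_def eq_card_imp_inj_on)
  then have "\<pi> permutes {1..n}" by (rule bij_imp_permutes) (simp add: \<pi>_def del: atLeastAtMost_iff)
  moreover have "line n \<pi> = v"
    by (rule nth_equalityI) (auto simp: line_def len \<pi>_def simp del: upt_Suc)
  ultimately show ?thesis by (rule that)
qed

definition multilinear_words :: "nat \<Rightarrow> nat list set" where
  "multilinear_words N = {w. distinct w \<and> set w = {1..N}}"

lemma finite_multilinear_words: "finite (multilinear_words N)"
proof (rule finite_subset)
  show "multilinear_words N \<subseteq> {w. set w \<subseteq> {1..N} \<and> length w = N}"
    using distinct_card by (fastforce simp: multilinear_words_def)
qed (simp add: finite_lists_length_eq)

lemma multilinear_word_sum:
  assumes "t \<in> multilinear N"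
  shows "word_sum t f = (\<Sum>w\<in>multilinear_words N. word_sum t (word w) *\<^sub>Q f w)"
  by (rule word_sum_word_expand[OF finite_multilinear_words])
    (use assms in \<open>auto simp: multilinear_def multilinear_words_def dest: mset_eq_setD mset_eq_imp_distinct_iff\<close>)

abbreviation perms :: "nat \<Rightarrow> (nat \<Rightarrow> nat) set" where
  "perms n \<equiv> {\<pi>. \<pi> permutes {1..n}}"

lemma words_leading:
  "{w \<in> multilinear_words (n + 1). hd w = n + 1} = (\<lambda>\<pi>. (n + 1) # line n \<pi>) ` perms n"
proof
  show "(\<lambda>\<pi>. (n + 1) # line n \<pi>) ` perms n \<subseteq> {w \<in> multilinear_words (n + 1). hd w = n + 1}"
    by (auto simp: multilinear_words_def set_line distinct_line)
  show "{w \<in> multilinear_words (n + 1). hd w = n + 1} \<subseteq> (\<lambda>\<pi>. (n + 1) # line n \<pi>) ` perms n"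
  proof
    fix w assume w: "w \<in> {w \<in> multilinear_words (n + 1). hd w = n + 1}"
    then obtain v where v: "w = (n + 1) # v" by (cases w) (auto simp: multilinear_words_def)
    then have "insert (n + 1) (set v) = {1..n + 1}" "n + 1 \<notin> set v" "distinct v"
      using w by (auto simp: multilinear_words_def)
    then have "set v = {1..n + 1} - {n + 1}" by blast
    also have "{1..n + 1} - {n + 1} = {1..n}" by auto
    finally obtain \<pi> where "\<pi> permutes {1..n}" "line n \<pi> = v"
      by (rule line_surj[OF \<open>distinct v\<close>])
    then show "w \<in> (\<lambda>\<pi>. (n + 1) # line n \<pi>) ` perms n" using v by auto
  qed
qed

definition lie_basis :: "nat \<Rightarrow> (nat \<Rightarrow> nat) \<Rightarrow> bracketing" where
  "lie_basis n \<pi> = left_comb (n + 1) (line n \<pi>)"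

lemma lie_basis_multilinear: "\<pi> permutes {1..n} \<Longrightarrow> lie_basis n \<pi> \<in> multilinear (n + 1)"
  by (auto simp: lie_basis_def multilinear_def set_line distinct_line)

lemma lie_basis_coefficient:
  assumes "\<pi> permutes {1..n}" "\<rho> permutes {1..n}"
  shows "word_sum (lie_basis n \<pi>) (word (Suc n # line n \<rho>)) = (if \<pi> = \<rho> then 1 else 0)"
  using assms by (simp add: lie_basis_def left_comb_coefficient set_line line_eq_iff)

text \<open>Of the words of the expansion only those beginning with \<open>n + 1\<close> count, and these are indexed by the
  permutations of the first \<open>n\<close> letters.\<close>

lemma lie_of_expand:
  assumes "t \<in> multilinear (n + 1)"
  shows "lie_of t = (\<Sum>\<pi>\<in>perms n. word_sum t (word ((n + 1) # line n \<pi>)) *\<^sub>Q lie_of (lie_basis n \<pi>))"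
proof -
  let ?W = "multilinear_words (n + 1)"
  have inj: "inj_on (\<lambda>\<pi>. (n + 1) # line n \<pi>) (perms n)"
    by (rule inj_onI) (simp add: line_eq_iff)
  have "lie_of t = word_sum t (leading (n + 1))"
    using assms by (intro lie_of_eq_word_sum) (auto simp: multilinear_def)
  also have "\<dots> = (\<Sum>w\<in>?W. word_sum t (word w) *\<^sub>Q leading (n + 1) w)"
    by (rule multilinear_word_sum[OF assms])
  also have "\<dots> = (\<Sum>w\<in>{w \<in> ?W. hd w = n + 1}. word_sum t (word w) *\<^sub>Q leading (n + 1) w)"
    by (rule sum.mono_neutral_right[OF finite_multilinear_words]) (auto simp: leading_def)
  also have "\<dots> = (\<Sum>\<pi>\<in>perms n. word_sum t (word ((n + 1) # line n \<pi>)) *\<^sub>Q lie_of (lie_basis n \<pi>))"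
    unfolding words_leading sum.reindex[OF inj] by (simp add: leading_def lie_basis_def)
  finally show ?thesis .
qed

lemma Lie_expand:
  assumes "x \<in> Lie (n + 1)"
  shows "x = (\<Sum>\<pi>\<in>perms n. lie_word_sum x (word ((n + 1) # line n \<pi>)) *\<^sub>Q lie_of (lie_basis n \<pi>))"
proof (rule Lie_eqI[OF _ _ assms, of "\<lambda>x. x"])
  show "qlinear (\<lambda>x. \<Sum>\<pi>\<in>perms n. lie_word_sum x (word ((n + 1) # line n \<pi>)) *\<^sub>Q lie_of (lie_basis n \<pi>))"
    by (intro qlinear_compose_sum ballI qlinear_scaleQ_left qlinear_lie_word_sum_left)
  show "qlinear (\<lambda>x::free_lie. x)" by (rule qlinear_ident)
  show "lie_of t = (\<Sum>\<pi>\<in>perms n. lie_word_sum (lie_of t) (word ((n + 1) # line n \<pi>)) *\<^sub>Q lie_of (lie_basis n \<pi>))"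
    if "t \<in> multilinear (n + 1)" for t
    unfolding lie_word_sum_lie_of by (rule lie_of_expand[OF that])
qed

text \<open>The restriction to Lie elements of the scalar product for which the words are orthonormal.\<close>

definition lie_form :: "free_lie \<Rightarrow> free_lie \<Rightarrow> rat" where
  "lie_form x y = lie_word_sum y (\<lambda>u. lie_word_sum x (word u))"

lemma lie_form_lie_of: "lie_form x (lie_of t) = lie_word_sum x (\<lambda>w. word_sum t (word w))"
proof -
  have "lie_form x (lie_of t) = lie_word_sum x (word_sum t word)"
    unfolding lie_form_def by (simp add: word_sum_linear[OF qlinear_lie_word_sum_right])
  also have "word_sum t word = (\<lambda>w. word_sum t (word w))"
  proof
    fix w
    have "word_sum t word w = word_sum t (\<lambda>u. word u w)" by (rule word_sum_linear[OF qlinear_apply])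
    also have "(\<lambda>u. word u w) = word w" by (auto simp: word_def fun_eq_iff)
    finally show "word_sum t word w = word_sum t (word w)" .
  qed
  finally show ?thesis .
qed

lemma qlinear_lie_form_right: "qlinear (lie_form x)"
  unfolding lie_form_def by (rule qlinear_lie_word_sum_left)

text \<open>The form at \<open>(x, x)\<close> is the sum of the squares of the coefficients of \<open>x\<close>, and some of these
  coefficients determine \<open>x\<close>.\<close>

lemma lie_form_definite:
  assumes x: "x \<in> Lie (n + 1)" and "lie_form x x = 0"
  shows "x = 0"
proof -
  let ?W = "multilinear_words (n + 1)"
  have e: "lie_word_sum x f = (\<Sum>w\<in>?W. lie_word_sum x (word w) *\<^sub>Q f w)" for f :: word_fun
  proof (rule Lie_eqI[OF qlinear_lie_word_sum_left _ x])
    show "qlinear (\<lambda>x. \<Sum>w\<in>?W. lie_word_sum x (word w) *\<^sub>Q f w)"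
      by (intro qlinear_compose_sum ballI qlinear_scaleQ_left qlinear_lie_word_sum_left)
  qed (unfold lie_word_sum_lie_of, rule multilinear_word_sum)
  have "(\<Sum>w\<in>?W. lie_word_sum x (word w) * lie_word_sum x (word w)) = 0"
    using assms(2) unfolding lie_form_def by (subst (asm) e) simp
  then have "lie_word_sum x (word w) = 0" if "w \<in> ?W" for w
    using that by (subst (asm) sum_nonneg_eq_0_iff) (auto simp: finite_multilinear_words)
  moreover have "(n + 1) # line n \<pi> \<in> ?W" if "\<pi> \<in> perms n" for \<pi>
    using that words_leading by blast
  ultimately have "(\<Sum>\<pi>\<in>perms n. lie_word_sum x (word ((n + 1) # line n \<pi>)) *\<^sub>Q lie_of (lie_basis n \<pi>)) = 0"
    by (intro sum.neutral) simp
  then show ?thesis using Lie_expand[OF x] by simp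
qed

lemma qlinear_lie_act: "qlinear (lie_act \<sigma>)"
  by (rule qlinearI; transfer) (simp_all add: linear_rename_add linear_rename_scale lie_ideal.zero)

lemma lie_act_lie_of [simp]: "lie_act \<sigma> (lie_of t) = lie_of (rename \<sigma> t)"
  by (simp add: lie_of_def lie_act.abs_eq basis_vec_def linear_rename_single)

lemma letters_rename: "letters (rename \<sigma> t) = map \<sigma> (letters t)"
  by (induction t) auto

lemma rename_multilinear:
  assumes "\<sigma> permutes {1..N}" "t \<in> multilinear N"
  shows "rename \<sigma> t \<in> multilinear N"
  using assms permutes_image[OF assms(1)] permutes_inj_on[OF assms(1)]
  by (auto simp: multilinear_def letters_rename distinct_map)

lemma lie_act_Lie:
  assumes "\<sigma> permutes {1..N}" "x \<in> Lie N"
  shows "lie_act \<sigma> x \<in> Lie N"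
proof -
  have "linear_between UNIV UNIV (lie_act \<sigma>)"
    by (simp add: linear_between_def qlinear_add[OF qlinear_lie_act] qlinear_scale[OF qlinear_lie_act])
  then show ?thesis
  proof (rule linear_between_span[OF _ rat_vector.subspace_UNIV subset_UNIV assms(2)[unfolded Lie_span] subspace_Lie])
    fix y assume "y \<in> lie_of ` multilinear N"
    then show "lie_act \<sigma> y \<in> Lie N" using lie_of_Lie[OF rename_multilinear[OF assms(1)]] by auto
  qed
qed

lemma lie_word_sum_act: "lie_word_sum (lie_act \<sigma> x) f = lie_word_sum x (\<lambda>w. f (map \<sigma> w))"
proof -
  obtain p where p: "x = abs_free_lie p" by (metis Quotient_abs_rep[OF Quotient_free_lie])
  have "lie_word_sum (lie_act \<sigma> (lin_ext lie_of p)) f = lie_word_sum (lin_ext lie_of p) (\<lambda>w. f (map \<sigma> w))"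
    unfolding qlinear_lin_ext_swap[OF qlinear_compose[OF qlinear_lie_word_sum_left qlinear_lie_act]]
      qlinear_lin_ext_swap[OF qlinear_lie_word_sum_left]
    by (simp add: word_sum_rename)
  then show ?thesis by (simp add: p abs_free_lie_eq)
qed

lemma rename_comp: "rename \<sigma> (rename \<pi> t) = rename (\<sigma> \<circ> \<pi>) t"
  by (induction t) auto

lemma rename_id: "rename id t = t"
  by (induction t) auto

lemma Lie_sym_rep: "sym_rep N (Lie N) lie_act"
  unfolding sym_rep_def
proof (intro conjI allI impI ballI)
  show "rat_vector.subspace (Lie N)" by (rule subspace_Lie)
  show "linear_between (Lie N) (Lie N) (lie_act \<sigma>)" if "\<sigma> permutes {1..N}" for \<sigma>
    using that by (auto simp: linear_between_def lie_act_Lie qlinear_add[OF qlinear_lie_act] qlinear_scale[OF qlinear_lie_act])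
  show "lie_act id x = x" if "x \<in> Lie N" for x
    by (rule Lie_eqI[OF qlinear_lie_act _ that, of "\<lambda>x. x"]) (auto simp: rename_id intro: qlinearI)
  show "lie_act (\<sigma> \<circ> \<pi>) x = lie_act \<sigma> (lie_act \<pi> x)" if "x \<in> Lie N" for \<sigma> \<pi> x
    by (rule Lie_eqI[OF qlinear_lie_act qlinear_compose[OF qlinear_lie_act qlinear_lie_act] that])
      (simp add: rename_comp)
qed

section \<open>Renaming the letters of words\<close>

lemma tree_eval_map: "tree_eval t (\<lambda>i w. p i (map h w)) w = tree_eval t p (map h w)"
proof (induction t arbitrary: p w)
  case (Prec l r)
  have "tree_eval l (\<lambda>i w. p i (map h w)) = (\<lambda>w. tree_eval l p (map h w))"
    "tree_eval r (\<lambda>i w. p (i + leaves l) (map h w)) = (\<lambda>w. tree_eval r (\<lambda>i. p (i + leaves l)) (map h w))"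
    using Prec.IH by (auto simp: fun_eq_iff)
  then show ?case by (simp add: half_shuffle_map)
next
  case (Succ l r)
  have "tree_eval l (\<lambda>i w. p i (map h w)) = (\<lambda>w. tree_eval l p (map h w))"
    "tree_eval r (\<lambda>i w. p (i + leaves l) (map h w)) = (\<lambda>w. tree_eval r (\<lambda>i. p (i + leaves l)) (map h w))"
    using Succ.IH by (auto simp: fun_eq_iff)
  then show ?case by (simp add: half_shuffle_map)
qed simp

lemma dend_eval_map: "dend_eval d (\<lambda>i w. p i (map h w)) w = dend_eval d p (map h w)"
  by transfer (simp add: lin_ext_apply tree_eval_map)

lemma zinb_eval_map: "zinb_eval z (\<lambda>i w. p i (map h w)) = (\<lambda>w. zinb_eval z p (map h w))"
  unfolding zinb_eval_def sym_eval_def comp_def sum_apply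
  by (rule ext, rule sum.cong[OF refl], rule dend_eval_map)

section \<open>The isomorphism with the Lie module\<close>

context zinb_anticyclic
begin

abbreviation letter :: "nat \<Rightarrow> word_fun" where
  "letter i \<equiv> word [i]"

lemmas zinb_form_basis_line = zinb_form_basis[folded line_def]

text \<open>The left combs and the right combs are dual bases for the pairing of Lie elements with Zinbiel
  operations, so this pairing separates the latter.\<close>

lemma zinb_expand:
  assumes n: "1 \<le> n" and z: "z \<in> arity_space Zinb n"
  shows "z = (\<Sum>\<pi>\<in>perms n. zinb_form (lie_basis n \<pi>) n z letter *\<^sub>Q zinb_basis n \<pi>)"
proof -
  let ?e = "\<lambda>z. \<Sum>\<pi>\<in>perms n. zinb_form (lie_basis n \<pi>) n z letter *\<^sub>Q zinb_basis n \<pi>"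
  have q: "qlinear ?e"
    by (intro qlinear_compose_sum ballI qlinear_scaleQ_left qlinear_zinb_form)
  have "rat_vector.subspace {z. z = ?e z}"
    by (rule subspace_eq[OF qlinear_ident q])
  moreover have "zinb_basis n \<rho> = ?e (zinb_basis n \<rho>)" if "\<rho> \<in> perms n" for \<rho>
  proof -
    have "?e (zinb_basis n \<rho>) = (\<Sum>\<pi>\<in>perms n. if \<pi> = \<rho> then zinb_basis n \<rho> else 0)"
      using that by (intro sum.cong refl)
        (simp add: zinb_form_basis_line[OF n] lie_basis_coefficient scaleQ_one)
    then show ?thesis using that by (simp add: finite_permutations)
  qed
  ultimately have "rat_vector.span (zinb_basis n ` perms n) \<subseteq> {z. z = ?e z}"
    by (intro rat_vector.span_minimal image_subsetI CollectI)
  then have "z \<in> {z. z = ?e z}"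
    using z unfolding arity_space_Zinb_comb_span[OF n] comb_span_def by (rule subsetD)
  then show ?thesis by (rule CollectD)
qed

lemma zinb_eqI:
  assumes n: "1 \<le> n" and "y \<in> arity_space Zinb n" "z \<in> arity_space Zinb n"
    and "\<And>t. t \<in> multilinear (n + 1) \<Longrightarrow> zinb_form t n y letter = zinb_form t n z letter"
  shows "y = z"
proof -
  have "y = (\<Sum>\<pi>\<in>perms n. zinb_form (lie_basis n \<pi>) n y letter *\<^sub>Q zinb_basis n \<pi>)"
    by (rule zinb_expand) fact+
  also have "\<dots> = (\<Sum>\<pi>\<in>perms n. zinb_form (lie_basis n \<pi>) n z letter *\<^sub>Q zinb_basis n \<pi>)"
    by (intro sum.cong refl) (use assms(4)[OF lie_basis_multilinear] in simp)
  also have "\<dots> = z" by (rule zinb_expand[symmetric]) fact+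
  finally show ?thesis .
qed

text \<open>The operation that pairs with every Lie element \<open>y\<close> to \<open>lie_form x y\<close>.\<close>

definition lie_to_zinb :: "nat \<Rightarrow> free_lie \<Rightarrow> zinb" where
  "lie_to_zinb n x = (\<Sum>\<pi>\<in>perms n. lie_form x (lie_of (lie_basis n \<pi>)) *\<^sub>Q zinb_basis n \<pi>)"

lemma qlinear_lie_to_zinb: "qlinear (lie_to_zinb n)"
  unfolding lie_to_zinb_def lie_form_lie_of
  by (intro qlinear_compose_sum ballI qlinear_scaleQ_left qlinear_lie_word_sum_left)

lemma lie_to_zinb_arity: "1 \<le> n \<Longrightarrow> lie_to_zinb n x \<in> arity_space Zinb n"
  unfolding arity_space_Zinb_comb_span comb_span_def lie_to_zinb_def
  by (intro rat_vector.span_sum rat_vector.span_scale rat_vector.span_base) auto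

lemma zinb_form_lie_to_zinb:
  assumes n: "1 \<le> n" and t: "t \<in> multilinear (n + 1)"
  shows "zinb_form t n (lie_to_zinb n x) letter = lie_form x (lie_of t)"
proof -
  have "zinb_form t n (lie_to_zinb n x) letter
    = (\<Sum>\<pi>\<in>perms n. lie_form x (lie_of (lie_basis n \<pi>)) * word_sum t (word ((n + 1) # line n \<pi>)))"
    unfolding lie_to_zinb_def qlinear_sum[OF qlinear_zinb_form] qlinear_scale[OF qlinear_zinb_form]
    by (intro sum.cong refl) (simp add: zinb_form_basis_line[OF n])
  also have "\<dots> = lie_form x (\<Sum>\<pi>\<in>perms n. word_sum t (word ((n + 1) # line n \<pi>)) *\<^sub>Q lie_of (lie_basis n \<pi>))"
    unfolding qlinear_sum[OF qlinear_lie_form_right] qlinear_scale[OF qlinear_lie_form_right]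
    by (simp add: mult.commute)
  finally show ?thesis unfolding lie_of_expand[OF t, symmetric] .
qed

text \<open>If \<open>x\<close> is in the kernel, then \<open>lie_form x\<close> vanishes on Lie elements, in particular at \<open>x\<close>.\<close>

lemma lie_to_zinb_inj:
  assumes n: "1 \<le> n"
  shows "inj_on (lie_to_zinb n) (Lie (n + 1))"
proof (rule inj_onI)
  fix x y assume x: "x \<in> Lie (n + 1)" and y: "y \<in> Lie (n + 1)" and eq: "lie_to_zinb n x = lie_to_zinb n y"
  have z: "x - y \<in> Lie (n + 1)" by (rule rat_vector.subspace_diff[OF subspace_Lie x y])
  have "lie_to_zinb n (x - y) = 0" by (simp add: qlinear_diff[OF qlinear_lie_to_zinb] eq)
  then have "lie_form (x - y) (lie_of t) = 0" if "t \<in> multilinear (n + 1)" for t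
    using zinb_form_lie_to_zinb[OF n that, of "x - y"] by (simp add: qlinear_0[OF qlinear_zinb_form])
  then have "lie_form (x - y) (x - y) = 0"
    by (intro Lie_eqI[OF qlinear_lie_form_right _ z, of "\<lambda>_. 0"]) (auto intro: qlinearI)
  then show "x = y" using lie_form_definite[OF z] by simp
qed

text \<open>The images of the left combs are independent and as many as the right combs, which span the target.\<close>

lemma lie_to_zinb_image:
  assumes n: "1 \<le> n"
  shows "lie_to_zinb n ` Lie (n + 1) = arity_space Zinb n"
proof
  show "lie_to_zinb n ` Lie (n + 1) \<subseteq> arity_space Zinb n" using lie_to_zinb_arity[OF n] by auto
  let ?b = "\<lambda>\<pi>. lie_to_zinb n (lie_of (lie_basis n \<pi>))"
  have fin: "finite (perms n)" by (simp add: finite_permutations)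
  have mem: "lie_of (lie_basis n \<pi>) \<in> Lie (n + 1)" if "\<pi> \<in> perms n" for \<pi>
    using that lie_of_Lie[OF lie_basis_multilinear] by simp
  have zero: "c \<rho> = 0" if "(\<Sum>\<pi>\<in>perms n. c \<pi> *\<^sub>Q ?b \<pi>) = 0" "\<rho> \<in> perms n" for c \<rho>
  proof -
    let ?x = "\<Sum>\<pi>\<in>perms n. c \<pi> *\<^sub>Q lie_of (lie_basis n \<pi>)"
    have x: "?x \<in> Lie (n + 1)"
      by (intro rat_vector.subspace_sum[OF subspace_Lie] rat_vector.subspace_scale[OF subspace_Lie] mem)
    have "lie_to_zinb n ?x = lie_to_zinb n 0"
      using that(1) by (simp add: qlinear_sum[OF qlinear_lie_to_zinb] qlinear_scale[OF qlinear_lie_to_zinb]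
          qlinear_0[OF qlinear_lie_to_zinb])
    then have "?x = 0"
      using lie_to_zinb_inj[OF n] x rat_vector.subspace_0[OF subspace_Lie] by (auto dest: inj_onD)
    then have "0 = lie_word_sum ?x (word ((n + 1) # line n \<rho>))"
      by (simp add: qlinear_0[OF qlinear_lie_word_sum_left])
    also have "\<dots> = (\<Sum>\<pi>\<in>perms n. if \<pi> = \<rho> then c \<rho> else 0)"
      unfolding qlinear_sum[OF qlinear_lie_word_sum_left] qlinear_scale[OF qlinear_lie_word_sum_left]
      using that(2) by (intro sum.cong refl) (simp add: lie_basis_coefficient)
    also have "\<dots> = c \<rho>" using that(2) fin by simp
    finally show ?thesis by simp
  qed
  have injb: "inj_on ?b (perms n)"
  proof (rule inj_onI)
    fix \<pi> \<rho> assume p: "\<pi> \<in> perms n" "\<rho> \<in> perms n" "?b \<pi> = ?b \<rho>"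
    show "\<pi> = \<rho>"
    proof (rule ccontr)
      assume ne: "\<pi> \<noteq> \<rho>"
      \<comment> \<open>Two equal images would give a nontrivial linear relation.\<close>
      let ?c = "\<lambda>\<theta>. (if \<theta> = \<pi> then 1 else 0) - (if \<theta> = \<rho> then 1 else 0) :: rat"
      have "(\<Sum>\<theta>\<in>perms n. ?c \<theta> *\<^sub>Q ?b \<theta>)
          = (\<Sum>\<theta>\<in>perms n. if \<theta> = \<pi> then ?b \<pi> else 0) - (\<Sum>\<theta>\<in>perms n. if \<theta> = \<rho> then ?b \<rho> else 0)"
        unfolding sum_subtractf[symmetric]
        by (intro sum.cong refl) (auto simp: rat_vector.scale_left_diff_distrib scaleQ_one)
      also have "\<dots> = 0" using p fin by simp
      finally have "?c \<pi> = 0" by (rule zero) (rule p(1))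
      then show False using ne by simp
    qed
  qed
  have indep: "rat_vector.independent (?b ` perms n)"
  proof
    assume "rat_vector.dependent (?b ` perms n)"
    then obtain u where u: "\<exists>v\<in>?b ` perms n. u v \<noteq> 0" "(\<Sum>v\<in>?b ` perms n. u v *\<^sub>Q v) = 0"
      using fin by (auto simp: rat_vector.dependent_finite)
    have "(\<Sum>\<pi>\<in>perms n. u (?b \<pi>) *\<^sub>Q ?b \<pi>) = 0"
      using u(2) unfolding sum.reindex[OF injb] by (simp add: comp_def)
    then have "u (?b \<pi>) = 0" if "\<pi> \<in> perms n" for \<pi> by (rule zero) (rule that)
    then show False using u(1) by auto
  qed
  have sub: "?b ` perms n \<subseteq> rat_vector.span (zinb_basis n ` perms n)"
    using lie_to_zinb_arity[OF n] by (auto simp: arity_space_Zinb_comb_span[OF n] comb_span_def)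
  have card: "card (zinb_basis n ` perms n) \<le> card (?b ` perms n)"
    unfolding card_image[OF injb] by (rule card_image_le[OF fin])
  have "zinb_basis n ` perms n \<subseteq> rat_vector.span (?b ` perms n)"
    by (rule rat_vector.independent_span_eq[OF finite_imageI[OF fin] indep sub card])
  then have "rat_vector.span (zinb_basis n ` perms n) \<subseteq> rat_vector.span (?b ` perms n)"
    by (rule rat_vector.span_minimal[OF _ rat_vector.subspace_span])
  also have "\<dots> \<subseteq> lie_to_zinb n ` Lie (n + 1)"
  proof (rule rat_vector.span_minimal)
    show "?b ` perms n \<subseteq> lie_to_zinb n ` Lie (n + 1)" using mem by auto
    show "rat_vector.subspace (lie_to_zinb n ` Lie (n + 1))"
      by (rule qlinear_subspace_image[OF qlinear_lie_to_zinb subspace_Lie])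
  qed
  finally show "arity_space Zinb n \<subseteq> lie_to_zinb n ` Lie (n + 1)"
    by (simp add: arity_space_Zinb_comb_span[OF n] comb_span_def)
qed

lemma zinb_form_rename:
  assumes "\<sigma> permutes {1..N}"
  shows "zinb_form t n z (letter \<circ> \<sigma>) = zinb_form (rename (inv \<sigma>) t) n z letter"
proof -
  have "letter (\<sigma> i) w = letter i (map (inv \<sigma>) w)" for i w
    using permutes_inverses[OF assms] by (cases w) (auto simp: word_def)
  then have "letter \<circ> \<sigma> = (\<lambda>i w. letter i (map (inv \<sigma>) w))" by (auto simp: fun_eq_iff)
  then show ?thesis
    by (simp add: zinb_form_def zinb_eval_map[of z letter] word_sum_rename half_shuffle_map)
qed

text \<open>Both the scalar product and the pairing are invariant under simultaneous renaming of letters.\<close>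

lemma lie_to_zinb_equivariant:
  assumes n: "1 \<le> n" and \<sigma>: "\<sigma> permutes {1..n + 1}"
  shows "lie_to_zinb n (lie_act \<sigma> x) = cycZ n \<sigma> (lie_to_zinb n x)"
proof (rule zinb_eqI[OF n lie_to_zinb_arity[OF n] sym_rep_closed[OF Z.cyc_rep[OF n] \<sigma> lie_to_zinb_arity[OF n]]])
  fix t assume t: "t \<in> multilinear (n + 1)"
  have t': "rename (inv \<sigma>) t \<in> multilinear (n + 1)" by (rule rename_multilinear[OF permutes_inv[OF \<sigma>] t])
  have w: "word (map \<sigma> w) v = word w (map (inv \<sigma>) v)" for w v
  proof -
    have "v = map \<sigma> w \<longleftrightarrow> map (inv \<sigma>) v = w"
      using permutes_inv_o[OF \<sigma>] by (metis map_map list.map_id0 id_apply)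
    then show ?thesis by (simp add: word_def)
  qed
  have "zinb_form t n (lie_to_zinb n (lie_act \<sigma> x)) letter = lie_word_sum x (\<lambda>w. word_sum t (word (map \<sigma> w)))"
    by (simp add: zinb_form_lie_to_zinb[OF n t] lie_form_lie_of lie_word_sum_act)
  also have "\<dots> = lie_form x (lie_of (rename (inv \<sigma>) t))"
    by (simp add: lie_form_lie_of word_sum_rename flip: w)
  also have "\<dots> = zinb_form (rename (inv \<sigma>) t) n (lie_to_zinb n x) letter"
    by (rule zinb_form_lie_to_zinb[OF n t', symmetric])
  also have "\<dots> = zinb_form t n (cycZ n \<sigma> (lie_to_zinb n x)) letter"
    by (simp add: zinb_form_cyc[OF n lie_to_zinb_arity[OF n] \<sigma>] zinb_form_rename[OF \<sigma>])
  finally show "zinb_form t n (lie_to_zinb n (lie_act \<sigma> x)) letter = zinb_form t n (cycZ n \<sigma> (lie_to_zinb n x)) letter" .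
qed

lemma zinb_lie_iso:
  assumes n: "1 \<le> n"
  shows "sym_rep_iso (n + 1) (arity_space Zinb n) (cycZ n) (Lie (n + 1)) lie_act"
proof -
  let ?A = "arity_space Zinb n" and ?L = "Lie (n + 1)" and ?f = "lie_to_zinb n"
  define \<phi> where "\<phi> = inv_into ?L ?f"
  have bij: "bij_betw ?f ?L ?A"
    using lie_to_zinb_inj[OF n] lie_to_zinb_image[OF n] by (simp add: bij_betw_def)
  have \<phi>: "bij_betw \<phi> ?A ?L" unfolding \<phi>_def by (rule bij_betw_inv_into[OF bij])
  have mem: "\<phi> z \<in> ?L" and f: "?f (\<phi> z) = z" if "z \<in> ?A" for z
    using that bij_betw_apply[OF \<phi>] bij_betw_inv_into_right[OF bij] by (auto simp: \<phi>_def)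
  have eqI: "\<phi> z = x" if "x \<in> ?L" "?f x = z" for x z
    using that bij_betw_inv_into_left[OF bij] by (auto simp: \<phi>_def)
  have "\<phi> (y + z) = \<phi> y + \<phi> z" if "y \<in> ?A" "z \<in> ?A" for y z
    by (rule eqI[OF rat_vector.subspace_add[OF subspace_Lie mem mem]])
      (simp_all add: that f qlinear_add[OF qlinear_lie_to_zinb])
  moreover have "\<phi> (c *\<^sub>Q z) = c *\<^sub>Q \<phi> z" if "z \<in> ?A" for c z
    by (rule eqI[OF rat_vector.subspace_scale[OF subspace_Lie mem]])
      (simp_all add: that f qlinear_scale[OF qlinear_lie_to_zinb])
  ultimately have "linear_between ?A ?L \<phi>"
    unfolding linear_between_def using mem by blast
  moreover have "\<phi> (cycZ n \<sigma> z) = lie_act \<sigma> (\<phi> z)" if "\<sigma> permutes {1..n + 1}" "z \<in> ?A" for \<sigma> z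
    by (rule eqI[OF lie_act_Lie[OF that(1) mem[OF that(2)]]])
      (simp only: lie_to_zinb_equivariant[OF n that(1)] f[OF that(2)])
  ultimately show ?thesis
    unfolding sym_rep_iso_def using \<phi> Z.cyc_rep[OF n] Lie_sym_rep[of "n + 1"] by blast
qed

end

theorem theorem5p10:
  fixes \<tau> :: "nat \<Rightarrow> dend \<Rightarrow> dend"
    and cycD :: "nat \<Rightarrow> (nat \<Rightarrow> nat) \<Rightarrow> ((nat \<Rightarrow> nat) \<Rightarrow>\<^sub>0 dend) \<Rightarrow> ((nat \<Rightarrow> nat) \<Rightarrow>\<^sub>0 dend)"
    and cycZ :: "nat \<Rightarrow> (nat \<Rightarrow> nat) \<Rightarrow> zinb \<Rightarrow> zinb"
    and n :: nat
  assumes "ns_anticyclic_operad Dend_ns \<tau>"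
    and "\<forall>x\<in>arity_space Dend_ns 1. \<tau> 1 x = - x"
    and "\<tau> 2 dend_succ = dend_prec"
    and "\<tau> 2 dend_prec = - dend_prec - dend_succ"
    and "anticyclic_operad Dend cycD"
    and "\<forall>k\<ge>1. \<forall>E\<in>arity_space Dend_ns k.
      cycD k (long_cycle k) (Poly_Mapping.single id E) = Poly_Mapping.single id (\<tau> k E)"
    and "anticyclic_operad Zinb cycZ"
    and "anticyclic_morphism Dend cycD Zinb cycZ abs_zinb"
    and "n \<ge> 1"
  shows "sym_rep_iso (n + 1) (arity_space Zinb n) (cycZ n) (Lie (n + 1)) lie_act"
proof -
  interpret zinb_anticyclic \<tau> cycD cycZ
    using assms(1,3-8)
    by (intro zinb_anticyclic.intro dend_anticyclic.intro dend_anticyclic_axioms.intro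
        zinb_anticyclic_axioms.intro) auto
  show ?thesis by (rule zinb_lie_iso) fact
qed

end
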